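(* Let $d\ge 1$, let $\Omega\subset\mathbb{R}^d$ be an open, connected and bounded set with Lipschitz boundary, and let $K\colon\mathbb{R}^d\to[0,+\infty)$ be of the form $K(h)=\bar K(|h|)$, where $\bar K\colon[0,+\infty)\to[0,+\infty)$ is a measurable function such that $\int_0^{+\infty}\bar K(r)r^d\,\mathrm{d}r<+\infty$. Let $E\subset\mathbb{R}^d$ be Lebesgue measurable. Then: (i) there exists a family $\{E_\varepsilon\}_{\varepsilon>0}$ of measurable sets that converges to $E$ in $L^1_{\mathrm{loc}}(\mathbb{R}^d)$ as $\varepsilon\to0$ and such that $$\limsup_{\varepsilon\to0}\frac{1}{\varepsilon}J_\varepsilon(E_\varepsilon,\Omega)\le c_K\operatorname{Per}(E,\Omega);$$ (ii) if in addition $\bar K$ is strictly decreasing, then for any family $\{E_\varepsilon\}_{\varepsilon>0}$ of measurable sets that converges to $E$ in $L^1_{\mathrm{loc}}(\mathbb{R}^d)$ as $\varepsilon\to 0$, $$c_K\operatorname{Per}(E,\Omega)\le\liminf_{\varepsilon\to0}\frac{1}{2\varepsilon}J^1_\varepsilon(E_\varepsilon,\Omega).$$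
   Context: For $\varepsilon>0$ set $K_\varepsilon(h)=\varepsilon^{-d}K(h/\varepsilon)$. For a measurable set $E$ with characteristic function $\chi_E$ put $$J^1_\varepsilon(E,\Omega)=\int_\Omega\int_\Omega K_\varepsilon(y-x)|\chi_E(y)-\chi_E(x)|\,\mathrm{d}x\,\mathrm{d}y,\qquad J^2_\varepsilon(E,\Omega)=\int_\Omega\int_{\Omega^c}K_\varepsilon(y-x)|\chi_E(y)-\chi_E(x)|\,\mathrm{d}x\,\mathrm{d}y,$$ and $J_\varepsilon(E,\Omega)=\frac12J^1_\varepsilon(E,\Omega)+J^2_\varepsilon(E,\Omega)$. The constant is $c_K=\frac12\int_{\mathbb{R}^d}K(h)|h_d|\,\mathrm{d}h$, where $h_d$ is the last component of $h$. $\operatorname{Per}(E,\Omega)=|\mathrm{D}\chi_E|(\Omega)\in[0,+\infty]$ is the classical (De Giorgi) perimeter, i.e. the total variation in $\Omega$ of the distributional gradient of $\chi_E$ ($+\infty$ if $\chi_E\notin\mathrm{BV}(\Omega)$). $E_\varepsilon\to E$ in $L^1_{\mathrm{loc}}(\mathbb{R}^d)$ means $|(E_\varepsilon\triangle E)\cap C|\to0$ for every compact set $C$. *)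

theory Defs
  imports "HOL-Analysis.Analysis"
begin

definition scaled_kernel :: "(real ^ 'n \<Rightarrow> real) \<Rightarrow> real \<Rightarrow> real ^ 'n \<Rightarrow> real" where
  "scaled_kernel K \<epsilon> h = K (h /\<^sub>R \<epsilon>) / \<epsilon> ^ CARD('n)"

text \<open>The energies may be infinite, hence they take values in \<^typ>\<open>ennreal\<close>.\<close>

definition J1 :: "(real ^ 'n \<Rightarrow> real) \<Rightarrow> real \<Rightarrow> (real ^ 'n) set \<Rightarrow> (real ^ 'n) set \<Rightarrow> ennreal" where
  "J1 K \<epsilon> E \<Omega> =
    (\<integral>\<^sup>+y\<in>\<Omega>. (\<integral>\<^sup>+x\<in>\<Omega>. ennreal (scaled_kernel K \<epsilon> (y - x) *
        \<bar>indicat_real E y - indicat_real E x\<bar>) \<partial>lebesgue) \<partial>lebesgue)"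

definition J2 :: "(real ^ 'n \<Rightarrow> real) \<Rightarrow> real \<Rightarrow> (real ^ 'n) set \<Rightarrow> (real ^ 'n) set \<Rightarrow> ennreal" where
  "J2 K \<epsilon> E \<Omega> =
    (\<integral>\<^sup>+y\<in>\<Omega>. (\<integral>\<^sup>+x\<in>-\<Omega>. ennreal (scaled_kernel K \<epsilon> (y - x) *
        \<bar>indicat_real E y - indicat_real E x\<bar>) \<partial>lebesgue) \<partial>lebesgue)"

definition J :: "(real ^ 'n \<Rightarrow> real) \<Rightarrow> real \<Rightarrow> (real ^ 'n) set \<Rightarrow> (real ^ 'n) set \<Rightarrow> ennreal" where
  "J K \<epsilon> E \<Omega> = J1 K \<epsilon> E \<Omega> / 2 + J2 K \<epsilon> E \<Omega>"

text \<open>The last component of a vector is the one at the greatest index.\<close>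

definition c_K :: "(real ^ 'n::{finite,linorder} \<Rightarrow> real) \<Rightarrow> ennreal" where
  "c_K K = (\<integral>\<^sup>+h. ennreal (K h * \<bar>h $ Max UNIV\<bar>) \<partial>lebesgue) / 2"

text \<open>
  Test fields: continuously differentiable vector fields on the whole space whose support is
  compact and contained in \<open>\<Omega>\<close>.
\<close>

definition test_fields :: "(real ^ 'n) set \<Rightarrow> (real ^ 'n \<Rightarrow> real ^ 'n) set" where
  "test_fields \<Omega> = {\<phi>.
    (\<exists>\<phi>'. (\<forall>x. (\<phi> has_derivative blinfun_apply (\<phi>' x)) (at x)) \<and> continuous_on UNIV \<phi>') \<and>
    (\<exists>C. compact C \<and> C \<subseteq> \<Omega> \<and> (\<forall>x. x \<notin> C \<longrightarrow> \<phi> x = 0))}"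

definition divergence :: "(real ^ 'n \<Rightarrow> real ^ 'n) \<Rightarrow> real ^ 'n \<Rightarrow> real" where
  "divergence \<phi> x = (\<Sum>i\<in>UNIV. frechet_derivative \<phi> (at x) (axis i 1) $ i)"

text \<open>The distributional gradient of the characteristic function of \<open>E\<close>, paired with \<open>\<phi>\<close>.\<close>

definition distr_grad :: "(real ^ 'n) set \<Rightarrow> (real ^ 'n \<Rightarrow> real ^ 'n) \<Rightarrow> real" where
  "distr_grad E \<phi> = - (LINT x:E|lebesgue. divergence \<phi> x)"

text \<open>
  The perimeter as total variation of the distributional gradient.  The map \<^const>\<open>ennreal\<close> sends
  negative reals to \<open>0\<close>; this does not change the supremum, since \<open>\<phi> = 0\<close> is admissible.
\<close>

definition Per :: "(real ^ 'n) set \<Rightarrow> (real ^ 'n) set \<Rightarrow> ennreal" where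
  "Per E \<Omega> = (SUP \<phi>\<in>{\<phi> \<in> test_fields \<Omega>. \<forall>x. norm (\<phi> x) \<le> 1}. ennreal (distr_grad E \<phi>))"

text \<open>
  Near each boundary point, in Cartesian coordinates with axis \<open>\<nu>\<close>, the set is the part of
  a ball lying above the graph of a Lipschitz function \<open>g\<close>.  The remaining coordinates are
  represented by the orthogonal projection onto the hyperplane normal to \<open>\<nu>\<close>, on which
  \<open>g\<close> is defined.
\<close>

definition lipschitz_boundary :: "'a::euclidean_space set \<Rightarrow> bool" where
  "lipschitz_boundary \<Omega> \<longleftrightarrow>
    (\<forall>p\<in>frontier \<Omega>. \<exists>\<nu> r L g. norm \<nu> = 1 \<and> r > 0 \<and> L-lipschitz_on {z. z \<bullet> \<nu> = 0} g \<and>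
      \<Omega> \<inter> ball p r = {x \<in> ball p r. g (x - (x \<bullet> \<nu>) *\<^sub>R \<nu>) < x \<bullet> \<nu>})"

definition conv_L1_loc :: "(real \<Rightarrow> (real ^ 'n) set) \<Rightarrow> (real ^ 'n) set \<Rightarrow> bool" where
  "conv_L1_loc F E \<longleftrightarrow>
    (\<forall>C. compact C \<longrightarrow> ((\<lambda>\<epsilon>. emeasure lebesgue (sym_diff (F \<epsilon>) E \<inter> C)) \<longlongrightarrow> 0) (at_right 0))"

end

theory Submission
  imports Defs
begin

text \<open>
For a function \<open>u\<close> of class \<open>C\<^sup>1\<close> the rescaled energy
\<open>1/(2 \<epsilon>) \<integral>\<integral> K\<^sub>\<epsilon>(y - x) |u(y) - u(x)| dx dy\<close> is, after the substitution \<open>x = y + \<epsilon> h\<close>, an average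
over \<open>h\<close> of difference quotients of \<open>u\<close>. It converges to
\<open>1/2 \<integral> K(h) \<integral> |\<nabla>u(y) \<bullet> h| dy dh\<close>, which equals \<open>c\<^sub>K \<integral> |\<nabla>u|\<close> because \<open>K\<close> is radial
(\<open>nn_integral_kernel_directional\<close>). The perimeter is the corresponding limit of \<open>\<integral> |\<nabla>u\<^sub>\<eta>|\<close> for the
mollifications \<open>u\<^sub>\<eta> = \<chi>\<^sub>E * \<rho>\<^sub>\<eta>\<close>. Only two inequalities of this kind are used:
\<open>\<integral>\<^sub>S |\<nabla>u\<^sub>\<eta>| \<le> Per(E, \<Omega>)\<close> if the \<open>\<eta>\<close>-neighbourhood of \<open>S\<close> lies in a compact part of \<open>\<Omega>\<close>
(\<open>gradient_integral_le_Per\<close>), and conversely every test field gives at most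
\<open>\<integral>\<^sub>C |\<nabla>u\<^sub>\<eta>|\<close> plus a small error, where \<open>C\<close> contains its support (\<open>test_field_le_gradient_integral\<close>).
All passages between sets and smooth functions go through these mollifications.

Lower bound. The energy is convex and translation invariant, so mollifying \<open>E\<^sub>\<epsilon>\<close> at a fixed scale
\<open>\<eta>\<close> does not increase it, up to shrinking \<open>\<Omega>\<close> by \<open>2 \<eta>\<close> (\<open>mollified_difference_le\<close>). The
difference quotients of the mollified functions converge pointwise as \<open>\<epsilon> \<rightarrow> 0\<close>, and two applications of
Fatou's lemma, in \<open>x\<close> and in \<open>h\<close>, give \<open>c\<^sub>K \<integral>\<^sub>C |\<nabla>u\<^sub>\<eta>|\<close> as a lower bound for the limit inferior
(\<open>liminf_interaction_ge\<close>). It remains to let \<open>\<eta> \<rightarrow> 0\<close> and to take the supremum over the test fields.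

Upper bound. The term \<open>J\<^sup>2\<close> sees jumps of \<open>E\<close> across the boundary of \<open>\<Omega>\<close>, which \<open>Per(E, \<Omega>)\<close> does
not. The recovery sets therefore avoid such jumps: they are preimages of \<open>E\<close> under a deformation
\<open>\<Phi>\<^sub>t = id + t X\<close> that maps a neighbourhood of the closure of \<open>\<Omega>\<close> into \<open>\<Omega>\<close>. The field \<open>X\<close> is a finite sum of
bumps times the directions of the local graphs (\<open>inward_push_field\<close>). The perimeter of \<open>\<Phi>\<^sub>t\<^sup>-\<^sup>1(E)\<close>
near \<open>\<Omega>\<close> exceeds \<open>Per(E, \<Omega>)\<close> at most by a factor that tends to \<open>1\<close>, since
\<open>\<nabla>(u\<^sub>\<eta> \<circ> \<Phi>\<^sub>t)\<close> is controlled by \<open>\<nabla>u\<^sub>\<eta> \<circ> \<Phi>\<^sub>t\<close> and \<open>\<Phi>\<^sub>t\<^sup>-\<^sup>1\<close> has a Lipschitz constant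
close to \<open>1\<close>. Increments \<open>\<epsilon> h\<close> that stay inside the neighbourhood are bounded by integrating this
gradient along segments (\<open>short_range_energy_le\<close>), and longer increments contribute only a tail of the
convergent integral of \<open>K(h) |h|\<close> (\<open>long_range_energy_le\<close>). A diagonal choice \<open>t = t(\<epsilon>) \<rightarrow> 0\<close>
finishes the construction (\<open>recovery_family\<close>).
\<close>

section \<open>Lipschitz changes of variables\<close>

lemma nn_integral_lborel_shift:
  fixes a :: "'a::euclidean_space"
  assumes [measurable]: "f \<in> borel_measurable borel"
  shows "(\<integral>\<^sup>+x. f (a + x) \<partial>lborel) = (\<integral>\<^sup>+x. f x \<partial>lborel)"
  using nn_integral_distr[of "(+) a" lborel borel f] lborel_distr_plus[of a] by simp

lemma lborel_distr_uminus_euclidean: "distr lborel borel uminus = (lborel :: 'a::euclidean_space measure)"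
  by (subst lborel_affine[of "-1" 0]) (auto simp: density_1 one_ennreal_def[symmetric])

lemma nn_integral_lborel_reflect:
  fixes a :: "'a::euclidean_space"
  assumes [measurable]: "f \<in> borel_measurable borel"
  shows "(\<integral>\<^sup>+x. f (a - x) \<partial>lborel) = (\<integral>\<^sup>+x. f x \<partial>lborel)"
proof -
  have "(\<integral>\<^sup>+x. f (a - x) \<partial>lborel) = (\<integral>\<^sup>+x. f (a + x) \<partial>distr lborel borel uminus)"
    by (subst nn_integral_distr) auto
  then show ?thesis by (simp add: lborel_distr_uminus_euclidean nn_integral_lborel_shift)
qed

lemma nn_integral_lborel_scale:
  fixes f :: "'a::euclidean_space \<Rightarrow> ennreal"
  assumes [measurable]: "f \<in> borel_measurable borel" and "c > 0"
  shows "(\<integral>\<^sup>+x. f x \<partial>lborel) = ennreal (c ^ DIM('a)) * (\<integral>\<^sup>+x. f (c *\<^sub>R x) \<partial>lborel)"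
  using \<open>c > 0\<close>
  by (subst lborel_affine[of c 0]) (auto simp: nn_integral_density nn_integral_distr nn_integral_cmult)

lemma integral_lborel_shift:
  fixes f :: "'a::euclidean_space \<Rightarrow> 'b::{banach, second_countable_topology}"
  assumes [measurable]: "f \<in> borel_measurable borel"
  shows "(\<integral>x. f (a + x) \<partial>lborel) = (\<integral>x. f x \<partial>lborel)"
  using integral_distr[of "(+) a" lborel borel f] lborel_distr_plus[of a] by simp

lemma integral_lborel_reflect:
  fixes f :: "'a::euclidean_space \<Rightarrow> 'b::{banach, second_countable_topology}"
  assumes [measurable]: "f \<in> borel_measurable borel"
  shows "(\<integral>x. f (a - x) \<partial>lborel) = (\<integral>x. f x \<partial>lborel)"
proof -
  have "(\<integral>x. f (a - x) \<partial>lborel) = (\<integral>x. f (a + x) \<partial>distr lborel borel uminus)"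
    by (subst integral_distr) auto
  then show ?thesis by (simp add: lborel_distr_uminus_euclidean integral_lborel_shift)
qed

text \<open>
By Vitali's theorem an open superset of \<open>A\<close> consists, up to a null set, of disjoint balls
\<open>ball a r\<close>. The points that \<open>\<Phi>\<close> sends into such a ball lie in \<open>cball (\<Psi> a) (L * r)\<close>, whose volume is
\<open>L\<^sup>d\<close> times that of \<open>ball a r\<close>, and the null set is harmless because \<open>\<Psi>\<close> is Lipschitz. The
centre \<open>\<Psi> a\<close> gives the sharp constant \<open>L\<^sup>d\<close>; this sharpness makes the distortion factors of the
deformations below tend to \<open>1\<close>.
\<close>

lemma emeasure_lipschitz_preimage:
  fixes \<Phi> \<Psi> :: "'a::euclidean_space \<Rightarrow> 'a"
  assumes lip: "L-lipschitz_on UNIV \<Psi>" and inv: "\<And>x. \<Psi> (\<Phi> x) = x"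
    and meas: "\<Phi> \<in> borel_measurable borel" and A: "A \<in> sets borel"
  shows "emeasure lborel (\<Phi> -` A) \<le> ennreal (L ^ DIM('a)) * emeasure lborel A"
proof -
  have L0: "L \<ge> 0" using lip by (simp add: lipschitz_on_def)
  have lipD: "norm (\<Psi> x - \<Psi> y) \<le> L * norm (x - y)" for x y
    using lipschitz_onD[OF lip, of x y] by (simp add: dist_norm)
  have pre: "\<Phi> -` A \<in> sets borel" using measurable_sets[OF meas A] by simp
  have main: "emeasure lborel (\<Phi> -` A) \<le> ennreal (L ^ DIM('a)) * emeasure lborel G" if G: "open G" "A \<subseteq> G" for G
  proof -
    define K where "K = {(a::'a, r::real). r > 0 \<and> ball a r \<subseteq> G}"
    have cov: "\<exists>i. i \<in> K \<and> x \<in> ball (fst i) (snd i) \<and> snd i < d" if "x \<in> G" "0 < d" for x d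
    proof -
      obtain r where r: "r > 0" "ball x r \<subseteq> G" using G(1) \<open>x \<in> G\<close> by (meson open_contains_ball)
      have "ball x (min r (d/2)) \<subseteq> G" using r(2) by (meson min.cobounded1 order_trans subset_ball)
      then have "(x, min r (d/2)) \<in> K" using r(1) \<open>0<d\<close> by (simp add: K_def)
      moreover have "min r (d/2) < d" using \<open>0 < d\<close> by simp
      ultimately show ?thesis using r(1) \<open>0<d\<close> by (intro exI[of _ "(x, min r (d/2))"]) auto
    qed
    obtain C where C: "countable C" "C \<subseteq> K"
      "pairwise (\<lambda>i j. disjnt (ball (fst i) (snd i)) (ball (fst j) (snd j))) C"
      and neg: "negligible (G - (\<Union>i\<in>C. ball (fst i) (snd i)))"
      by (rule Vitali_covering_theorem_balls[of G K fst snd, OF cov]) (assumption | rule that; assumption)+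
    define N where "N = G - (\<Union>i\<in>C. ball (fst i) (snd i))"
    have negN: "negligible (\<Psi> ` N)"
      using neg unfolding N_def[symmetric]
      by (rule negligible_locally_Lipschitz_image[rotated]) (auto intro!: exI[of _ UNIV] exI[of _ L] lipD)
    define F where "F k = (if k \<in> to_nat_on C ` C then cball (\<Psi> (fst (from_nat_into C k))) (L * snd (from_nat_into C k)) else {})" for k
    define B where "B k = (if k \<in> to_nat_on C ` C then ball (fst (from_nat_into C k)) (snd (from_nat_into C k)) else {})" for k
    have sub: "\<Phi> -` A \<subseteq> \<Psi> ` N \<union> (\<Union>k. F k)"
    proof
      fix x assume "x \<in> \<Phi> -` A"
      then have "\<Phi> x \<in> G" using G(2) by auto
      show "x \<in> \<Psi> ` N \<union> (\<Union>k. F k)"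
      proof (cases "\<Phi> x \<in> N")
        case True then show ?thesis by (metis UnI1 imageI inv)
      next
        case False
        then obtain i where i: "i \<in> C" "\<Phi> x \<in> ball (fst i) (snd i)" using \<open>\<Phi> x \<in> G\<close> by (auto simp: N_def)
        have "norm (\<Psi> (fst i) - \<Psi> (\<Phi> x)) \<le> L * norm (fst i - \<Phi> x)" by (rule lipD)
        also have "\<dots> \<le> L * snd i" using i(2) L0 by (intro mult_left_mono) (auto simp: dist_norm)
        finally have "x \<in> cball (\<Psi> (fst i)) (L * snd i)" by (simp add: inv dist_norm)
        then have "x \<in> F (to_nat_on C i)" using i(1) C(1) by (simp add: F_def)
        then show ?thesis by blast
      qed
    qed
    have FU: "(\<Union>k. F k) \<in> sets borel" by (intro sets.countable_UN) (auto simp: F_def)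
    have emF: "emeasure lborel (F k) = ennreal (L ^ DIM('a)) * emeasure lborel (B k)" for k
    proof (cases "k \<in> to_nat_on C ` C")
      case True
      then have "from_nat_into C k \<in> K" using C by auto
      then have "snd (from_nat_into C k) > 0" by (auto simp: K_def)
      then show ?thesis using True L0
        by (simp add: F_def B_def emeasure_cball emeasure_ball ennreal_mult[symmetric] power_mult_distrib mult_ac)
    qed (simp add: F_def B_def)
    have disj: "disjoint_family B"
      unfolding disjoint_family_on_def
    proof (intro ballI impI)
      fix m n :: nat assume "m \<noteq> n"
      show "B m \<inter> B n = {}"
      proof (cases "m \<in> to_nat_on C ` C \<and> n \<in> to_nat_on C ` C")
        case True
        then obtain i j where ij: "i \<in> C" "j \<in> C" "m = to_nat_on C i" "n = to_nat_on C j" by auto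
        then have "i \<noteq> j" using \<open>m \<noteq> n\<close> by auto
        then show ?thesis using C(1,3) ij by (auto simp: B_def pairwise_def disjnt_def)
      qed (auto simp: B_def)
    qed
    have BG: "(\<Union>k. B k) \<subseteq> G"
    proof
      fix x assume "x \<in> (\<Union>k. B k)"
      then obtain k where "x \<in> B k" by auto
      then obtain i where "i \<in> C" "x \<in> ball (fst i) (snd i)" using C(1) by (auto simp: B_def split: if_splits)
      moreover have "ball (fst i) (snd i) \<subseteq> G" using subsetD[OF C(2) \<open>i \<in> C\<close>] by (simp add: K_def case_prod_beta)
      ultimately show "x \<in> G" by blast
    qed
    \<comment> \<open>The image of the null set need not be Borel, so the estimate passes through Lebesgue measure.\<close>
    have "emeasure lborel (\<Phi> -` A) = emeasure lebesgue (\<Phi> -` A)" using pre by simp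
    also have "\<dots> \<le> emeasure lebesgue (\<Psi> ` N \<union> (\<Union>k. F k))"
      using negN FU by (intro emeasure_mono sub sets.Un) (auto simp: negligible_iff_null_sets)
    also have "\<dots> = emeasure lebesgue (\<Union>k. F k)"
      using negN FU by (subst Un_commute, intro emeasure_Un_null_set) (auto simp: negligible_iff_null_sets)
    also have "\<dots> = emeasure lborel (\<Union>k. F k)" using FU by simp
    also have "\<dots> \<le> (\<Sum>k. emeasure lborel (F k))" by (intro emeasure_subadditive_countably) (auto simp: F_def)
    also have "\<dots> = ennreal (L ^ DIM('a)) * (\<Sum>k. emeasure lborel (B k))" by (simp add: emF)
    also have "(\<Sum>k. emeasure lborel (B k)) = emeasure lborel (\<Union>k. B k)"
      by (intro suminf_emeasure disj) (auto simp: B_def)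
    also have "\<dots> \<le> emeasure lborel G" using BG G(1) by (intro emeasure_mono) auto
    finally show ?thesis by (simp add: mult_left_mono)
  qed
  show ?thesis
  proof (rule ennreal_le_epsilon)
    fix e :: real assume "e > 0"
    define e' where "e' = e / (L ^ DIM('a) + 1)"
    have "L ^ DIM('a) \<ge> 0" using L0 by simp
    then have e': "e' > 0" "L ^ DIM('a) * e' \<le> e" using \<open>e > 0\<close> by (auto simp: e'_def field_simps)
    obtain G where G: "open G" "A \<subseteq> G" "emeasure lborel (G - A) < e'"
      using outer_regular_lborel[OF A e'(1)] by blast
    have "emeasure lborel G = emeasure lborel A + emeasure lborel (G - A)"
      using G A by (subst plus_emeasure) (auto simp: Un_absorb1)
    also have "\<dots> \<le> emeasure lborel A + ennreal e'" using G(3) by (intro add_left_mono) simp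
    finally have "ennreal (L ^ DIM('a)) * emeasure lborel G \<le> ennreal (L ^ DIM('a)) * (emeasure lborel A + ennreal e')"
      by (rule mult_left_mono) simp
    also have "\<dots> = ennreal (L ^ DIM('a)) * emeasure lborel A + ennreal (L ^ DIM('a) * e')"
      using L0 e'(1) by (simp add: distrib_left ennreal_mult[symmetric])
    also have "\<dots> \<le> ennreal (L ^ DIM('a)) * emeasure lborel A + ennreal e" using e'(2) by (intro add_left_mono ennreal_leI)
    finally show "emeasure lborel (\<Phi> -` A) \<le> ennreal (L ^ DIM('a)) * emeasure lborel A + ennreal e"
      using main[OF G(1,2)] by simp
  qed
qed

lemma nn_integral_lipschitz_substitution:
  fixes \<Phi> \<Psi> :: "'a::euclidean_space \<Rightarrow> 'a"
  assumes lip: "L-lipschitz_on UNIV \<Psi>" and inv: "\<And>x. \<Psi> (\<Phi> x) = x"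
    and [measurable]: "\<Phi> \<in> borel_measurable borel" "f \<in> borel_measurable borel"
  shows "(\<integral>\<^sup>+x. f (\<Phi> x) \<partial>lborel) \<le> ennreal (L ^ DIM('a)) * (\<integral>\<^sup>+x. f x \<partial>lborel)"
proof -
  have "(\<integral>\<^sup>+x. f (\<Phi> x) \<partial>lborel) = (\<integral>\<^sup>+x. f x \<partial>distr lborel borel \<Phi>)"
    by (subst nn_integral_distr) auto
  also have "\<dots> \<le> (\<integral>\<^sup>+x. f x \<partial>scale_measure (ennreal (L ^ DIM('a))) lborel)"
  proof (rule nn_integral_mono_measure)
    have "emeasure (distr lborel borel \<Phi>) A \<le> emeasure (scale_measure (ennreal (L ^ DIM('a))) lborel) A" for A
    proof (cases "A \<in> sets borel")
      case True
      then show ?thesis using emeasure_lipschitz_preimage[OF lip inv, of A] by (simp add: emeasure_distr)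
    qed (simp add: emeasure_notin_sets)
    then show "distr lborel borel \<Phi> \<le> scale_measure (ennreal (L ^ DIM('a))) lborel"
      by (auto simp: le_measure_iff le_fun_def space_scale_measure)
  qed simp
  also have "\<dots> = ennreal (L ^ DIM('a)) * (\<integral>\<^sup>+x. f x \<partial>lborel)" by (rule nn_integral_scale_measure) simp
  finally show ?thesis .
qed

text \<open>
A rotation and its inverse are both \<open>1\<close>-Lipschitz, so the preceding inequality holds in both
directions.
\<close>

lemma nn_integral_orthogonal:
  fixes T :: "real ^ 'n \<Rightarrow> real ^ 'n"
  assumes T: "orthogonal_transformation T" and [measurable]: "f \<in> borel_measurable borel"
  shows "(\<integral>\<^sup>+x. f (T x) \<partial>lborel) = (\<integral>\<^sup>+x. f x \<partial>lborel)"
proof -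
  have le: "(\<integral>\<^sup>+x. g (R x) \<partial>lborel) \<le> (\<integral>\<^sup>+x. g x \<partial>lborel)"
    if R: "orthogonal_transformation R" and [measurable]: "g \<in> borel_measurable borel" for R :: "real ^ 'n \<Rightarrow> real ^ 'n" and g :: "real ^ 'n \<Rightarrow> ennreal"
  proof -
    have Ri: "orthogonal_transformation (inv R)" by (rule orthogonal_transformation_inv[OF R])
    have lip: "1-lipschitz_on UNIV (inv R)"
      by (rule lipschitz_onI)
        (auto simp: dist_norm linear_diff[OF orthogonal_transformation_linear[OF Ri], symmetric]
          orthogonal_transformation_norm[OF Ri])
    have [measurable]: "R \<in> borel_measurable borel"
      by (intro borel_measurable_continuous_onI linear_continuous_on linear_conv_bounded_linear[THEN iffD1]
          orthogonal_transformation_linear R)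
    have "inv R (R x) = x" for x using orthogonal_transformation_inj[OF R] by simp
    from nn_integral_lipschitz_substitution[OF lip this, where f = g]
    show ?thesis by simp
  qed
  have [measurable]: "T \<in> borel_measurable borel"
    by (intro borel_measurable_continuous_onI linear_continuous_on linear_conv_bounded_linear[THEN iffD1]
        orthogonal_transformation_linear T)
  have "T (inv T x) = x" for x
    using orthogonal_transformation_surj[OF T] by (simp add: surj_f_inv_f)
  then have "(\<integral>\<^sup>+x. f x \<partial>lborel) = (\<integral>\<^sup>+x. f (T (inv T x)) \<partial>lborel)" by simp
  also have "\<dots> \<le> (\<integral>\<^sup>+x. f (T x) \<partial>lborel)"
    by (rule le[OF orthogonal_transformation_inv[OF T], where g = "\<lambda>x. f (T x)"]) simp
  finally show ?thesis using le[OF T] by (simp add: antisym)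
qed

section \<open>Radial kernels\<close>

text \<open>
Integration in polar coordinates for radial functions: the two measures agree on all half-lines
\<open>{..a}\<close> because the volume of a ball of radius \<open>a\<close> is the integral of its surface area.
\<close>

lemma distr_norm_lborel:
  "distr lborel borel (norm :: 'a::euclidean_space \<Rightarrow> real)
    = density lborel (\<lambda>r. ennreal (indicator {0..} r * (real DIM('a) * unit_ball_vol DIM('a) * r ^ (DIM('a) - 1))))"
    (is "?M = ?N")
proof (rule measure_eqI_generator_eq[where E = "range atMost" and \<Omega> = UNIV and A = "\<lambda>i::nat. {..real i}"])
  show "Int_stable (range atMost :: real set set)"
    by (auto simp: Int_stable_def)
  have sb: "sets borel = sigma_sets UNIV (range atMost :: real set set)"
    unfolding borel_eq_atMost by (simp add: image_def)
  then show "sets ?M = sigma_sets UNIV (range atMost)" "sets ?N = sigma_sets UNIV (range atMost)" by simp_all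
  have em: "emeasure ?M {..a} = (if a \<ge> 0 then ennreal (unit_ball_vol DIM('a) * a ^ DIM('a)) else 0)" for a
  proof -
    have "norm -` {..a} = cball (0::'a) a" by auto
    then show ?thesis by (subst emeasure_distr) (auto simp: emeasure_cball)
  qed
  show "emeasure ?M {..real i} \<noteq> \<infinity>" for i by (simp add: em)
  show "(\<Union>i. {..real i}) = (UNIV::real set)" using real_arch_simple by auto
  fix X :: "real set" assume "X \<in> range atMost"
  then obtain a where X: "X = {..a}" by auto
  let ?c = "real DIM('a) * unit_ball_vol DIM('a)"
  have c0: "?c \<ge> 0" by simp
  have "emeasure ?N X = (\<integral>\<^sup>+r. ennreal (indicator {0..} r * (?c * r ^ (DIM('a) - 1))) * indicator {..a} r \<partial>lborel)"
    by (simp add: X emeasure_density)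
  also have "\<dots> = (\<integral>\<^sup>+r. ennreal (?c * r ^ (DIM('a) - 1)) * indicator {0..a} r \<partial>lborel)"
    by (intro nn_integral_cong) (auto simp: indicator_def)
  also have "\<dots> = emeasure ?M X"
  proof (cases "a \<ge> 0")
    case True
    have "(\<integral>\<^sup>+r. ennreal (?c * r ^ (DIM('a) - 1)) * indicator {0..a} r \<partial>lborel)
      = ennreal (unit_ball_vol DIM('a) * a ^ DIM('a) - unit_ball_vol DIM('a) * 0 ^ DIM('a))"
    proof (rule nn_integral_FTC_Icc)
      fix x :: real assume "x \<in> {0..a}"
      then have "0 \<le> x" by simp
      show "((\<lambda>r. unit_ball_vol DIM('a) * r ^ DIM('a)) has_real_derivative ?c * x ^ (DIM('a) - 1)) (at x)"
        by (auto intro!: derivative_eq_intros)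
      show "0 \<le> ?c * x ^ (DIM('a) - 1)" using \<open>0 \<le> x\<close> by simp
    qed (use True in auto)
    then show ?thesis using True by (simp add: X em)
  qed (simp add: X em)
  finally show "emeasure ?M X = emeasure ?N X" by simp
qed auto

lemma nn_integral_radial:
  assumes [measurable]: "f \<in> borel_measurable borel"
  shows "(\<integral>\<^sup>+x. f (norm (x::'a::euclidean_space)) \<partial>lborel)
    = ennreal (real DIM('a) * unit_ball_vol DIM('a)) * (\<integral>\<^sup>+r\<in>{0..}. f r * ennreal (r ^ (DIM('a) - 1)) \<partial>lborel)"
proof -
  have "(\<integral>\<^sup>+x. f (norm (x::'a::euclidean_space)) \<partial>lborel) = (\<integral>\<^sup>+r. f r \<partial>distr lborel borel (norm :: 'a \<Rightarrow> real))"
    by (subst nn_integral_distr) auto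
  also have "\<dots> = (\<integral>\<^sup>+r. ennreal (indicator {0..} r * (real DIM('a) * unit_ball_vol DIM('a) * r ^ (DIM('a) - 1))) * f r \<partial>lborel)"
    unfolding distr_norm_lborel by (subst nn_integral_density) auto
  also have "\<dots> = (\<integral>\<^sup>+r. ennreal (real DIM('a) * unit_ball_vol DIM('a)) * (f r * ennreal (r ^ (DIM('a) - 1)) * indicator {0..} r) \<partial>lborel)"
    by (intro nn_integral_cong) (auto simp: indicator_def ennreal_mult' mult_ac)
  also have "\<dots> = ennreal (real DIM('a) * unit_ball_vol DIM('a)) * (\<integral>\<^sup>+r\<in>{0..}. f r * ennreal (r ^ (DIM('a) - 1)) \<partial>lborel)"
    by (rule nn_integral_cmult) measurable
  finally show ?thesis .
qed

text \<open>
A measurable radial profile is determined only up to a null set of radii; by this lemma that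
ambiguity is invisible for the kernel on the whole space.
\<close>

lemma null_set_norm_preimage:
  assumes "N \<in> null_sets (lborel :: real measure)"
  shows "(norm :: 'a::euclidean_space \<Rightarrow> real) -` N \<in> null_sets lborel"
proof -
  have N[measurable]: "N \<in> sets borel" and N0: "emeasure lborel N = 0" using assms by (auto simp: null_sets_def)
  have pre: "(norm :: 'a \<Rightarrow> real) -` N \<in> sets borel"
    using measurable_sets[of "norm :: 'a \<Rightarrow> real" borel borel N] by simp
  have "(\<integral>\<^sup>+x. indicator N (norm (x::'a)) \<partial>lborel) = (\<integral>\<^sup>+x. indicator ((norm :: 'a \<Rightarrow> real) -` N) x \<partial>lborel)"
    by (intro nn_integral_cong) (simp add: indicator_def)
  then have "emeasure lborel ((norm :: 'a \<Rightarrow> real) -` N) = (\<integral>\<^sup>+x. indicator N (norm (x::'a)) \<partial>lborel)"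
    using pre by simp
  also have "\<dots> = ennreal (real DIM('a) * unit_ball_vol DIM('a)) * (\<integral>\<^sup>+r\<in>{0..}. indicator N r * ennreal (r ^ (DIM('a) - 1)) \<partial>lborel)"
    by (rule nn_integral_radial) measurable
  also have "(\<integral>\<^sup>+r\<in>{0..}. indicator N r * ennreal (r ^ (DIM('a) - 1)) \<partial>lborel) = (\<integral>\<^sup>+r. 0 \<partial>(lborel::real measure))"
    using AE_not_in[OF assms] by (intro nn_integral_cong_AE) (auto elim!: eventually_mono)
  finally show ?thesis using pre by (simp add: null_sets_def)
qed

text \<open>
Rotating \<open>v\<close> onto the \<open>i\<close>-th axis does not change the integral because \<open>K\<close> is invariant under
rotations. Hence all directions see the same constant, and any coordinate may be used for \<open>c_K\<close>.
\<close>

lemma nn_integral_radial_directional: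
  fixes K :: "real ^ 'n \<Rightarrow> real"
  assumes [measurable]: "K \<in> borel_measurable borel" and K0: "\<And>h. K h \<ge> 0"
    and rad: "\<And>h. K h = k (norm h)"
  shows "(\<integral>\<^sup>+h. ennreal (K h * \<bar>v \<bullet> h\<bar>) \<partial>lborel) = ennreal (norm v) * (\<integral>\<^sup>+h. ennreal (K h * \<bar>h $ i\<bar>) \<partial>lborel)"
proof -
  have "norm (norm v *\<^sub>R axis i 1 :: real ^ 'n) = norm v" by simp
  then obtain T :: "real ^ 'n \<Rightarrow> real ^ 'n" where T: "orthogonal_transformation T" "T (norm v *\<^sub>R axis i 1) = v"
    by (rule orthogonal_transformation_exists) (rule that)
  have "(\<integral>\<^sup>+h. ennreal (K h * \<bar>v \<bullet> h\<bar>) \<partial>lborel) = (\<integral>\<^sup>+h. ennreal (K (T h) * \<bar>v \<bullet> T h\<bar>) \<partial>lborel)"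
    by (rule nn_integral_orthogonal[OF T(1), symmetric]) measurable
  also have "\<dots> = (\<integral>\<^sup>+h. ennreal (norm v) * ennreal (K h * \<bar>h $ i\<bar>) \<partial>lborel)"
  proof (rule nn_integral_cong)
    fix h
    have "v \<bullet> T h = (norm v *\<^sub>R axis i 1) \<bullet> h" using T unfolding orthogonal_transformation_def by metis
    also have "\<dots> = norm v * h $ i" by (simp add: inner_axis')
    finally have "v \<bullet> T h = norm v * h $ i" .
    moreover have "K (T h) = K h" by (simp add: rad orthogonal_transformation_norm[OF T(1)])
    ultimately show "ennreal (K (T h) * \<bar>v \<bullet> T h\<bar>) = ennreal (norm v) * ennreal (K h * \<bar>h $ i\<bar>)"
      using K0[of h] by (simp add: abs_mult ennreal_mult[symmetric] mult_ac)
  qed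
  also have "\<dots> = ennreal (norm v) * (\<integral>\<^sup>+h. ennreal (K h * \<bar>h $ i\<bar>) \<partial>lborel)"
    by (rule nn_integral_cmult) (auto simp: cart_eq_inner_axis intro!: measurable_compose[OF _ measurable_ennreal])
  finally show ?thesis .
qed

section \<open>The mollifier and convolutions with bounded functions\<close>

text \<open>
The error of the linearization is at most \<open>(s - t)\<^sup>2\<close>, also when \<open>s\<close> and \<open>t\<close> lie on different
sides of the kink of \<open>max 0\<close>.
\<close>

lemma DERIV_max0_squared: "((\<lambda>t. (max 0 t)\<^sup>2) has_real_derivative 2 * max 0 t) (at t)"
proof -
  have est: "\<bar>(max 0 s)\<^sup>2 - (max 0 t)\<^sup>2 - 2 * max 0 t * (s - t)\<bar> \<le> (s - t)\<^sup>2" for s :: real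
  proof -
    consider "s > 0" "t > 0" | "s \<le> 0" "t > 0" | "s > 0" "t \<le> 0" | "s \<le> 0" "t \<le> 0" by linarith
    then show ?thesis
    proof cases
      case 1
      have "s\<^sup>2 - t\<^sup>2 - 2 * t * (s - t) = (s - t)\<^sup>2" by (simp add: power2_eq_square algebra_simps)
      then show ?thesis using 1 by simp
    next
      case 2
      have "0 \<le> t\<^sup>2 - 2 * t * s" "t\<^sup>2 - 2 * t * s \<le> (s - t)\<^sup>2"
        using 2 mult_nonneg_nonpos[of t s] by (auto simp: power2_eq_square algebra_simps)
      moreover have "- t\<^sup>2 - 2 * t * (s - t) = t\<^sup>2 - 2 * t * s" by (simp add: power2_eq_square algebra_simps)
      ultimately show ?thesis using 2 by simp
    next
      case 3
      have "s\<^sup>2 \<le> (s - t)\<^sup>2" using 3 by (intro power_mono) auto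
      then show ?thesis using 3 by simp
    qed auto
  qed
  show ?thesis
    unfolding has_field_derivative_def has_derivative_at_alt
  proof (intro conjI allI impI)
    fix e :: real assume "e > 0"
    show "\<exists>d>0. \<forall>y. norm (y - t) < d \<longrightarrow> norm ((max 0 y)\<^sup>2 - (max 0 t)\<^sup>2 - 2 * max 0 t * (y - t)) \<le> e * norm (y - t)"
    proof (intro exI[of _ e] conjI allI impI \<open>e > 0\<close>)
      fix y assume y: "norm (y - t) < e"
      have "norm ((max 0 y)\<^sup>2 - (max 0 t)\<^sup>2 - 2 * max 0 t * (y - t)) \<le> \<bar>y - t\<bar> * \<bar>y - t\<bar>"
        using est[of y] by (simp add: power2_eq_square)
      also have "\<dots> \<le> e * norm (y - t)" using y by (intro mult_mono) auto
      finally show "norm ((max 0 y)\<^sup>2 - (max 0 t)\<^sup>2 - 2 * max 0 t * (y - t)) \<le> e * norm (y - t)" .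
    qed
  qed (rule bounded_linear_mult_right)
qed

text \<open>
Only first derivatives of mollified functions occur, so a bump of class \<open>C\<^sup>1\<close> suffices; the square
of a truncated paraboloid has an explicit gradient.
\<close>

definition bump :: "real \<Rightarrow> 'a::euclidean_space \<Rightarrow> real" where
  "bump \<eta> x = (max 0 (\<eta>\<^sup>2 - x \<bullet> x))\<^sup>2"

definition moll :: "real \<Rightarrow> 'a::euclidean_space \<Rightarrow> real" where
  "moll \<eta> x = bump \<eta> x / (\<integral>z. bump \<eta> (z::'a) \<partial>lborel)"

definition moll_grad :: "real \<Rightarrow> 'a::euclidean_space \<Rightarrow> 'a" where
  "moll_grad \<eta> x = (- 4 * max 0 (\<eta>\<^sup>2 - x \<bullet> x) / (\<integral>z. bump \<eta> (z::'a) \<partial>lborel)) *\<^sub>R x"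

lemma bump_nonneg: "bump \<eta> x \<ge> 0" by (simp add: bump_def)

lemma inner_self_gt: "norm x > \<eta> \<Longrightarrow> \<eta> > 0 \<Longrightarrow> \<eta>\<^sup>2 < x \<bullet> (x::'a::real_inner)"
  by (simp add: dot_square_norm power_strict_mono)

lemma bump_outside: "\<eta> > 0 \<Longrightarrow> norm x > \<eta> \<Longrightarrow> bump \<eta> x = 0"
  using inner_self_gt[of \<eta> x] by (simp add: bump_def)

lemma continuous_bump: "continuous_on S (bump \<eta>)"
  unfolding bump_def by (intro continuous_intros)

lemma integrable_continuous_compact_support:
  fixes f :: "'a::euclidean_space \<Rightarrow> 'b::euclidean_space"
  assumes "continuous_on UNIV f" "\<And>x. norm x > R \<Longrightarrow> f x = 0"
  shows "integrable lborel f"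
proof -
  have "set_integrable lborel (cball 0 R) f"
    unfolding set_integrable_def by (intro borel_integrable_compact continuous_on_subset[OF assms(1)]) auto
  moreover have "(\<lambda>x. indicator (cball 0 R) x *\<^sub>R f x) = f"
    using assms(2) by (force simp: indicator_def)
  ultimately show ?thesis by (simp add: set_integrable_def)
qed

lemma bump_mass_pos:
  assumes "\<eta> > 0" shows "(\<integral>z. bump \<eta> (z::'a::euclidean_space) \<partial>lborel) > 0"
proof -
  have int: "integrable lborel (bump \<eta> :: 'a \<Rightarrow> real)"
    by (rule integrable_continuous_compact_support[OF continuous_bump bump_outside[OF assms]])
  have "(\<integral>z. bump \<eta> (z::'a) \<partial>lborel) \<noteq> 0"
  proof
    assume "(\<integral>z. bump \<eta> (z::'a) \<partial>lborel) = 0"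
    then have "AE z in lborel. bump \<eta> (z::'a) = 0"
      using integral_nonneg_eq_0_iff_AE[OF int] bump_nonneg by auto
    then have "AE z in lborel. z \<notin> ball (0::'a) \<eta>"
    proof eventually_elim
      case (elim z)
      show ?case
      proof
        assume "z \<in> ball 0 \<eta>"
        then have "z \<bullet> z < \<eta>\<^sup>2" by (simp add: dot_square_norm power_strict_mono)
        then show False using elim by (simp add: bump_def)
      qed
    qed
    then have "emeasure lborel (ball (0::'a) \<eta>) = 0"
      by (subst (asm) AE_iff_measurable[of "ball (0::'a) \<eta>"]) auto
    then show False using assms unit_ball_vol_pos[of "real DIM('a)"] by (simp add: emeasure_ball)
  qed
  then show ?thesis using Bochner_Integration.integral_nonneg[of lborel "bump \<eta> :: 'a \<Rightarrow> real"] bump_nonneg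
    by (metis less_eq_real_def)
qed

lemma moll_nonneg: "\<eta> > 0 \<Longrightarrow> moll \<eta> (x::'a::euclidean_space) \<ge> 0"
  using bump_mass_pos[of \<eta>, where 'a='a] bump_nonneg[of \<eta> x]
  by (simp add: moll_def)

lemma moll_outside: "\<eta> > 0 \<Longrightarrow> norm x > \<eta> \<Longrightarrow> moll \<eta> x = 0"
  by (simp add: moll_def bump_outside)

lemma moll_grad_outside: "\<eta> > 0 \<Longrightarrow> norm x > \<eta> \<Longrightarrow> moll_grad \<eta> x = 0"
  using inner_self_gt[of \<eta> x] by (simp add: moll_grad_def)

lemma moll_grad_minus: "moll_grad \<eta> (- x) = - moll_grad \<eta> x" by (simp add: moll_grad_def)

lemma continuous_moll: "continuous_on S (moll \<eta>)"
  using continuous_bump[of S \<eta>] unfolding moll_def divide_inverse by (intro continuous_intros)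

lemma continuous_moll_grad: "continuous_on S (moll_grad \<eta>)"
  unfolding moll_grad_def divide_inverse by (intro continuous_intros)

lemma integrable_moll: "\<eta> > 0 \<Longrightarrow> integrable lborel (moll \<eta>)"
  by (rule integrable_continuous_compact_support[OF continuous_moll moll_outside])

lemma integral_moll: "\<eta> > 0 \<Longrightarrow> (\<integral>x. moll \<eta> (x::'a::euclidean_space) \<partial>lborel) = 1"
  using bump_mass_pos[of \<eta>, where 'a='a]
  unfolding moll_def[abs_def, where 'a='a] by simp

lemma nn_integral_moll: "\<eta> > 0 \<Longrightarrow> (\<integral>\<^sup>+x. ennreal (moll \<eta> (x::'a::euclidean_space)) \<partial>lborel) = 1"
  using nn_integral_eq_integral[OF integrable_moll[of \<eta>, where 'a='a]] integral_moll[of \<eta>, where 'a='a] moll_nonneg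
  by auto

lemma moll_has_derivative: "(moll \<eta> has_derivative (\<lambda>h. moll_grad \<eta> x \<bullet> h)) (at x)"
proof -
  let ?M = "\<integral>z. bump \<eta> (z::'a) \<partial>lborel"
  have 1: "((\<lambda>x. \<eta>\<^sup>2 - x \<bullet> x) has_derivative (\<lambda>h. - 2 * (x \<bullet> h))) (at x)"
    by (auto intro!: derivative_eq_intros simp: inner_commute)
  have "((\<lambda>x. (max 0 (\<eta>\<^sup>2 - x \<bullet> x))\<^sup>2) has_derivative (\<lambda>h. (2 * max 0 (\<eta>\<^sup>2 - x \<bullet> x)) * (- 2 * (x \<bullet> h)))) (at x)"
    using diff_chain_at[OF 1 DERIV_max0_squared[unfolded has_field_derivative_def, of "\<eta>\<^sup>2 - x \<bullet> x"]]
    by (simp add: o_def)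
  from has_derivative_mult_right[OF this, of "1 / ?M"] show ?thesis
    unfolding moll_def[abs_def] moll_grad_def
    by (simp add: bump_def[symmetric] mult_ac)
qed

text \<open>
The second factor may be vector-valued, so that the gradient of \<open>conv f g\<close> is again of this form,
with the gradient of \<open>g\<close> in place of \<open>g\<close>.
\<close>

definition conv :: "('a::euclidean_space \<Rightarrow> real) \<Rightarrow> ('a \<Rightarrow> 'b::euclidean_space) \<Rightarrow> 'a \<Rightarrow> 'b" where
  "conv f H x = (\<integral>z. f z *\<^sub>R H (x - z) \<partial>lborel)"

lemma bounded_continuous_compact_support:
  fixes H :: "'a::euclidean_space \<Rightarrow> 'b::real_normed_vector"
  assumes "continuous_on UNIV H" "\<And>x. norm x > R \<Longrightarrow> H x = 0"
  obtains B where "B > 0" "\<And>x. norm (H x) \<le> B"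
proof -
  have "bounded (H ` cball 0 R)"
    by (intro compact_imp_bounded compact_continuous_image continuous_on_subset[OF assms(1)]) auto
  then obtain B where B: "B > 0" "\<And>x. x \<in> cball 0 R \<Longrightarrow> norm (H x) \<le> B" by (auto simp: bounded_pos)
  show ?thesis
  proof (rule that[OF B(1)])
    fix x show "norm (H x) \<le> B" using B assms(2)[of x] by (cases "norm x \<le> R") auto
  qed
qed

lemma uniform_continuous_compact_support:
  fixes H :: "'a::euclidean_space \<Rightarrow> 'b::real_normed_vector"
  assumes "continuous_on UNIV H" "\<And>x. norm x > R \<Longrightarrow> H x = 0" "e > 0"
  obtains d where "d > 0" "d \<le> 1" "\<And>x y. norm (x - y) < d \<Longrightarrow> norm (H x - H y) < e"
proof -
  have "uniformly_continuous_on (cball 0 (R + 1)) H"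
    by (intro compact_uniformly_continuous continuous_on_subset[OF assms(1)]) auto
  then obtain d where d: "d > 0" "\<And>x y. x \<in> cball 0 (R+1) \<Longrightarrow> y \<in> cball 0 (R+1) \<Longrightarrow> dist y x < d \<Longrightarrow> dist (H y) (H x) < e"
    using \<open>e > 0\<close> unfolding uniformly_continuous_on_def by metis
  show ?thesis
  proof (rule that[of "min d 1"])
    fix x y :: 'a assume xy: "norm (x - y) < min d 1"
    show "norm (H x - H y) < e"
    proof (cases "norm x \<le> R + 1 \<and> norm y \<le> R + 1")
      case True then show ?thesis using d(2)[of y x] xy by (simp add: dist_norm)
    next
      case False
      have "norm x \<le> norm y + norm (x - y)" "norm y \<le> norm x + norm (x - y)"
        by (metis add.commute diff_add_cancel norm_triangle_ineq, metis norm_minus_commute norm_triangle_sub)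
      then have "norm x > R" "norm y > R" using xy False by auto
      then show ?thesis using assms by simp
    qed
  qed (use d in auto)
qed

lemma conv_integrable:
  fixes H :: "'a::euclidean_space \<Rightarrow> 'b::euclidean_space"
  assumes H: "continuous_on UNIV H" "\<And>x. norm x > R \<Longrightarrow> H x = 0"
    and [measurable]: "f \<in> borel_measurable borel" and f: "\<And>z. \<bar>f z\<bar> \<le> c"
  shows "integrable lborel (\<lambda>z. f z *\<^sub>R H (x - z))"
proof -
  obtain B where B: "B > 0" "\<And>x. norm (H x) \<le> B" using bounded_continuous_compact_support[OF H] by metis
  have [measurable]: "H \<in> borel_measurable borel" by (rule borel_measurable_continuous_onI[OF H(1)])
  have "integrable lborel (\<lambda>z. indicator (cball x R) z *\<^sub>R (c * B))"
    using emeasure_lborel_cball_finite[of x R]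
    by (intro integrable_real_indicator[THEN integrable_scaleR_left]) auto
  then show ?thesis
  proof (rule Bochner_Integration.integrable_bound)
    show "AE z in lborel. norm (f z *\<^sub>R H (x - z)) \<le> norm (indicator (cball x R) z *\<^sub>R (c * B))"
    proof (rule AE_I2)
      fix z
      have "\<bar>f z\<bar> * norm (H (x - z)) \<le> c * B"
        using f[of z] B by (intro mult_mono) auto
      then show "norm (f z *\<^sub>R H (x - z)) \<le> norm (indicator (cball x R) z *\<^sub>R (c * B))"
        using H(2)[of "x - z"] by (auto simp: indicator_def dist_norm)
    qed
  qed measurable
qed

lemma conv_norm_le:
  fixes H :: "'a::euclidean_space \<Rightarrow> 'b::euclidean_space"
  assumes [measurable]: "H \<in> borel_measurable borel" "f \<in> borel_measurable borel" and f: "\<And>z. \<bar>f z\<bar> \<le> 1"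
    and H: "\<And>z. norm (H z) \<le> indicator (cball 0 R) z * c" and c: "c \<ge> 0"
  shows "norm (conv f H x) \<le> c * measure lborel (cball (0::'a) R)"
proof -
  have 0: "integrable lborel (\<lambda>z. indicator (cball x R) z *\<^sub>R c)"
    using emeasure_lborel_cball_finite[of x R]
    by (intro integrable_real_indicator[THEN integrable_scaleR_left]) auto
  have b: "norm (f z *\<^sub>R H (x - z)) \<le> indicator (cball x R) z *\<^sub>R c" for z
  proof -
    have "norm (f z *\<^sub>R H (x - z)) \<le> 1 * norm (H (x - z))" using f[of z] mult_right_mono[of "\<bar>f z\<bar>" 1 "norm (H (x - z))"] by simp
    also have "\<dots> \<le> indicator (cball x R) z *\<^sub>R c" using H[of "x - z"] by (auto simp: indicator_def dist_norm norm_minus_commute split: if_splits)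
    finally show ?thesis .
  qed
  have "integrable lborel (\<lambda>z. f z *\<^sub>R H (x - z))"
  proof (rule Bochner_Integration.integrable_bound[OF 0])
    show "AE z in lborel. norm (f z *\<^sub>R H (x - z)) \<le> norm (indicator (cball x R) z *\<^sub>R c)"
      using b c by (auto intro!: AE_I2 order_trans[OF b])
  qed measurable
  then have "norm (conv f H x) \<le> (\<integral>z. indicator (cball x R) z *\<^sub>R c \<partial>lborel)"
    unfolding conv_def by (rule Bochner_Integration.integral_norm_bound_integral[OF _ 0]) (rule b)
  also have "\<dots> = c * measure lborel (cball x R)" by simp
  also have "measure lborel (cball x R) = measure lborel (cball (0::'a) R)"
    by (cases "R \<ge> 0") (auto simp: content_cball)
  finally show ?thesis .
qed

lemma conv_uniformly_continuous:
  fixes H :: "'a::euclidean_space \<Rightarrow> 'b::euclidean_space"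
  assumes H: "continuous_on UNIV H" "\<And>x. norm x > R \<Longrightarrow> H x = 0"
    and f: "f \<in> borel_measurable borel" "\<And>z. \<bar>f z\<bar> \<le> 1" and "e > 0"
  obtains d where "d > 0" "\<And>x y. norm (x - y) < d \<Longrightarrow> norm (conv f H x - conv f H y) \<le> e"
proof -
  define V where "V = measure lborel (cball (0::'a) (R + 1))"
  have V: "V \<ge> 0" by (simp add: V_def)
  have "e / (V + 1) > 0" using \<open>e > 0\<close> V by simp
  then obtain d where d: "d > 0" "d \<le> 1" "\<And>x y. norm (x - y) < d \<Longrightarrow> norm (H x - H y) < e / (V + 1)"
    using uniform_continuous_compact_support[OF H] by metis
  have [measurable]: "H \<in> borel_measurable borel" by (rule borel_measurable_continuous_onI[OF H(1)])
  show ?thesis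
  proof (rule that[OF d(1)])
    fix x y :: 'a assume xy: "norm (x - y) < d"
    define D where "D a = H (a + (x - y)) - H a" for a
    have "conv f H x - conv f H y = (\<integral>z. f z *\<^sub>R H (x - z) - f z *\<^sub>R H (y - z) \<partial>lborel)"
      unfolding conv_def by (subst Bochner_Integration.integral_diff) (auto intro: conv_integrable[OF H f])
    also have "\<dots> = conv f D y" by (simp add: conv_def D_def algebra_simps)
    also have "norm (conv f D y) \<le> e / (V + 1) * V"
      unfolding V_def
    proof (rule conv_norm_le)
      show "D \<in> borel_measurable borel" unfolding D_def by measurable
      fix z
      show "norm (D z) \<le> indicator (cball 0 (R + 1)) z * (e / (measure lborel (cball (0::'a) (R + 1)) + 1))"
      proof (cases "norm z \<le> R + 1")
        case True
        then show ?thesis using d(3)[of "z + (x - y)" z] xy by (simp add: D_def V_def)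
      next
        case False
        have "norm z \<le> norm (z + (x - y)) + norm (x - y)"
          using norm_triangle_ineq4[of "z + (x - y)" "x - y"] by simp
        then have "D z = 0" using False xy d(2) H(2) by (simp add: D_def)
        then show ?thesis using \<open>e > 0\<close> False by simp
      qed
    qed (use f V \<open>e > 0\<close> in \<open>auto simp: V_def\<close>)
    also have "\<dots> \<le> e" using V \<open>e > 0\<close> by (simp add: field_simps)
    finally show "norm (conv f H x - conv f H y) \<le> e" .
  qed
qed

lemma continuous_conv:
  fixes H :: "'a::euclidean_space \<Rightarrow> 'b::euclidean_space"
  assumes H: "continuous_on UNIV H" "\<And>x. norm x > R \<Longrightarrow> H x = 0"
    and f: "f \<in> borel_measurable borel" "\<And>z. \<bar>f z\<bar> \<le> 1"
  shows "continuous_on S (conv f H)"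
  unfolding continuous_on_iff
proof (intro ballI allI impI)
  fix x and e :: real assume "e > 0"
  then have "e / 2 > 0" by simp
  from conv_uniformly_continuous[OF H f this] obtain d
    where "d > 0" "\<And>x y. norm (x - y) < d \<Longrightarrow> norm (conv f H x - conv f H y) \<le> e / 2" by metis
  then show "\<exists>d>0. \<forall>x'\<in>S. dist x' x < d \<longrightarrow> dist (conv f H x') (conv f H x) < e"
    using \<open>e > 0\<close> by (force simp: dist_norm intro!: exI[of _ d])
qed

text \<open>
The threshold \<open>d\<close> depends on the modulus of continuity of \<open>G\<close> but neither on \<open>f\<close> nor on \<open>x\<close>. In
the lower bound the function \<open>f\<close> is the indicator of a set that varies with \<open>\<epsilon>\<close>, and this
uniformity keeps the difference quotients under control.
\<close>

lemma conv_linearization: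
  fixes g :: "'a::euclidean_space \<Rightarrow> real"
  assumes g: "\<And>x. (g has_derivative (\<lambda>h. G x \<bullet> h)) (at x)" "\<And>x. norm x > R \<Longrightarrow> g x = 0"
    and G: "continuous_on UNIV G" "\<And>x. norm x > R \<Longrightarrow> G x = 0" and "e > 0"
  obtains d where "d > 0" "\<And>f x h. f \<in> borel_measurable borel \<Longrightarrow> (\<And>z. \<bar>f z\<bar> \<le> 1) \<Longrightarrow> norm h < d \<Longrightarrow>
      \<bar>conv f g (x + h) - conv f g x - conv f G x \<bullet> h\<bar> \<le> e * norm h"
proof -
  define V where "V = measure lborel (cball (0::'a) (R + 1))"
  have V: "V \<ge> 0" by (simp add: V_def)
  have e': "e / (V + 1) > 0" using \<open>e > 0\<close> V by simp
  then obtain d where d: "d > 0" "d \<le> 1" "\<And>x y. norm (x - y) < d \<Longrightarrow> norm (G x - G y) < e / (V + 1)"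
    using uniform_continuous_compact_support[OF G] by metis
  have cg: "continuous_on UNIV g"
    by (rule has_derivative_continuous_on[OF has_derivative_at_withinI[OF g(1)]])
  have [measurable]: "G \<in> borel_measurable borel" by (rule borel_measurable_continuous_onI[OF G(1)])
  have [measurable]: "g \<in> borel_measurable borel" by (rule borel_measurable_continuous_onI[OF cg])
  show ?thesis
  proof (rule that[OF d(1)])
    fix f :: "'a \<Rightarrow> real" and x h :: 'a
    assume f: "f \<in> borel_measurable borel" "\<And>z. \<bar>f z\<bar> \<le> 1" and h: "norm h < d"
    define D where "D a = g (a + h) - g a - G a \<bullet> h" for a
    have i1: "integrable lborel (\<lambda>z. f z *\<^sub>R G (x - z) \<bullet> h)"
      by (intro integrable_inner_left conv_integrable[OF G f])
    have i2: "integrable lborel (\<lambda>z. f z * g (x + h - z))" "integrable lborel (\<lambda>z. f z * g (x - z))"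
      using conv_integrable[OF cg g(2) f] by auto
    have "conv f G x \<bullet> h = (\<integral>z. f z *\<^sub>R G (x - z) \<bullet> h \<partial>lborel)"
      unfolding conv_def by (rule integral_inner_left[symmetric]) (intro conv_integrable[OF G f])
    then have "conv f g (x + h) - conv f g x - conv f G x \<bullet> h
       = (\<integral>z. f z * g (x + h - z) - f z * g (x - z) - f z *\<^sub>R G (x - z) \<bullet> h \<partial>lborel)"
      using i1 i2 by (simp add: conv_def)
    also have "\<dots> = conv f D x" by (simp add: conv_def D_def algebra_simps)
    also have "norm (conv f D x) \<le> (e / (V + 1) * norm h) * V"
      unfolding V_def
    proof (rule conv_norm_le)
      show "D \<in> borel_measurable borel" unfolding D_def by measurable
      fix z
      show "norm (D z) \<le> indicator (cball 0 (R + 1)) z * (e / (measure lborel (cball (0::'a) (R + 1)) + 1) * norm h)"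
      proof (cases "norm z \<le> R + 1")
        case True
        have "norm (g (z + h) - g z - G z \<bullet> (z + h - z)) \<le> norm (z + h - z) * (e / (V + 1))"
        proof (rule differentiable_bound_linearization[where S = "ball z d" and f' = "\<lambda>x h. G x \<bullet> h"])
          fix t :: real assume "t \<in> {0..1}"
          then have "\<bar>t\<bar> * norm h \<le> 1 * norm h" by (intro mult_right_mono) auto
          then show "z + t *\<^sub>R (z + h - z) \<in> ball z d" using h by (simp add: dist_norm)
        next
          fix y assume "y \<in> ball z d"
          then have *: "norm (G y - G z) < e / (V + 1)" using d(3)[of y z] by (simp add: dist_norm norm_minus_commute)
          show "onorm ((\<lambda>h. G y \<bullet> h) - (\<lambda>h. G z \<bullet> h)) \<le> e / (V + 1)"
          proof (rule onorm_le)
            fix i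
            have "\<bar>(G y - G z) \<bullet> i\<bar> \<le> norm (G y - G z) * norm i" by (rule Cauchy_Schwarz_ineq2)
            also have "\<dots> \<le> e / (V + 1) * norm i" using * by (intro mult_right_mono) auto
            finally show "norm (((\<lambda>h. G y \<bullet> h) - (\<lambda>h. G z \<bullet> h)) i) \<le> e / (V + 1) * norm i" by (simp add: inner_diff_left)
          qed
        qed (use d(1) has_derivative_at_withinI[OF g(1)] in auto)
        then show ?thesis using True by (simp add: D_def V_def mult.commute)
      next
        case False
        have "norm z \<le> norm (z + h) + norm h"
          using norm_triangle_ineq4[of "z + h" "h"] by simp
        then have "D z = 0" using False h d(2) G(2) g(2) by (simp add: D_def)
        then show ?thesis using False by simp
      qed
    qed (use f V \<open>e > 0\<close> in \<open>auto simp: V_def\<close>)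
    also have "\<dots> \<le> e * norm h"
    proof -
      have "e / (V + 1) * V \<le> e" using V \<open>e > 0\<close> by (simp add: field_simps)
      from mult_right_mono[OF this norm_ge_zero[of h]] show ?thesis by (simp add: mult_ac)
    qed
    finally show "\<bar>conv f g (x + h) - conv f g x - conv f G x \<bullet> h\<bar> \<le> e * norm h" by simp
  qed
qed

lemma conv_has_derivative:
  fixes g :: "'a::euclidean_space \<Rightarrow> real"
  assumes g: "\<And>x. (g has_derivative (\<lambda>h. G x \<bullet> h)) (at x)" "\<And>x. norm x > R \<Longrightarrow> g x = 0"
    and G: "continuous_on UNIV G" "\<And>x. norm x > R \<Longrightarrow> G x = 0"
    and f: "f \<in> borel_measurable borel" "\<And>z. \<bar>f z\<bar> \<le> 1"
  shows "(conv f g has_derivative (\<lambda>h. conv f G x \<bullet> h)) (at x)"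
  unfolding has_derivative_at_alt
proof (intro conjI allI impI)
  fix e :: real assume "e > 0"
  from conv_linearization[OF g G this] obtain d where d: "d > 0" "\<And>f x h. f \<in> borel_measurable borel \<Longrightarrow> (\<And>z. \<bar>f z\<bar> \<le> 1) \<Longrightarrow> norm h < d \<Longrightarrow>
      \<bar>conv f g (x + h) - conv f g x - conv f G x \<bullet> h\<bar> \<le> e * norm h" by metis
  show "\<exists>d>0. \<forall>y. norm (y - x) < d \<longrightarrow> norm (conv f g y - conv f g x - conv f G x \<bullet> (y - x)) \<le> e * norm (y - x)"
  proof (intro exI[of _ d] conjI allI impI d(1))
    fix y assume "norm (y - x) < d"
    from d(2)[OF f this, of x] show "norm (conv f g y - conv f g x - conv f G x \<bullet> (y - x)) \<le> e * norm (y - x)" by simp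
  qed
qed (rule bounded_linear_inner_right)

section \<open>Mollified sets and their difference quotients\<close>

abbreviation mollified :: "real \<Rightarrow> 'a::euclidean_space set \<Rightarrow> 'a \<Rightarrow> real" where
  "mollified \<eta> E \<equiv> conv (indicat_real E) (moll \<eta>)"

abbreviation mollified_grad :: "real \<Rightarrow> 'a::euclidean_space set \<Rightarrow> 'a \<Rightarrow> 'a" where
  "mollified_grad \<eta> E \<equiv> conv (indicat_real E) (moll_grad \<eta>)"

abbreviation jump :: "'a::euclidean_space set \<Rightarrow> 'a \<Rightarrow> 'a \<Rightarrow> ennreal" where
  "jump E z y \<equiv> ennreal \<bar>indicat_real E y - indicat_real E (y + z)\<bar>"

lemma integral_moll_reflect: "\<eta> > 0 \<Longrightarrow> (\<integral>z. moll \<eta> (x - z) \<partial>lborel) = 1" for x :: "'a::euclidean_space"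
  using integral_lborel_reflect[of "moll \<eta>" x] integral_moll[of \<eta>, where 'a='a]
  by (simp add: borel_measurable_continuous_onI continuous_moll)

lemma borel_measurable_moll[measurable]: "moll \<eta> \<in> borel_measurable borel"
  by (rule borel_measurable_continuous_onI[OF continuous_moll])

lemma borel_measurable_moll_grad[measurable]: "moll_grad \<eta> \<in> borel_measurable borel"
  by (rule borel_measurable_continuous_onI[OF continuous_moll_grad])

lemma nn_integral_moll_translate: "\<eta> > 0 \<Longrightarrow> (\<integral>\<^sup>+x. ennreal (moll \<eta> (x - z)) \<partial>lborel) = 1" for z :: "'a::euclidean_space"
  using nn_integral_lborel_shift[of "\<lambda>z. ennreal (moll \<eta> z)" "- z"] nn_integral_moll[of \<eta>, where 'a='a] by simp

lemma integrable_moll_reflect: "\<eta> > 0 \<Longrightarrow> integrable lborel (\<lambda>z. moll \<eta> (x - z))" for x :: "'a::euclidean_space"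
  using conv_integrable[OF continuous_moll moll_outside, where f = "\<lambda>_. 1" and c = 1 and x = x] by simp

lemma integrable_conv_moll:
  fixes x :: "'a::euclidean_space"
  assumes "\<eta> > 0" "f \<in> borel_measurable borel" "\<And>z. \<bar>f z\<bar> \<le> c"
  shows "integrable lborel (\<lambda>z. f z * moll \<eta> (x - z))"
  using conv_integrable[OF continuous_moll moll_outside[OF assms(1)] assms(2,3)] by simp

text \<open>
Mollification is an average over a ball of radius \<open>\<eta>\<close>, so a bound for \<open>f - a\<close> on that ball
passes to the mollified function.
\<close>

lemma conv_moll_deviation:
  fixes x :: "'a::euclidean_space"
  assumes \<eta>: "\<eta> > 0" and f: "f \<in> borel_measurable borel" "\<And>z. \<bar>f z\<bar> \<le> c"
    and near: "\<And>z. norm (x - z) \<le> \<eta> \<Longrightarrow> \<bar>f z - a\<bar> \<le> e"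
  shows "\<bar>conv f (moll \<eta>) x - a\<bar> \<le> e"
proof -
  have "conv f (moll \<eta>) x - a = (\<integral>z. f z * moll \<eta> (x - z) - a * moll \<eta> (x - z) \<partial>lborel)"
    using \<eta> integrable_conv_moll[OF \<eta> f, of x] integrable_moll_reflect[OF \<eta>, of x]
    by (simp add: conv_def integral_moll_reflect)
  also have "\<bar>\<dots>\<bar> \<le> (\<integral>z. e * moll \<eta> (x - z) \<partial>lborel)"
  proof (subst real_norm_def[symmetric], rule Bochner_Integration.integral_norm_bound_integral)
    fix z
    show "norm (f z * moll \<eta> (x - z) - a * moll \<eta> (x - z)) \<le> e * moll \<eta> (x - z)"
    proof (cases "norm (x - z) \<le> \<eta>")
      case True
      have "norm (f z * moll \<eta> (x - z) - a * moll \<eta> (x - z)) = \<bar>f z - a\<bar> * moll \<eta> (x - z)"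
        using moll_nonneg[OF \<eta>, of "x - z"] by (simp add: left_diff_distrib[symmetric] abs_mult)
      also have "\<dots> \<le> e * moll \<eta> (x - z)" using near[OF True] moll_nonneg[OF \<eta>] by (rule mult_right_mono)
      finally show ?thesis .
    qed (use moll_outside[OF \<eta>, of "x - z"] in simp)
  qed (use \<eta> integrable_conv_moll[OF \<eta> f, of x] integrable_moll_reflect[OF \<eta>, of x] in auto)
  also have "\<dots> = e" using \<eta> by (simp add: integral_moll_reflect)
  finally show ?thesis .
qed

lemma conv_moll_abs_le:
  fixes x :: "'a::euclidean_space"
  assumes \<eta>: "\<eta> > 0" and f: "f \<in> borel_measurable borel" "\<And>z. \<bar>f z\<bar> \<le> c"
  shows "\<bar>conv f (moll \<eta>) x\<bar> \<le> c"
  using conv_moll_deviation[OF \<eta> f, of x 0 c] f(2) by simp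

lemma continuous_conv_moll:
  fixes f :: "'a::euclidean_space \<Rightarrow> real"
  assumes "\<eta> > 0" "f \<in> borel_measurable borel" "\<And>z. \<bar>f z\<bar> \<le> 1"
  shows "continuous_on S (conv f (moll \<eta>))"
  by (rule continuous_conv[OF continuous_moll moll_outside[OF assms(1)] assms(2,3)])

lemma continuous_conv_moll_grad:
  fixes f :: "'a::euclidean_space \<Rightarrow> real"
  assumes "\<eta> > 0" "f \<in> borel_measurable borel" "\<And>z. \<bar>f z\<bar> \<le> 1"
  shows "continuous_on S (conv f (moll_grad \<eta>))"
  by (rule continuous_conv[OF continuous_moll_grad moll_grad_outside[OF assms(1)] assms(2,3)])

lemma conv_moll_has_derivative:
  fixes f :: "'a::euclidean_space \<Rightarrow> real"
  assumes "\<eta> > 0" "f \<in> borel_measurable borel" "\<And>z. \<bar>f z\<bar> \<le> 1"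
  shows "(conv f (moll \<eta>) has_derivative (\<lambda>h. conv f (moll_grad \<eta>) x \<bullet> h)) (at x)"
  by (rule conv_has_derivative[OF moll_has_derivative moll_outside[OF assms(1)] continuous_moll_grad
        moll_grad_outside[OF assms(1)] assms(2,3)])

text \<open>
Young's inequality for the \<open>L\<^sup>1\<close> norm, by Tonelli's theorem.
\<close>

lemma nn_integral_conv_moll_le:
  fixes f :: "'a::euclidean_space \<Rightarrow> real"
  assumes \<eta>: "\<eta> > 0" and f[measurable]: "f \<in> borel_measurable borel" and "\<And>z. \<bar>f z\<bar> \<le> c"
  shows "(\<integral>\<^sup>+x. ennreal \<bar>conv f (moll \<eta>) x\<bar> \<partial>lborel) \<le> (\<integral>\<^sup>+z. ennreal \<bar>f z\<bar> \<partial>lborel)"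
proof -
  have "(\<integral>\<^sup>+x. ennreal \<bar>conv f (moll \<eta>) x\<bar> \<partial>lborel) \<le> (\<integral>\<^sup>+x. (\<integral>\<^sup>+z. ennreal \<bar>f z\<bar> * ennreal (moll \<eta> (x - z)) \<partial>lborel) \<partial>lborel)"
  proof (rule nn_integral_mono)
    fix x :: 'a
    have "ennreal \<bar>conv f (moll \<eta>) x\<bar> \<le> (\<integral>\<^sup>+z. ennreal (norm (f z *\<^sub>R moll \<eta> (x - z))) \<partial>lborel)"
      unfolding conv_def real_norm_def[symmetric]
      by (rule integral_norm_bound_ennreal) (use integrable_conv_moll[OF assms] in simp)
    then show "ennreal \<bar>conv f (moll \<eta>) x\<bar> \<le> (\<integral>\<^sup>+z. ennreal \<bar>f z\<bar> * ennreal (moll \<eta> (x - z)) \<partial>lborel)"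
      using moll_nonneg[OF \<eta>, where 'a='a] by (simp add: abs_mult ennreal_mult abs_of_nonneg)
  qed
  also have "\<dots> = (\<integral>\<^sup>+z. (\<integral>\<^sup>+x. ennreal \<bar>f z\<bar> * ennreal (moll \<eta> (x - z)) \<partial>lborel) \<partial>lborel)"
    by (rule lborel_pair.Fubini') measurable
  also have "\<dots> = (\<integral>\<^sup>+z. ennreal \<bar>f z\<bar> \<partial>lborel)"
    by (simp add: nn_integral_cmult nn_integral_moll_translate[OF \<eta>])
  finally show ?thesis .
qed

text \<open>
A Urysohn function between a closed subset and an open superset of \<open>A\<close> of almost the same measure.
\<close>

lemma approx_indicator_continuous:
  fixes A :: "'a::euclidean_space set"
  assumes A: "A \<in> sets borel" "bounded A" and "e > 0"
  obtains k :: "'a \<Rightarrow> real" and R where "continuous_on UNIV k" "\<And>x. 0 \<le> k x \<and> k x \<le> 1" "\<And>x. norm x > R \<Longrightarrow> k x = 0"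
    "(\<integral>\<^sup>+x. ennreal \<bar>indicator A x - k x\<bar> \<partial>lborel) \<le> ennreal e"
proof -
  obtain R where R: "A \<subseteq> ball 0 R" using A(2) by (meson bounded_subset_ballD)
  have e2: "e / 2 > 0" and Al: "A \<in> sets lebesgue" using \<open>e > 0\<close> A by auto
  obtain G where G: "open G" "A \<subseteq> G" "emeasure lborel (G - A) < ennreal (e/2)"
    by (rule outer_regular_lborel[OF A(1) e2]) (rule that)
  obtain C where C: "closed C" "C \<subseteq> A" "emeasure lebesgue (A - C) < ennreal (e/2)"
    by (rule sets_lebesgue_inner_closed[OF Al e2]) (rule that)
  have C3: "emeasure lborel (A - C) < ennreal (e/2)" using C A by simp
  let ?G = "G \<inter> ball 0 R"
  have CG: "C \<inter> - ?G = {}" using C(2) G(2) R by auto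
  have Gc: "closed (- ?G)" using G(1) by auto
  obtain k :: "'a \<Rightarrow> real" where k: "continuous_on UNIV k" "\<And>x. k x \<in> closed_segment 1 0"
    "\<And>x. x \<in> C \<Longrightarrow> k x = 1" "\<And>x. x \<in> - ?G \<Longrightarrow> k x = 0"
    by (rule Urysohn[OF C(1) Gc CG, of "1::real" 0]) (rule that)
  have k01: "0 \<le> k x \<and> k x \<le> 1" for x using k(2)[of x] by (auto simp: closed_segment_eq_real_ivl)
  have "(\<integral>\<^sup>+x. ennreal \<bar>indicator A x - k x\<bar> \<partial>lborel) \<le> (\<integral>\<^sup>+x. indicator (A - C) x + indicator (G - A) x \<partial>lborel)"
  proof (rule nn_integral_mono)
    fix x show "ennreal \<bar>indicator A x - k x\<bar> \<le> indicator (A - C) x + indicator (G - A) x"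
      using k01[of x] k(3,4)[of x] C(2) by (auto simp: indicator_def)
  qed
  also have "\<dots> = emeasure lborel (A - C) + emeasure lborel (G - A)"
  proof (subst nn_integral_add)
    show "indicator (A - C) \<in> borel_measurable lborel" "indicator (G - A) \<in> borel_measurable lborel"
      using A C G by (auto intro!: borel_measurable_indicator)
  qed (use A C G in auto)
  also have "\<dots> \<le> ennreal (e/2) + ennreal (e/2)" using C3 G(3) by (intro add_mono) auto
  also have "\<dots> = ennreal e" using \<open>e > 0\<close> by (simp add: ennreal_plus[symmetric] del: ennreal_plus)
  finally show ?thesis using that[OF k(1) k01, of R] k(4) by auto
qed

lemma conv_indicator_local:
  fixes x :: "'a::euclidean_space"
  assumes \<eta>: "\<eta> > 0" and AB: "\<And>z. norm (x - z) \<le> \<eta> \<Longrightarrow> z \<in> A \<longleftrightarrow> z \<in> B"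
  shows "mollified \<eta> A x = mollified \<eta> B x"
  unfolding conv_def
proof (rule Bochner_Integration.integral_cong)
  fix z show "indicat_real A z *\<^sub>R moll \<eta> (x - z) = indicat_real B z *\<^sub>R moll \<eta> (x - z)"
    using AB[of z] moll_outside[OF \<eta>, of "x - z"] by (cases "norm (x - z) \<le> \<eta>") (auto simp: indicator_def)
qed simp

text \<open>
On the given ball, \<open>A\<close> may be replaced by a bounded set and its indicator by a continuous function \<open>k\<close> that
is close in \<open>L\<^sup>1\<close>. Mollification does not increase the \<open>L\<^sup>1\<close> distance, and it converges uniformly on \<open>k\<close>.
\<close>

lemma mollify_L1_conv:
  fixes A :: "'a::euclidean_space set"
  assumes A: "A \<in> sets borel" and "e > 0"
  obtains \<eta>0 where "\<eta>0 > 0" "\<And>\<eta>. 0 < \<eta> \<Longrightarrow> \<eta> < \<eta>0 \<Longrightarrow>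
    (\<integral>\<^sup>+x\<in>cball 0 R. ennreal \<bar>mollified \<eta> A x - indicat_real A x\<bar> \<partial>lborel) \<le> ennreal e"
proof -
  define B where "B = A \<inter> cball 0 (R + 1)"
  have B[measurable]: "B \<in> sets borel" and "bounded B" using A by (auto simp: B_def bounded_Int)
  have e3: "e / 3 > 0" using \<open>e > 0\<close> by simp
  obtain k :: "'a \<Rightarrow> real" and R' where k: "continuous_on UNIV k" "\<And>x. 0 \<le> k x \<and> k x \<le> 1" "\<And>x. norm x > R' \<Longrightarrow> k x = 0"
    "(\<integral>\<^sup>+x. ennreal \<bar>indicat_real B x - k x\<bar> \<partial>lborel) \<le> ennreal (e/3)"
    by (rule approx_indicator_continuous[OF B \<open>bounded B\<close> e3]) (rule that)
  have [measurable]: "k \<in> borel_measurable borel" by (rule borel_measurable_continuous_onI[OF k(1)])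
  have k1: "\<bar>k x\<bar> \<le> 1" for x using k(2)[of x] by simp
  define V where "V = measure lborel (cball (0::'a) R)"
  have V: "V \<ge> 0" "emeasure lborel (cball (0::'a) R) = ennreal V"
    using emeasure_lborel_cball_finite[of "0::'a" R] by (auto simp: V_def emeasure_eq_ennreal_measure)
  \<comment> \<open>The summand \<open>1\<close> avoids a division by zero when the ball is degenerate.\<close>
  have e': "e / (3 * (V + 1)) > 0" using V \<open>e > 0\<close> by simp
  obtain d where d: "d > 0" "d \<le> 1" "\<And>x y. norm (x - y) < d \<Longrightarrow> norm (k x - k y) < e / (3 * (V + 1))"
    using uniform_continuous_compact_support[OF k(1,3) e'] by metis
  show ?thesis
  proof (rule that[OF d(1)])
    fix \<eta> :: real assume \<eta>: "0 < \<eta>" "\<eta> < d"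
    let ?m = "moll \<eta> :: 'a \<Rightarrow> real"
    define f where "f x = indicat_real B x - k x" for x
    have fm[measurable]: "f \<in> borel_measurable borel" unfolding f_def by measurable
    have f1: "\<bar>f z\<bar> \<le> 1" for z using k(2)[of z] by (auto simp: f_def indicator_def)
    define c where "c = conv f ?m"
    have k4: "(\<integral>\<^sup>+x. ennreal \<bar>f x\<bar> \<partial>lborel) \<le> ennreal (e/3)" using k(4) by (simp add: f_def)
    have ck: "\<bar>conv k ?m x - k x\<bar> \<le> e / (3 * (V + 1))" for x
    proof (rule conv_moll_deviation[OF \<eta>(1) _ k1])
      fix z assume "norm (x - z) \<le> \<eta>"
      then show "\<bar>k z - k x\<bar> \<le> e / (3 * (V + 1))" using d(3)[of z x] \<eta>(2) by (simp add: norm_minus_commute)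
    qed measurable
    have [measurable]: "c \<in> borel_measurable borel"
      unfolding c_def by (rule borel_measurable_continuous_onI[OF continuous_conv_moll[OF \<eta>(1) fm f1]])
    have "(\<integral>\<^sup>+x\<in>cball 0 R. ennreal \<bar>conv (indicat_real A) ?m x - indicat_real A x\<bar> \<partial>lborel)
      \<le> (\<integral>\<^sup>+x. ennreal \<bar>c x\<bar> + (ennreal \<bar>f x\<bar> + ennreal (e / (3 * (V + 1))) * indicator (cball 0 R) x) \<partial>lborel)"
    proof (rule nn_integral_mono)
      fix x :: 'a
      show "ennreal \<bar>conv (indicat_real A) ?m x - indicat_real A x\<bar> * indicator (cball 0 R) x
        \<le> ennreal \<bar>c x\<bar> + (ennreal \<bar>f x\<bar> + ennreal (e / (3 * (V + 1))) * indicator (cball 0 R) x)"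
      proof (cases "norm x \<le> R")
        case True
        have "conv (indicat_real A) ?m x = conv (indicat_real B) ?m x"
        proof (rule conv_indicator_local[OF \<eta>(1)])
          fix z assume "norm (x - z) \<le> \<eta>"
          moreover have "norm z \<le> norm x + norm (x - z)" by (metis norm_minus_commute norm_triangle_sub)
          ultimately show "z \<in> A \<longleftrightarrow> z \<in> B" using True \<eta> d(2) by (auto simp: B_def)
        qed
        moreover have "c x = conv (indicat_real B) ?m x - conv k ?m x"
        proof -
          have "integrable lborel (\<lambda>z. indicat_real B z * ?m (x - z))"
            by (rule integrable_conv_moll[OF \<eta>(1), where c = 1]) (auto simp: indicator_def)
          moreover have "integrable lborel (\<lambda>z. k z * ?m (x - z))"
            by (rule integrable_conv_moll[OF \<eta>(1) _ k1]) measurable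
          ultimately show ?thesis
            unfolding conv_def c_def f_def by (simp add: left_diff_distrib)
        qed
        moreover have "indicat_real A x = indicat_real B x" using True by (simp add: B_def indicator_def)
        ultimately have "\<bar>conv (indicat_real A) ?m x - indicat_real A x\<bar> \<le> \<bar>c x\<bar> + (\<bar>f x\<bar> + e / (3 * (V + 1)))"
          using ck[of x] unfolding f_def by linarith
        then have "ennreal \<bar>conv (indicat_real A) ?m x - indicat_real A x\<bar> \<le> ennreal (\<bar>c x\<bar> + (\<bar>f x\<bar> + e / (3 * (V + 1))))"
          by (rule ennreal_leI)
        also have "\<dots> = ennreal \<bar>c x\<bar> + (ennreal \<bar>f x\<bar> + ennreal (e / (3 * (V + 1))))"
          using e' by simp
        finally show ?thesis using True by simp
      qed simp
    qed
    also have "\<dots> = (\<integral>\<^sup>+x. ennreal \<bar>c x\<bar> \<partial>lborel) + ((\<integral>\<^sup>+x. ennreal \<bar>f x\<bar> \<partial>lborel) + ennreal (e / (3 * (V + 1))) * ennreal V)"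
    proof -
      have V': "(\<integral>\<^sup>+x. ennreal (e / (3 * (V + 1))) * indicator (cball (0::'a) R) x \<partial>lborel) = ennreal (e / (3 * (V + 1))) * ennreal V"
        unfolding V(2)[symmetric] by (rule nn_integral_cmult_indicator) simp
      have [measurable]: "cball (0::'a) R \<in> sets borel" by simp
      have m: "(\<lambda>x. ennreal \<bar>c x\<bar>) \<in> borel_measurable lborel" "(\<lambda>x. ennreal \<bar>f x\<bar>) \<in> borel_measurable lborel"
        "(\<lambda>x. ennreal (e / (3 * (V + 1))) * indicator (cball (0::'a) R) x) \<in> borel_measurable lborel"
        by measurable
      show ?thesis
        by (simp only: V' nn_integral_add[OF m(1) borel_measurable_add[OF m(2,3)]] nn_integral_add[OF m(2,3)])
    qed
    also have "\<dots> \<le> ennreal (e/3) + (ennreal (e/3) + ennreal (e/3))"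
    proof (intro add_mono k4)
      show "(\<integral>\<^sup>+x. ennreal \<bar>c x\<bar> \<partial>lborel) \<le> ennreal (e/3)"
        unfolding c_def by (rule order_trans[OF nn_integral_conv_moll_le[OF \<eta>(1) fm f1] k4])
      have "e / (3 * (V + 1)) * V \<le> e / 3" using V(1) \<open>e > 0\<close> by (simp add: field_simps)
      then show "ennreal (e / (3 * (V + 1))) * ennreal V \<le> ennreal (e / 3)"
        using e' V(1) by (simp add: ennreal_mult[symmetric] ennreal_leI)
    qed
    also have "\<dots> = ennreal e" using \<open>e > 0\<close> by (simp add: ennreal_plus[symmetric] del: ennreal_plus)
    finally show "(\<integral>\<^sup>+x\<in>cball 0 R. ennreal \<bar>conv (indicat_real A) ?m x - indicat_real A x\<bar> \<partial>lborel) \<le> ennreal e" .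
  qed
qed

text \<open>
The fundamental theorem of calculus on each segment from \<open>x\<close> to \<open>x + h\<close>, followed by Tonelli's
theorem: each translate of \<open>S\<close> by \<open>s h\<close> lies in \<open>U\<close>.
\<close>

lemma difference_le_directional_derivative:
  fixes w :: "'a::euclidean_space \<Rightarrow> real"
  assumes w: "\<And>x. (w has_derivative (\<lambda>h. D x \<bullet> h)) (at x)" and D: "continuous_on UNIV D"
    and [measurable]: "S \<in> sets borel" "U \<in> sets borel"
    and SU: "\<And>x s. x \<in> S \<Longrightarrow> 0 \<le> s \<Longrightarrow> s \<le> 1 \<Longrightarrow> x + s *\<^sub>R h \<in> U"
  shows "(\<integral>\<^sup>+x\<in>S. ennreal \<bar>w (x + h) - w x\<bar> \<partial>lborel) \<le> (\<integral>\<^sup>+x\<in>U. ennreal \<bar>D x \<bullet> h\<bar> \<partial>lborel)"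
proof -
  have [measurable]: "D \<in> borel_measurable borel" by (rule borel_measurable_continuous_onI[OF D])
  have pw: "ennreal \<bar>w (x + h) - w x\<bar> \<le> (\<integral>\<^sup>+s. ennreal \<bar>D (s *\<^sub>R h + x) \<bullet> h\<bar> * indicator {0..1} s \<partial>lborel)" for x
  proof -
    have der: "((\<lambda>s. w (x + s *\<^sub>R h)) has_vector_derivative D (x + s *\<^sub>R h) \<bullet> h) (at s within {0..1})" for s
    proof -
      have a1: "((\<lambda>s. x + s *\<^sub>R h) has_derivative (\<lambda>r. r *\<^sub>R h)) (at s)"
        by (rule has_derivative_eq_rhs, rule has_derivative_add[OF has_derivative_const has_derivative_scaleR_left[OF has_derivative_ident]]) simp
      show ?thesis
        unfolding has_vector_derivative_def
        by (rule has_derivative_eq_rhs, rule has_derivative_at_withinI, rule has_derivative_compose[OF a1 w]) (simp add: fun_eq_iff)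
    qed
    have cont: "continuous_on {0..1} (\<lambda>s. D (x + s *\<^sub>R h) \<bullet> h)"
    proof -
      have "continuous_on {0..1} (\<lambda>s. x + s *\<^sub>R h)" by (intro continuous_intros)
      then have "continuous_on {0..1} (\<lambda>s. D (x + s *\<^sub>R h))" by (rule continuous_on_compose2[OF D]) simp
      then show ?thesis by (rule continuous_on_inner[OF _ continuous_on_const])
    qed
    have int: "integrable lborel (\<lambda>s. indicator {0..1} s *\<^sub>R (D (x + s *\<^sub>R h) \<bullet> h))"
      by (rule borel_integrable_compact[OF _ cont]) auto
    have "w (x + h) - w x = (\<integral>s. indicator {0..1} s *\<^sub>R (D (x + s *\<^sub>R h) \<bullet> h) \<partial>lborel)"
      using integral_FTC_atLeastAtMost[OF zero_le_one der cont] by simp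
    also have "ennreal \<bar>\<dots>\<bar> \<le> (\<integral>\<^sup>+s. ennreal (norm (indicator {0..1} s *\<^sub>R (D (x + s *\<^sub>R h) \<bullet> h))) \<partial>lborel)"
      unfolding real_norm_def[symmetric] by (rule integral_norm_bound_ennreal[OF int])
    also have "\<dots> = (\<integral>\<^sup>+s. ennreal \<bar>D (s *\<^sub>R h + x) \<bullet> h\<bar> * indicator {0..1} s \<partial>lborel)"
      by (intro nn_integral_cong) (auto simp: indicator_def add.commute)
    finally show ?thesis .
  qed
  have "(\<integral>\<^sup>+x\<in>S. ennreal \<bar>w (x + h) - w x\<bar> \<partial>lborel)
      \<le> (\<integral>\<^sup>+x. (\<integral>\<^sup>+s. ennreal \<bar>D (s *\<^sub>R h + x) \<bullet> h\<bar> * indicator U (s *\<^sub>R h + x) * indicator {0..1} s \<partial>lborel) \<partial>lborel)"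
  proof (rule nn_integral_mono)
    fix x
    show "ennreal \<bar>w (x + h) - w x\<bar> * indicator S x \<le> (\<integral>\<^sup>+s. ennreal \<bar>D (s *\<^sub>R h + x) \<bullet> h\<bar> * indicator U (s *\<^sub>R h + x) * indicator {0..1} s \<partial>lborel)"
    proof (cases "x \<in> S")
      case True
      note pw[of x]
      also have "(\<integral>\<^sup>+s. ennreal \<bar>D (s *\<^sub>R h + x) \<bullet> h\<bar> * indicator {0..1} s \<partial>lborel)
        = (\<integral>\<^sup>+s. ennreal \<bar>D (s *\<^sub>R h + x) \<bullet> h\<bar> * indicator U (s *\<^sub>R h + x) * indicator {0..1} s \<partial>lborel)"
        using SU[OF True] by (intro nn_integral_cong) (auto simp: indicator_def add.commute)
      finally show ?thesis using True by simp
    qed simp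
  qed
  also have "\<dots> = (\<integral>\<^sup>+s. (\<integral>\<^sup>+x. ennreal \<bar>D (s *\<^sub>R h + x) \<bullet> h\<bar> * indicator U (s *\<^sub>R h + x) * indicator {0..1} s \<partial>lborel) \<partial>lborel)"
    by (rule lborel_pair.Fubini') measurable
  also have "\<dots> = (\<integral>\<^sup>+s. (\<integral>\<^sup>+x\<in>U. ennreal \<bar>D x \<bullet> h\<bar> \<partial>lborel) * indicator {0..1::real} s \<partial>lborel)"
  proof (rule nn_integral_cong)
    fix s :: real
    show "(\<integral>\<^sup>+x. ennreal \<bar>D (s *\<^sub>R h + x) \<bullet> h\<bar> * indicator U (s *\<^sub>R h + x) * indicator {0..1} s \<partial>lborel)
      = (\<integral>\<^sup>+x\<in>U. ennreal \<bar>D x \<bullet> h\<bar> \<partial>lborel) * indicator {0..1::real} s"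
      using nn_integral_lborel_shift[of "\<lambda>x. ennreal \<bar>D x \<bullet> h\<bar> * indicator U x" "s *\<^sub>R h"]
      by (subst nn_integral_multc) auto
  qed
  also have "\<dots> = (\<integral>\<^sup>+x\<in>U. ennreal \<bar>D x \<bullet> h\<bar> \<partial>lborel)"
    by (simp add: nn_integral_cmult)
  finally show ?thesis .
qed

section \<open>The perimeter as a limit of integrals of mollified gradients\<close>

definition mollified_field :: "real \<Rightarrow> (real ^ 'n \<Rightarrow> real ^ 'n) \<Rightarrow> real ^ 'n \<Rightarrow> real ^ 'n" where
  "mollified_field \<eta> \<phi> x = (\<chi> i. conv (\<lambda>z. \<phi> z $ i) (moll \<eta>) x)"

context
  fixes \<eta> :: real and \<phi> :: "real ^ 'n \<Rightarrow> real ^ 'n" and R :: real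
  assumes \<eta>: "\<eta> > 0" and \<phi>[measurable]: "\<phi> \<in> borel_measurable borel"
    and \<phi>1: "\<And>z. norm (\<phi> z) \<le> 1" and \<phi>R: "\<And>z. norm z > R \<Longrightarrow> \<phi> z = 0"
begin

lemma component_measurable[measurable]: "(\<lambda>z. \<phi> z $ i) \<in> borel_measurable borel"
proof -
  have "(\<lambda>z. \<phi> z \<bullet> axis i 1) \<in> borel_measurable borel" by measurable
  then show ?thesis by (simp add: inner_axis)
qed

lemma component_bound: "\<bar>\<phi> z $ i\<bar> \<le> 1"
  using component_le_norm_cart[of "\<phi> z" i] \<phi>1[of z] by linarith

lemma mollified_field_has_derivative:
  "(mollified_field \<eta> \<phi> has_derivative (\<lambda>h. \<chi> i. conv (\<lambda>z. \<phi> z $ i) (moll_grad \<eta>) x \<bullet> h)) (at x)"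
proof (subst has_derivative_componentwise_within, intro ballI)
  fix b :: "real ^ 'n" assume "b \<in> Basis"
  then obtain i where b: "b = axis i 1" by (auto simp: Basis_vec_def)
  show "((\<lambda>x. mollified_field \<eta> \<phi> x \<bullet> b) has_derivative (\<lambda>h. (\<chi> i. conv (\<lambda>z. \<phi> z $ i) (moll_grad \<eta>) x \<bullet> h) \<bullet> b)) (at x)"
    using conv_moll_has_derivative[OF \<eta> component_measurable component_bound, of i x]
    by (simp only: b inner_axis mollified_field_def vec_lambda_beta inner_real_def mult_1_right)
qed

lemma mollified_field_C1:
  "\<exists>\<phi>'. (\<forall>x. (mollified_field \<eta> \<phi> has_derivative blinfun_apply (\<phi>' x)) (at x)) \<and> continuous_on UNIV \<phi>'"
proof -
  define D where "D x = Blinfun (\<lambda>h. \<chi> i. conv (\<lambda>z. \<phi> z $ i) (moll_grad \<eta>) x \<bullet> h)" for x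
  have D: "blinfun_apply (D x) = (\<lambda>h. \<chi> i. conv (\<lambda>z. \<phi> z $ i) (moll_grad \<eta>) x \<bullet> h)" for x
    unfolding D_def
    by (rule bounded_linear_Blinfun_apply) (rule has_derivative_bounded_linear[OF mollified_field_has_derivative])
  have "continuous_on UNIV D"
  proof (rule continuous_on_blinfun_componentwise)
    fix b :: "real ^ 'n"
    show "continuous_on UNIV (\<lambda>x. blinfun_apply (D x) b)"
      unfolding D
      by (intro continuous_on_vec_lambda continuous_on_inner continuous_on_const
          continuous_conv_moll_grad[OF \<eta> component_measurable component_bound])
  qed
  then show ?thesis using mollified_field_has_derivative D by (intro exI[of _ D]) simp
qed

lemma inner_mollified_field: "a \<bullet> mollified_field \<eta> \<phi> x = conv (\<lambda>z. a \<bullet> \<phi> z) (moll \<eta>) x"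
proof -
  have "a \<bullet> mollified_field \<eta> \<phi> x = (\<Sum>i\<in>UNIV. (\<integral>z. a $ i * (\<phi> z $ i * moll \<eta> (x - z)) \<partial>lborel))"
    by (simp add: inner_vec_def mollified_field_def conv_def)
  also have "\<dots> = (\<integral>z. (\<Sum>i\<in>UNIV. a $ i * (\<phi> z $ i * moll \<eta> (x - z))) \<partial>lborel)"
    by (rule Bochner_Integration.integral_sum[symmetric])
       (intro integrable_mult_right integrable_conv_moll[OF \<eta> component_measurable component_bound])
  also have "\<dots> = conv (\<lambda>z. a \<bullet> \<phi> z) (moll \<eta>) x"
    by (simp add: conv_def inner_vec_def sum_distrib_right mult.assoc)
  finally show ?thesis .
qed

lemma norm_mollified_field: "norm (mollified_field \<eta> \<phi> x) \<le> 1"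
proof (cases "mollified_field \<eta> \<phi> x = 0")
  case False
  let ?F = "mollified_field \<eta> \<phi> x"
  define a where "a = sgn ?F"
  have a: "norm a = 1" using False by (simp add: a_def norm_sgn)
  have "norm ?F = a \<bullet> ?F" using False by (simp add: a_def sgn_div_norm dot_square_norm power2_eq_square)
  also have "\<dots> = conv (\<lambda>z. a \<bullet> \<phi> z) (moll \<eta>) x" by (rule inner_mollified_field)
  also have "\<dots> \<le> \<bar>conv (\<lambda>z. a \<bullet> \<phi> z) (moll \<eta>) x\<bar>" by simp
  also have "\<dots> \<le> 1"
  proof (rule conv_moll_abs_le[OF \<eta>])
    fix z
    have "\<bar>a \<bullet> \<phi> z\<bar> \<le> norm a * norm (\<phi> z)" by (rule Cauchy_Schwarz_ineq2)
    then show "\<bar>a \<bullet> \<phi> z\<bar> \<le> 1" using \<phi>1[of z] by (simp add: a)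
  qed measurable
  finally show ?thesis .
qed simp

lemma mollified_field_support:
  assumes "\<And>z. norm (x - z) \<le> \<eta> \<Longrightarrow> \<phi> z = 0"
  shows "mollified_field \<eta> \<phi> x = 0"
proof -
  have "\<phi> z $ i * moll \<eta> (x - z) = 0" for z i
    using assms[of z] moll_outside[OF \<eta>, of "x - z"] by (cases "norm (x - z) \<le> \<eta>") auto
  then have "(\<lambda>z. \<phi> z $ i *\<^sub>R moll \<eta> (x - z)) = (\<lambda>_. 0)" for i by (simp only: real_scaleR_def)
  then show ?thesis by (simp only: mollified_field_def conv_def) (simp add: vec_eq_iff)
qed

text \<open>
The derivative falls on the mollifier, since \<open>\<phi>\<close> is merely measurable.
\<close>

lemma divergence_mollified_field:
  "divergence (mollified_field \<eta> \<phi>) x = (\<integral>z. \<phi> z \<bullet> moll_grad \<eta> (x - z) \<partial>lborel)"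
proof -
  have int: "integrable lborel (\<lambda>z. \<phi> z $ i *\<^sub>R moll_grad \<eta> (x - z))" for i
    by (rule conv_integrable[OF continuous_moll_grad moll_grad_outside[OF \<eta>] component_measurable component_bound])
  have "divergence (mollified_field \<eta> \<phi>) x = (\<Sum>i\<in>UNIV. conv (\<lambda>z. \<phi> z $ i) (moll_grad \<eta>) x \<bullet> axis i 1)"
    by (simp add: divergence_def frechet_derivative_at[OF mollified_field_has_derivative, symmetric])
  also have "\<dots> = (\<Sum>i\<in>UNIV. (\<integral>z. (\<phi> z $ i *\<^sub>R moll_grad \<eta> (x - z)) \<bullet> axis i 1 \<partial>lborel))"
    unfolding conv_def by (intro sum.cong refl integral_inner_left[symmetric] int)
  also have "\<dots> = (\<integral>z. (\<Sum>i\<in>UNIV. (\<phi> z $ i *\<^sub>R moll_grad \<eta> (x - z)) \<bullet> axis i 1) \<partial>lborel)"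
    by (rule Bochner_Integration.integral_sum[symmetric]) (intro integrable_inner_left int)
  also have "\<dots> = (\<integral>z. \<phi> z \<bullet> moll_grad \<eta> (x - z) \<partial>lborel)"
  proof -
    have "(\<phi> z $ i *\<^sub>R m) \<bullet> axis i 1 = \<phi> z $ i \<bullet> m $ i" for z i m by (simp add: inner_axis)
    then show ?thesis by (simp only: inner_vec_def[of "\<phi> _"])
  qed
  finally show ?thesis .
qed

text \<open>
Integration by parts in disguise: Fubini's theorem moves the mollifier from \<open>\<phi>\<close> to the indicator
of \<open>E\<close>, and the sign changes because the gradient of the mollifier is odd.
\<close>

lemma distr_grad_mollified_field:
  assumes E[measurable]: "E \<in> sets borel"
  shows "distr_grad E (mollified_field \<eta> \<phi>) = (\<integral>z. \<phi> z \<bullet> mollified_grad \<eta> E z \<partial>lborel)"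
proof -
  have E1: "\<bar>indicat_real E z\<bar> \<le> 1" for z by (simp add: indicator_def)
  obtain B where B: "B > 0" "\<And>x. norm (moll_grad \<eta> (x::real^'n)) \<le> B"
    by (rule bounded_continuous_compact_support[OF continuous_moll_grad, where R = \<eta>])
       (erule moll_grad_outside[OF \<eta>], rule that)
  let ?K = "cball (0::real^'n) (R + \<eta>) \<times> cball (0::real^'n) R"
  let ?f = "\<lambda>x z. indicat_real E x * (\<phi> z \<bullet> moll_grad \<eta> (x - z))"
  have meas: "(\<lambda>(x, z). ?f x z) \<in> borel_measurable (lborel \<Otimes>\<^sub>M lborel)" by measurable
  have int: "integrable (lborel \<Otimes>\<^sub>M lborel) (\<lambda>(x, z). ?f x z)"
  proof (rule Bochner_Integration.integrable_bound[OF _ meas])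
    have "emeasure lborel ?K < \<infinity>" by (intro emeasure_bounded_finite bounded_Times) auto
    then show "integrable (lborel \<Otimes>\<^sub>M lborel) (\<lambda>p. indicator ?K p *\<^sub>R B)"
      unfolding lborel_prod
      by (intro integrable_real_indicator[THEN integrable_scaleR_left]) (auto intro!: borel_closed closed_Times)
    show "AE p in lborel \<Otimes>\<^sub>M lborel. norm (case p of (x, z) \<Rightarrow> ?f x z) \<le> norm (indicator ?K p *\<^sub>R B)"
    proof (rule AE_I2, clarify)
      fix x z :: "real ^ 'n"
      show "norm (?f x z) \<le> norm (indicator ?K (x, z) *\<^sub>R B)"
      proof (cases "norm z \<le> R \<and> norm (x - z) \<le> \<eta>")
        case True
        have "norm x \<le> norm z + norm (x - z)" by (rule norm_triangle_sub)
        then have "(x, z) \<in> ?K" using True by auto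
        have "norm (?f x z) \<le> 1 * \<bar>\<phi> z \<bullet> moll_grad \<eta> (x - z)\<bar>" by (auto simp: indicator_def)
        also have "\<dots> \<le> norm (\<phi> z) * norm (moll_grad \<eta> (x - z))" using Cauchy_Schwarz_ineq2 by simp
        also have "\<dots> \<le> 1 * B" using \<phi>1 B by (intro mult_mono) auto
        finally show ?thesis using \<open>(x, z) \<in> ?K\<close> B(1) by simp
      next
        case False
        then have "?f x z = 0" using \<phi>R[of z] moll_grad_outside[OF \<eta>, of "x - z"] by auto
        then show ?thesis by (simp only: norm_zero norm_ge_zero)
      qed
    qed
  qed
  have m: "(\<lambda>x. indicat_real E x *\<^sub>R divergence (mollified_field \<eta> \<phi>) x) \<in> borel_measurable lborel"
    unfolding divergence_mollified_field by measurable
  have "distr_grad E (mollified_field \<eta> \<phi>) = - (\<integral>x. indicat_real E x *\<^sub>R divergence (mollified_field \<eta> \<phi>) x \<partial>lborel)"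
    unfolding distr_grad_def set_lebesgue_integral_def using integral_completion[OF m] by simp
  also have "\<dots> = - (\<integral>x. (\<integral>z. ?f x z \<partial>lborel) \<partial>lborel)"
    by (simp add: divergence_mollified_field)
  also have "\<dots> = - (\<integral>z. (\<integral>x. ?f x z \<partial>lborel) \<partial>lborel)"
    using lborel_pair.Fubini_integral[OF int] by simp
  also have "\<dots> = - (\<integral>z. \<phi> z \<bullet> (- mollified_grad \<eta> E z) \<partial>lborel)"
  proof -
    have "(\<integral>x. ?f x z \<partial>lborel) = \<phi> z \<bullet> (- mollified_grad \<eta> E z)" for z
    proof -
      have i: "integrable lborel (\<lambda>x. indicat_real E x *\<^sub>R moll_grad \<eta> (z - x))"
        by (rule conv_integrable[OF continuous_moll_grad moll_grad_outside[OF \<eta>] _ E1]) measurable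
      have "moll_grad \<eta> (x - z) = - moll_grad \<eta> (z - x)" for x using moll_grad_minus[of \<eta> "z - x"] by simp
      then have "(\<integral>x. ?f x z \<partial>lborel) = - (\<integral>x. \<phi> z \<bullet> (indicat_real E x *\<^sub>R moll_grad \<eta> (z - x)) \<partial>lborel)"
        by simp
      also have "\<dots> = - (\<phi> z \<bullet> mollified_grad \<eta> E z)"
        unfolding conv_def using integral_inner_right[of "\<phi> z", OF i] by simp
      finally show ?thesis by simp
    qed
    then show ?thesis by simp
  qed
  finally show ?thesis by simp
qed

end

text \<open>
The test field is the mollification of the unit field in the direction of the mollified gradient \<open>v\<close>,
cut off outside \<open>S\<close>. It is of class \<open>C\<^sup>1\<close> although the cut-off field is only measurable, it is
supported in \<open>C\<close>, and its pairing with the distributional gradient of \<open>E\<close> is exactly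
\<open>\<integral>\<^sub>S |v|\<close>.
\<close>

lemma gradient_integral_le_Per:
  fixes E \<Omega> :: "(real ^ 'n) set"
  assumes \<eta>: "\<eta> > 0" and E[measurable]: "E \<in> sets borel" and S[measurable]: "S \<in> sets borel"
    and C: "compact C" "C \<subseteq> \<Omega>" "\<And>x. x \<in> S \<Longrightarrow> cball x \<eta> \<subseteq> C"
  shows "(\<integral>\<^sup>+x\<in>S. ennreal (norm (mollified_grad \<eta> E x)) \<partial>lborel) \<le> Per E \<Omega>"
proof -
  define v where "v = mollified_grad \<eta> E"
  have E1: "\<bar>indicat_real E z\<bar> \<le> 1" for z by (simp add: indicator_def)
  have vc: "continuous_on UNIV v" unfolding v_def
    by (rule continuous_conv_moll_grad[OF \<eta> _ E1]) measurable
  have [measurable]: "v \<in> borel_measurable borel" by (rule borel_measurable_continuous_onI[OF vc])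
  define \<phi> where "\<phi> z = indicat_real S z *\<^sub>R sgn (v z)" for z
  have \<phi>m[measurable]: "\<phi> \<in> borel_measurable borel"
    unfolding \<phi>_def sgn_div_norm by measurable
  have \<phi>1: "norm (\<phi> z) \<le> 1" for z by (simp add: \<phi>_def norm_sgn indicator_def)
  have SC: "S \<subseteq> C" using C(3) \<eta> by (auto simp: subset_iff)
  obtain R where R: "C \<subseteq> cball 0 R" using bounded_subset_ballD[OF compact_imp_bounded[OF C(1)], of 0] ball_subset_cball by (meson order_trans)
  have \<phi>R: "\<phi> z = 0" if "norm z > R" for z using that SC R by (force simp: \<phi>_def indicator_def)
  have "mollified_field \<eta> \<phi> \<in> test_fields \<Omega>"
    unfolding test_fields_def
  proof (intro CollectI conjI exI[of _ C] allI impI)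
    show "\<exists>\<phi>'. (\<forall>x. (mollified_field \<eta> \<phi> has_derivative blinfun_apply (\<phi>' x)) (at x)) \<and> continuous_on UNIV \<phi>'"
      by (rule mollified_field_C1[OF \<eta> \<phi>m \<phi>1 \<phi>R])
    fix x assume "x \<notin> C"
    show "mollified_field \<eta> \<phi> x = 0"
    proof (rule mollified_field_support[OF \<eta> \<phi>m \<phi>1 \<phi>R])
      fix z assume "norm (x - z) \<le> \<eta>"
      then have "x \<in> cball z \<eta>" by (simp add: dist_norm norm_minus_commute)
      then show "\<phi> z = 0" using C(3)[of z] \<open>x \<notin> C\<close> by (cases "z \<in> S") (auto simp: \<phi>_def)
    qed
  qed (use C in auto)
  moreover have "\<forall>x. norm (mollified_field \<eta> \<phi> x) \<le> 1"
    by (intro allI norm_mollified_field[OF \<eta> \<phi>m \<phi>1 \<phi>R])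
  ultimately have "ennreal (distr_grad E (mollified_field \<eta> \<phi>)) \<le> Per E \<Omega>"
    unfolding Per_def by (intro SUP_upper) auto
  moreover have "distr_grad E (mollified_field \<eta> \<phi>) = (\<integral>z. indicator S z *\<^sub>R norm (v z) \<partial>lborel)"
  proof -
    have "\<phi> z \<bullet> v z = indicator S z *\<^sub>R norm (v z)" for z
      by (cases "v z = 0") (simp_all add: \<phi>_def sgn_div_norm dot_square_norm power2_eq_square)
    then show ?thesis
      using distr_grad_mollified_field[OF \<eta> \<phi>m \<phi>1 \<phi>R E] by (simp add: v_def[symmetric])
  qed
  moreover have "(\<integral>\<^sup>+z. ennreal (indicator S z *\<^sub>R norm (v z)) \<partial>lborel) = ennreal (\<integral>z. indicator S z *\<^sub>R norm (v z) \<partial>lborel)"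
  proof (rule nn_integral_eq_integral)
    have "integrable lborel (\<lambda>z. indicator C z *\<^sub>R norm (v z))"
      by (rule borel_integrable_compact[OF C(1)]) (intro continuous_on_norm continuous_on_subset[OF vc], simp)
    then show "integrable lborel (\<lambda>z. indicator S z *\<^sub>R norm (v z))"
      by (rule Bochner_Integration.integrable_bound) (use SC in \<open>auto simp: indicator_def\<close>)
  qed (auto simp: indicator_def)
  moreover have "(\<integral>\<^sup>+z. ennreal (indicator S z *\<^sub>R norm (v z)) \<partial>lborel) = (\<integral>\<^sup>+x\<in>S. ennreal (norm (v x)) \<partial>lborel)"
    by (intro nn_integral_cong) (auto simp: indicator_def)
  ultimately show ?thesis by (simp add: v_def)
qed

text \<open>
Rescaling \<open>f\<close> removes the normalization of its bound to \<open>1\<close>. This version is needed with the mollifier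
itself in the role of \<open>f\<close> and a component of a test field in the role of \<open>g\<close>.
\<close>

lemma conv_has_derivative_bounded:
  fixes g :: "'a::euclidean_space \<Rightarrow> real"
  assumes g: "\<And>x. (g has_derivative (\<lambda>h. G x \<bullet> h)) (at x)" "\<And>x. norm x > R \<Longrightarrow> g x = 0"
    and G: "continuous_on UNIV G" "\<And>x. norm x > R \<Longrightarrow> G x = 0"
    and f[measurable]: "f \<in> borel_measurable borel" and "\<And>z. \<bar>f z\<bar> \<le> c" and c: "c > 0"
  shows "(conv f g has_derivative (\<lambda>h. conv f G x \<bullet> h)) (at x)"
proof -
  have sc: "conv f H = (\<lambda>x. c *\<^sub>R conv (\<lambda>z. f z / c) H x)" for H :: "'a \<Rightarrow> 'b::euclidean_space"
    unfolding conv_def integral_scaleR_right[symmetric] using c by (simp add: fun_eq_iff)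
  have "(conv (\<lambda>z. f z / c) g has_derivative (\<lambda>h. conv (\<lambda>z. f z / c) G x \<bullet> h)) (at x)"
    using assms(6) c by (intro conv_has_derivative[OF g G]) auto
  from has_derivative_scaleR_right[OF this, of c] show ?thesis
    by (simp only: sc[of g] sc[of G] inner_scaleR_left real_scaleR_def)
qed

lemma conv_commute:
  fixes f g :: "'a::euclidean_space \<Rightarrow> real"
  assumes [measurable]: "f \<in> borel_measurable borel" "g \<in> borel_measurable borel"
  shows "conv f g = conv g f"
proof
  fix x
  have "conv f g x = (\<integral>z. f (x - z) * g (x - (x - z)) \<partial>lborel)"
    unfolding conv_def real_scaleR_def
    by (rule integral_lborel_reflect[of "\<lambda>z. f z * g (x - z)", symmetric]) measurable
  then show "conv f g x = conv g f x" by (simp add: conv_def mult.commute)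
qed

lemma test_field_gradients:
  assumes "\<phi> \<in> test_fields \<Omega>"
  obtains C R G where "compact C" "C \<subseteq> \<Omega>" "\<And>x. x \<notin> C \<Longrightarrow> \<phi> x = 0" "C \<subseteq> cball 0 R"
    "\<And>i x. ((\<lambda>x. \<phi> x $ i) has_derivative (\<lambda>h. G i x \<bullet> h)) (at x)"
    "\<And>i. continuous_on UNIV (G i)" "\<And>i x. norm x > R \<Longrightarrow> G i x = 0"
    "\<And>x. divergence \<phi> x = (\<Sum>i\<in>UNIV. G i x $ i)" "continuous_on UNIV \<phi>"
proof -
  obtain \<phi>' C where \<phi>': "\<And>x. (\<phi> has_derivative blinfun_apply (\<phi>' x)) (at x)" "continuous_on UNIV \<phi>'"
    and C: "compact C" "C \<subseteq> \<Omega>" "\<And>x. x \<notin> C \<Longrightarrow> \<phi> x = 0"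
    using assms unfolding test_fields_def by blast
  obtain R where R: "C \<subseteq> cball 0 R"
    using bounded_subset_ballD[OF compact_imp_bounded[OF C(1)], of 0] ball_subset_cball by (meson order_trans)
  define G where "G i x = (\<chi> j. blinfun_apply (\<phi>' x) (axis j 1) $ i)" for i x
  have Gh: "G i x \<bullet> h = blinfun_apply (\<phi>' x) h $ i" for i x h
  proof -
    have "h = (\<Sum>j\<in>UNIV. h $ j *\<^sub>R axis j 1)" using basis_expansion[of h] by (simp add: scalar_mult_eq_scaleR)
    then have "blinfun_apply (\<phi>' x) h = (\<Sum>j\<in>UNIV. h $ j *\<^sub>R blinfun_apply (\<phi>' x) (axis j 1))"
      by (metis (no_types, lifting) blinfun.sum_right blinfun.scaleR_right sum.cong)
    then show ?thesis by (simp add: G_def inner_vec_def mult.commute)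
  qed
  show ?thesis
  proof (rule that[OF C R])
    fix i x
    have "((\<lambda>x. \<phi> x \<bullet> axis i 1) has_derivative (\<lambda>h. blinfun_apply (\<phi>' x) h \<bullet> axis i 1)) (at x)"
      by (rule has_derivative_inner_left[OF \<phi>'(1)])
    then show "((\<lambda>x. \<phi> x $ i) has_derivative (\<lambda>h. G i x \<bullet> h)) (at x)" by (simp add: inner_axis Gh)
  next
    fix i show "continuous_on UNIV (G i)"
      unfolding G_def[abs_def]
      by (intro continuous_on_vec_lambda continuous_on_component blinfun.continuous_on \<phi>'(2) continuous_on_const)
  next
    fix i and x :: "real ^ 'a" assume x: "norm x > R"
    have "(\<phi> has_derivative (\<lambda>h. 0)) (at x)"
    proof (rule has_derivative_transform_within_open[of "\<lambda>_. 0" _ _ _ "- cball 0 R"])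
      show "0 = \<phi> y" if "y \<in> - cball 0 R" for y by (rule C(3)[symmetric]) (use that R in force)
    qed (use x in auto)
    then have "blinfun_apply (\<phi>' x) = (\<lambda>h. 0)" by (rule has_derivative_unique[OF \<phi>'(1)])
    then show "G i x = 0" by (simp add: G_def vec_eq_iff)
  next
    fix x show "divergence \<phi> x = (\<Sum>i\<in>UNIV. G i x $ i)"
      by (simp add: divergence_def frechet_derivative_at[OF \<phi>'(1), symmetric] G_def)
  next
    show "continuous_on UNIV \<phi>" by (rule has_derivative_continuous_on[OF has_derivative_at_withinI[OF \<phi>'(1)]])
  qed
qed

text \<open>
Differentiating the test field instead of the mollifier shows that the divergence of the mollified
field is the mollification of the continuous function \<open>divergence \<phi>\<close>, hence uniformly close to it.
So \<open>\<phi>\<close> may be replaced by its mollification, whose pairing with the distributional gradient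
is \<open>\<integral> \<phi> \<bullet> v\<close> for the mollified gradient \<open>v\<close>, and \<open>|\<phi>| \<le> 1\<close> on its support \<open>C\<close>.
\<close>

lemma test_field_le_gradient_integral:
  fixes E :: "(real ^ 'n) set"
  assumes \<phi>: "\<phi> \<in> test_fields \<Omega>" and \<phi>1: "\<And>x. norm (\<phi> x) \<le> 1"
    and E[measurable]: "E \<in> sets borel" and e: "e > 0"
  obtains C \<eta>0 where "compact C" "C \<subseteq> \<Omega>" "\<eta>0 > 0"
    "\<And>\<eta>. 0 < \<eta> \<Longrightarrow> \<eta> < \<eta>0 \<Longrightarrow> ennreal (distr_grad E \<phi>)
        \<le> (\<integral>\<^sup>+x\<in>C. ennreal (norm (mollified_grad \<eta> E x)) \<partial>lborel) + ennreal e"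
proof -
  obtain C R G where C: "compact C" "C \<subseteq> \<Omega>" "\<And>x. x \<notin> C \<Longrightarrow> \<phi> x = 0" and R: "C \<subseteq> cball 0 R"
    and G: "\<And>i x. ((\<lambda>x. \<phi> x $ i) has_derivative (\<lambda>h. G i x \<bullet> h)) (at x)"
    "\<And>i. continuous_on UNIV (G i)" "\<And>i x. norm x > R \<Longrightarrow> G i x = 0"
    and div: "\<And>x. divergence \<phi> x = (\<Sum>i\<in>UNIV. G i x $ i)" and \<phi>c: "continuous_on UNIV \<phi>"
    by (rule test_field_gradients[OF \<phi>]) (rule that)
  have \<phi>m[measurable]: "\<phi> \<in> borel_measurable borel" by (rule borel_measurable_continuous_onI[OF \<phi>c])
  have \<phi>R: "\<phi> z = 0" if "norm z > R" for z by (rule C(3)) (use that R in force)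
  have E1: "\<bar>indicat_real E z\<bar> \<le> 1" for z by (simp add: indicator_def)
  let ?d = "divergence \<phi>"
  have dc: "continuous_on UNIV ?d"
    unfolding div[abs_def] by (intro continuous_on_sum continuous_on_component G(2))
  have dR: "?d x = 0" if "norm x > R" for x by (simp add: div G(3)[OF that])
  have [measurable]: "?d \<in> borel_measurable borel" by (rule borel_measurable_continuous_onI[OF dc])
  obtain B where B: "B > 0" "\<And>x. norm (?d x) \<le> B"
    by (rule bounded_continuous_compact_support[OF dc, where R = R]) (erule dR, rule that)
  define V where "V = measure lborel (cball (0::real^'n) (R + 1))"
  have V: "V \<ge> 0" by (simp add: V_def)
  have e': "e / (V + 1) > 0" using e V by simp
  \<comment> \<open>With \<open>d \<le> 1\<close> the mollified field still has its support in the ball of radius \<open>R + 1\<close>.\<close>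
  obtain d where d: "d > 0" "d \<le> 1" "\<And>x y. norm (x - y) < d \<Longrightarrow> norm (?d x - ?d y) < e / (V + 1)"
    by (rule uniform_continuous_compact_support[OF dc _ e', where R = R]) (erule dR, rule that)
  show ?thesis
  proof (rule that[OF C(1,2) d(1)])
    fix \<eta> assume \<eta>: "0 < \<eta>" "\<eta> < d"
    let ?F = "mollified_field \<eta> \<phi>"
    note ctx = \<eta>(1) \<phi>m \<phi>1 \<phi>R
    have cm: "(\<lambda>z. \<phi> z $ i) \<in> borel_measurable borel" for i by (rule component_measurable[OF ctx])
    have cb: "\<bar>\<phi> z $ i\<bar> \<le> 1" for z i by (rule component_bound[OF ctx])
    have divF: "divergence ?F x = conv ?d (moll \<eta>) x" for x
    proof -
      obtain M where M: "M > 0" "\<And>x. norm (moll \<eta> (x::real^'n)) \<le> M"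
        by (rule bounded_continuous_compact_support[OF continuous_moll, where R = \<eta>])
           (erule moll_outside[OF \<eta>(1)], rule that)
      have "conv (\<lambda>z. \<phi> z $ i) (moll_grad \<eta>) x = conv (moll \<eta>) (G i) x" for i
      proof -
        have "(conv (\<lambda>z. \<phi> z $ i) (moll \<eta>) has_derivative (\<lambda>h. conv (moll \<eta>) (G i) x \<bullet> h)) (at x)"
          unfolding conv_commute[OF cm borel_measurable_moll]
          by (rule conv_has_derivative_bounded[OF G(1) _ G(2,3) borel_measurable_moll _ M(1)])
             (use M(2) \<phi>R in auto)
        from has_derivative_unique[OF this conv_moll_has_derivative[OF \<eta>(1) cm cb]]
        have eq: "(\<lambda>h. conv (moll \<eta>) (G i) x \<bullet> h) = (\<lambda>h. conv (\<lambda>z. \<phi> z $ i) (moll_grad \<eta>) x \<bullet> h)" .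
        show ?thesis by (rule vector_eq_rdot[THEN iffD1]) (use eq in \<open>auto dest: fun_cong\<close>)
      qed
      then have "divergence ?F x = (\<Sum>i\<in>UNIV. conv (moll \<eta>) (G i) x \<bullet> axis i 1)"
        by (simp add: divergence_def frechet_derivative_at[OF mollified_field_has_derivative[OF ctx], symmetric])
      also have "\<dots> = (\<Sum>i\<in>UNIV. (\<integral>z. (moll \<eta> z *\<^sub>R G i (x - z)) \<bullet> axis i 1 \<partial>lborel))"
        unfolding conv_def
        by (intro sum.cong refl integral_inner_left[symmetric] conv_integrable[OF G(2,3), where c = M])
           (use M in auto)
      also have "\<dots> = (\<integral>z. (\<Sum>i\<in>UNIV. (moll \<eta> z *\<^sub>R G i (x - z)) \<bullet> axis i 1) \<partial>lborel)"
        by (intro Bochner_Integration.integral_sum[symmetric] integrable_inner_left conv_integrable[OF G(2,3), where c = M])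
           (use M in auto)
      also have "\<dots> = conv (moll \<eta>) ?d x"
        by (simp add: conv_def div inner_axis sum_distrib_left)
      finally show ?thesis by (simp add: conv_commute[of ?d "moll \<eta>"])
    qed
    have near: "\<bar>divergence ?F x - ?d x\<bar> \<le> e / (V + 1)" for x
      unfolding divF
    proof (rule conv_moll_deviation[OF \<eta>(1), where c = B])
      fix z assume "norm (x - z) \<le> \<eta>"
      then show "\<bar>?d z - ?d x\<bar> \<le> e / (V + 1)" using d(3)[of z x] \<eta>(2) by (simp add: norm_minus_commute)
    qed (use B(2) in auto)
    have far: "divergence ?F x = 0" if "norm x > R + 1" for x
    proof -
      have "\<bar>divergence ?F x - 0\<bar> \<le> 0"
        unfolding divF
      proof (rule conv_moll_deviation[OF \<eta>(1), where c = B])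
        fix z assume "norm (x - z) \<le> \<eta>"
        moreover have "norm x \<le> norm z + norm (x - z)" by (rule norm_triangle_sub)
        ultimately show "\<bar>?d z - 0\<bar> \<le> 0" using dR[of z] that \<eta>(2) d(2) by simp
      qed (use B(2) in auto)
      then show ?thesis by simp
    qed
    have m1: "(\<lambda>x. indicat_real E x *\<^sub>R ?d x) \<in> borel_measurable lborel" by measurable
    have Fm[measurable]: "divergence ?F \<in> borel_measurable borel"
      unfolding divF[abs_def] conv_def by measurable
    have m2: "(\<lambda>x. indicat_real E x *\<^sub>R divergence ?F x) \<in> borel_measurable lborel" by measurable
    have iK: "integrable lborel (\<lambda>x::real^'n. indicator (cball 0 (R + 1)) x *\<^sub>R c)" for c :: real
      using emeasure_lborel_cball_finite[of "0::real^'n" "R + 1"]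
      by (intro integrable_real_indicator[THEN integrable_scaleR_left]) auto
    have i1: "integrable lborel (\<lambda>x. indicat_real E x *\<^sub>R ?d x)"
    proof (rule Bochner_Integration.integrable_bound[OF iK[of B] m1], rule AE_I2)
      fix x show "norm (indicat_real E x *\<^sub>R ?d x) \<le> norm (indicator (cball 0 (R + 1)) x *\<^sub>R B)"
        using B(1) B(2)[of x] dR[of x] by (auto simp: indicator_def)
    qed
    have i2: "integrable lborel (\<lambda>x. indicat_real E x *\<^sub>R divergence ?F x)"
    proof (rule Bochner_Integration.integrable_bound[OF iK[of "B + e / (V + 1)"] m2], rule AE_I2)
      fix x show "norm (indicat_real E x *\<^sub>R divergence ?F x) \<le> norm (indicator (cball 0 (R + 1)) x *\<^sub>R (B + e / (V + 1)))"
      proof (cases "norm x \<le> R + 1")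
        case True
        have "\<bar>divergence ?F x\<bar> \<le> B + e / (V + 1)" using near[of x] B(2)[of x] by simp
        then show ?thesis using True by (auto simp: indicator_def)
      qed (simp add: far)
    qed
    have "distr_grad E \<phi> - distr_grad E ?F = (\<integral>x. indicat_real E x *\<^sub>R divergence ?F x - indicat_real E x *\<^sub>R ?d x \<partial>lborel)"
      unfolding distr_grad_def set_lebesgue_integral_def
      using integral_completion[OF m1] integral_completion[OF m2] i1 i2 by simp
    also have "\<dots> \<le> (\<integral>x. indicator (cball (0::real^'n) (R + 1)) x *\<^sub>R (e / (V + 1)) \<partial>lborel)"
    proof (rule Bochner_Integration.integral_mono)
      show "integrable lborel (\<lambda>x::real^'n. indicator (cball 0 (R + 1)) x *\<^sub>R (e / (V + 1)))" by (rule iK)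
      fix x :: "real ^ 'n"
      show "indicat_real E x *\<^sub>R divergence ?F x - indicat_real E x *\<^sub>R ?d x \<le> indicator (cball 0 (R + 1)) x *\<^sub>R (e / (V + 1))"
        using near[of x] far[of x] dR[of x] e' by (cases "norm x \<le> R + 1") (auto simp: indicator_def)
    qed (use i1 i2 in auto)
    also have "\<dots> = e / (V + 1) * V" by (simp add: V_def)
    also have "\<dots> \<le> e" using V e by (simp add: field_simps)
    finally have 1: "distr_grad E \<phi> \<le> distr_grad E ?F + e" by simp
    let ?v = "mollified_grad \<eta> E"
    have vc: "continuous_on S ?v" for S by (rule continuous_conv_moll_grad[OF \<eta>(1) _ E1]) measurable
    have vm[measurable]: "?v \<in> borel_measurable borel" by (rule borel_measurable_continuous_onI[OF vc])
    have iC: "integrable lborel (\<lambda>x. indicator C x *\<^sub>R norm (?v x))"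
      by (rule borel_integrable_compact[OF C(1)]) (intro continuous_on_norm vc)
    have bound: "\<bar>\<phi> x \<bullet> ?v x\<bar> \<le> indicator C x *\<^sub>R norm (?v x)" for x
    proof (cases "x \<in> C")
      case True
      have "\<bar>\<phi> x \<bullet> ?v x\<bar> \<le> norm (\<phi> x) * norm (?v x)" by (rule Cauchy_Schwarz_ineq2)
      also have "\<dots> \<le> 1 * norm (?v x)" using \<phi>1 by (intro mult_right_mono) auto
      finally show ?thesis using True by simp
    qed (simp add: C(3))
    have "distr_grad E ?F = (\<integral>x. \<phi> x \<bullet> ?v x \<partial>lborel)" by (rule distr_grad_mollified_field[OF ctx E])
    also have "\<dots> \<le> (\<integral>x. indicator C x *\<^sub>R norm (?v x) \<partial>lborel)"
    proof (rule Bochner_Integration.integral_mono)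
      show "integrable lborel (\<lambda>x. indicator C x *\<^sub>R norm (?v x))" by (rule iC)
      show "integrable lborel (\<lambda>x. \<phi> x \<bullet> ?v x)"
        by (rule Bochner_Integration.integrable_bound[OF iC])
           (measurable, rule AE_I2, use bound in \<open>auto intro: order_trans[OF _ abs_ge_self]\<close>)
    qed (use bound abs_ge_self order_trans in blast)
    finally have "distr_grad E \<phi> \<le> (\<integral>x. indicator C x *\<^sub>R norm (?v x) \<partial>lborel) + e" using 1 by simp
    then have "ennreal (distr_grad E \<phi>) \<le> ennreal ((\<integral>x. indicator C x *\<^sub>R norm (?v x) \<partial>lborel) + e)" by (rule ennreal_leI)
    also have "\<dots> = ennreal (\<integral>x. indicator C x *\<^sub>R norm (?v x) \<partial>lborel) + ennreal e"
      using e by (intro ennreal_plus Bochner_Integration.integral_nonneg) auto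
    also have "ennreal (\<integral>x. indicator C x *\<^sub>R norm (?v x) \<partial>lborel) = (\<integral>\<^sup>+x. ennreal (indicator C x *\<^sub>R norm (?v x)) \<partial>lborel)"
      by (rule nn_integral_eq_integral[OF iC, symmetric]) (auto simp: indicator_def)
    also have "\<dots> = (\<integral>\<^sup>+x\<in>C. ennreal (norm (?v x)) \<partial>lborel)"
      by (intro nn_integral_cong) (auto simp: indicator_def)
    finally show "ennreal (distr_grad E \<phi>) \<le> (\<integral>\<^sup>+x\<in>C. ennreal (norm (?v x)) \<partial>lborel) + ennreal e" .
  qed
qed

section \<open>The lower bound along a sequence for a fixed mollification\<close>

text \<open>
The substitution \<open>x = y + \<epsilon> h\<close>; the factor \<open>\<epsilon>\<^sup>d\<close> of the volume element cancels the
normalization of the scaled kernel.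
\<close>

lemma interaction_substitution:
  fixes K :: "real ^ 'n \<Rightarrow> real" and g :: "real ^ 'n \<Rightarrow> real ^ 'n \<Rightarrow> ennreal"
  assumes K[measurable]: "K \<in> borel_measurable borel" and K0: "\<And>h. K h \<ge> 0" and even: "\<And>h. K (- h) = K h"
    and \<epsilon>: "\<epsilon> > 0" and g: "case_prod g \<in> borel_measurable (borel \<Otimes>\<^sub>M borel)"
  shows "(\<integral>\<^sup>+y. (\<integral>\<^sup>+x. ennreal (scaled_kernel K \<epsilon> (y - x)) * g y x \<partial>lborel) \<partial>lborel)
    = (\<integral>\<^sup>+h. ennreal (K h) * (\<integral>\<^sup>+y. g y (y + \<epsilon> *\<^sub>R h) \<partial>lborel) \<partial>lborel)"
proof -
  have gy[measurable]: "g y \<in> borel_measurable borel" for y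
    using measurable_compose[OF measurable_Pair1' g, of y] by simp
  have [measurable]: "(\<lambda>p. g (fst p) (fst p + \<epsilon> *\<^sub>R snd p)) \<in> borel_measurable (borel \<Otimes>\<^sub>M borel)"
  proof -
    have "(\<lambda>p::(real^'n) \<times> (real^'n). (fst p, fst p + \<epsilon> *\<^sub>R snd p)) \<in> borel \<Otimes>\<^sub>M borel \<rightarrow>\<^sub>M borel \<Otimes>\<^sub>M borel"
      by measurable
    from measurable_compose[OF this g] show ?thesis by simp
  qed
  then have g2[measurable]: "(\<lambda>(y, h). g y (y + \<epsilon> *\<^sub>R h)) \<in> borel_measurable (borel \<Otimes>\<^sub>M borel)"
    by (simp add: case_prod_beta)
  have inner: "(\<integral>\<^sup>+x. ennreal (scaled_kernel K \<epsilon> (y - x)) * g y x \<partial>lborel)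
      = (\<integral>\<^sup>+h. ennreal (K h) * g y (y + \<epsilon> *\<^sub>R h) \<partial>lborel)" for y
  proof -
    define f where "f x = ennreal (scaled_kernel K \<epsilon> (y - x)) * g y x" for x
    have [measurable]: "f \<in> borel_measurable borel" unfolding f_def scaled_kernel_def by measurable
    have "(\<integral>\<^sup>+x. f x \<partial>lborel) = (\<integral>\<^sup>+x. f (y + x) \<partial>lborel)" by (rule nn_integral_lborel_shift[symmetric]) measurable
    also have "\<dots> = ennreal (\<epsilon> ^ CARD('n)) * (\<integral>\<^sup>+h. f (y + \<epsilon> *\<^sub>R h) \<partial>lborel)"
      using nn_integral_lborel_scale[of "\<lambda>x. f (y + x)" \<epsilon>] \<epsilon> by simp
    also have "\<dots> = (\<integral>\<^sup>+h. ennreal (\<epsilon> ^ CARD('n)) * f (y + \<epsilon> *\<^sub>R h) \<partial>lborel)"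
      by (rule nn_integral_cmult[symmetric]) measurable
    also have "\<dots> = (\<integral>\<^sup>+h. ennreal (K h) * g y (y + \<epsilon> *\<^sub>R h) \<partial>lborel)"
    proof (rule nn_integral_cong)
      fix h
      have "scaled_kernel K \<epsilon> (y - (y + \<epsilon> *\<^sub>R h)) = K h / \<epsilon> ^ CARD('n)"
        using \<epsilon> even[of h] by (simp add: scaled_kernel_def)
      then have "ennreal (\<epsilon> ^ CARD('n)) * f (y + \<epsilon> *\<^sub>R h) = ennreal (\<epsilon> ^ CARD('n)) * ennreal (K h / \<epsilon> ^ CARD('n)) * g y (y + \<epsilon> *\<^sub>R h)"
        by (simp add: f_def mult.assoc)
      also have "ennreal (\<epsilon> ^ CARD('n)) * ennreal (K h / \<epsilon> ^ CARD('n)) = ennreal (K h)"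
        using \<epsilon> K0[of h] by (simp add: ennreal_mult[symmetric])
      finally show "ennreal (\<epsilon> ^ CARD('n)) * f (y + \<epsilon> *\<^sub>R h) = ennreal (K h) * g y (y + \<epsilon> *\<^sub>R h)" .
    qed
    finally show ?thesis by (simp add: f_def)
  qed
  have "(\<integral>\<^sup>+y. (\<integral>\<^sup>+x. ennreal (scaled_kernel K \<epsilon> (y - x)) * g y x \<partial>lborel) \<partial>lborel)
    = (\<integral>\<^sup>+y. (\<integral>\<^sup>+h. ennreal (K h) * g y (y + \<epsilon> *\<^sub>R h) \<partial>lborel) \<partial>lborel)" by (simp only: inner)
  also have "\<dots> = (\<integral>\<^sup>+h. (\<integral>\<^sup>+y. ennreal (K h) * g y (y + \<epsilon> *\<^sub>R h) \<partial>lborel) \<partial>lborel)"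
  proof (rule lborel_pair.Fubini')
    have "(\<lambda>p. (snd p, fst p)) \<in> borel \<Otimes>\<^sub>M borel \<rightarrow>\<^sub>M borel \<Otimes>\<^sub>M (borel :: (real^'n) measure)" by measurable
    from measurable_compose[OF this g2]
    have "(\<lambda>p::(real^'n) \<times> (real^'n). g (snd p) (snd p + \<epsilon> *\<^sub>R fst p)) \<in> borel_measurable (borel \<Otimes>\<^sub>M borel)" by simp
    then have "(\<lambda>p. ennreal (K (fst p)) * g (snd p) (snd p + \<epsilon> *\<^sub>R fst p)) \<in> borel_measurable (borel \<Otimes>\<^sub>M borel)"
      by (intro borel_measurable_times_ennreal) measurable
    then show "(\<lambda>(h, y). ennreal (K h) * g y (y + \<epsilon> *\<^sub>R h)) \<in> borel_measurable (lborel \<Otimes>\<^sub>M lborel)"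
      by (simp add: case_prod_beta cong: measurable_cong_sets)
  qed
  also have "\<dots> = (\<integral>\<^sup>+h. ennreal (K h) * (\<integral>\<^sup>+y. g y (y + \<epsilon> *\<^sub>R h) \<partial>lborel) \<partial>lborel)"
  proof -
    have "(\<lambda>y. g y (y + \<epsilon> *\<^sub>R h)) \<in> borel_measurable lborel" for h
    proof -
      have "(\<lambda>y. (y, h)) \<in> borel \<rightarrow>\<^sub>M borel \<Otimes>\<^sub>M (borel :: (real^'n) measure)" by measurable
      from measurable_compose[OF this g2] show ?thesis by simp
    qed
    then show ?thesis by (simp add: nn_integral_cmult)
  qed
  finally show ?thesis .
qed

lemma mult_Liminf_le_ennreal:
  fixes f :: "'a \<Rightarrow> ennreal"
  shows "c * Liminf G f \<le> Liminf G (\<lambda>x. c * f x)"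
  unfolding Liminf_def SUP_mult_left_ennreal
  by (intro SUP_mono bexI INF_greatest mult_left_mono INF_lower) auto

lemma nn_integral_kernel_directional:
  fixes K :: "real ^ 'n \<Rightarrow> real" and D :: "real ^ 'n \<Rightarrow> real ^ 'n"
  assumes K[measurable]: "K \<in> borel_measurable borel" and K0: "\<And>h. K h \<ge> 0" and rad: "\<And>h. K h = k (norm h)"
    and D[measurable]: "D \<in> borel_measurable borel" and S[measurable]: "S \<in> sets borel"
  shows "(\<integral>\<^sup>+h. ennreal (K h) * (\<integral>\<^sup>+x\<in>S. ennreal \<bar>D x \<bullet> h\<bar> \<partial>lborel) \<partial>lborel)
    = (\<integral>\<^sup>+h. ennreal (K h * \<bar>h $ i\<bar>) \<partial>lborel) * (\<integral>\<^sup>+x\<in>S. ennreal (norm (D x)) \<partial>lborel)"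
proof -
  have "(\<integral>\<^sup>+h. ennreal (K h) * (\<integral>\<^sup>+x\<in>S. ennreal \<bar>D x \<bullet> h\<bar> \<partial>lborel) \<partial>lborel)
     = (\<integral>\<^sup>+h. (\<integral>\<^sup>+x. ennreal (K h * \<bar>D x \<bullet> h\<bar>) * indicator S x \<partial>lborel) \<partial>lborel)"
    using K0 by (intro nn_integral_cong, subst nn_integral_cmult[symmetric]) (auto simp: ennreal_mult mult.assoc)
  also have "\<dots> = (\<integral>\<^sup>+x. (\<integral>\<^sup>+h. ennreal (K h * \<bar>D x \<bullet> h\<bar>) * indicator S x \<partial>lborel) \<partial>lborel)"
    by (rule lborel_pair.Fubini') measurable
  also have "\<dots> = (\<integral>\<^sup>+x. (\<integral>\<^sup>+h. ennreal (K h * \<bar>h $ i\<bar>) \<partial>lborel) * (ennreal (norm (D x)) * indicator S x) \<partial>lborel)"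
  proof (rule nn_integral_cong)
    fix x
    show "(\<integral>\<^sup>+h. ennreal (K h * \<bar>D x \<bullet> h\<bar>) * indicator S x \<partial>lborel)
      = (\<integral>\<^sup>+h. ennreal (K h * \<bar>h $ i\<bar>) \<partial>lborel) * (ennreal (norm (D x)) * indicator S x)"
      using nn_integral_radial_directional[OF K K0 rad, of "D x" i]
      by (subst nn_integral_multc) (auto simp: mult_ac)
  qed
  also have "\<dots> = (\<integral>\<^sup>+h. ennreal (K h * \<bar>h $ i\<bar>) \<partial>lborel) * (\<integral>\<^sup>+x\<in>S. ennreal (norm (D x)) \<partial>lborel)"
    by (rule nn_integral_cmult) measurable
  finally show ?thesis .
qed

text \<open>
Only the part of the sets within the support of \<open>H\<close> around \<open>x\<close> matters, so local \<open>L\<^sup>1\<close> convergence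
gives pointwise convergence of the convolutions.
\<close>

lemma conv_indicator_tendsto:
  fixes H :: "'a::euclidean_space \<Rightarrow> 'b::euclidean_space"
  assumes H: "continuous_on UNIV H" "\<And>x. norm x > R \<Longrightarrow> H x = 0"
    and F[measurable]: "\<And>k::nat. F k \<in> sets borel" and E[measurable]: "E \<in> sets borel"
    and lim: "(\<lambda>k. emeasure lborel (sym_diff (F k) E \<inter> cball x R)) \<longlonglongrightarrow> 0"
  shows "(\<lambda>k. conv (indicat_real (F k)) H x) \<longlonglongrightarrow> conv (indicat_real E) H x"
proof -
  obtain B where B: "B > 0" "\<And>x. norm (H x) \<le> B"
    by (rule bounded_continuous_compact_support[OF H(1), where R = R]) (erule H(2), rule that)
  have Hm[measurable]: "H \<in> borel_measurable borel" by (rule borel_measurable_continuous_onI[OF H(1)])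
  have ib: "\<bar>indicat_real A z\<bar> \<le> 1" for A :: "'a set" and z by (simp add: indicator_def)
  let ?S = "\<lambda>k. sym_diff (F k) E \<inter> cball x R"
  have fin: "emeasure lborel (?S k) < \<infinity>" for k
    by (intro emeasure_bounded_finite bounded_subset[OF bounded_cball[of x R]]) auto
  have [measurable]: "cball x R \<in> sets borel" by simp
  have Sm[measurable]: "?S k \<in> sets borel" for k by measurable
  have est: "norm (conv (indicat_real (F k)) H x - conv (indicat_real E) H x) \<le> B * measure lborel (?S k)" for k
  proof -
    have i1: "integrable lborel (\<lambda>z. indicat_real (F k) z *\<^sub>R H (x - z))"
      by (rule conv_integrable[OF H _ ib]) (auto intro: borel_measurable_indicator)
    have i2: "integrable lborel (\<lambda>z. indicat_real E z *\<^sub>R H (x - z))"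
      by (rule conv_integrable[OF H _ ib]) (auto intro: borel_measurable_indicator)
    have iS: "integrable lborel (\<lambda>z. indicat_real (?S k) z *\<^sub>R B)"
      using fin[of k] Sm[of k] by (intro integrable_real_indicator[THEN integrable_scaleR_left]) auto
    have "conv (indicat_real (F k)) H x - conv (indicat_real E) H x
        = (\<integral>z. indicat_real (F k) z *\<^sub>R H (x - z) - indicat_real E z *\<^sub>R H (x - z) \<partial>lborel)"
      unfolding conv_def using i1 i2 by simp
    also have "norm \<dots> \<le> (\<integral>z. indicat_real (?S k) z *\<^sub>R B \<partial>lborel)"
    proof (rule Bochner_Integration.integral_norm_bound_integral)
      fix z
      show "norm (indicat_real (F k) z *\<^sub>R H (x - z) - indicat_real E z *\<^sub>R H (x - z)) \<le> indicat_real (?S k) z *\<^sub>R B"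
      proof (cases "norm (x - z) \<le> R")
        case True
        then have "z \<in> cball x R" by (simp add: dist_norm)
        then show ?thesis using B(1) B(2)[of "x - z"] by (auto simp: indicator_def)
      next
        case False
        then show ?thesis using H(2)[of "x - z"] B(1) by simp
      qed
    qed (use i1 i2 iS in auto)
    also have "\<dots> = B * measure lborel (?S k)" using Sm[of k] by simp
    finally show ?thesis .
  qed
  have "(\<lambda>k. measure lborel (?S k)) \<longlonglongrightarrow> 0"
  proof -
    have "(\<lambda>k. ennreal (measure lborel (?S k))) \<longlonglongrightarrow> ennreal 0"
      using lim fin by (simp add: emeasure_eq_ennreal_measure[symmetric] less_top[symmetric])
    then show ?thesis by (subst (asm) tendsto_ennreal_iff) auto
  qed
  then have "(\<lambda>k. B * measure lborel (?S k)) \<longlonglongrightarrow> 0" by (intro tendsto_mult_right_zero)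
  then have "(\<lambda>k. conv (indicat_real (F k)) H x - conv (indicat_real E) H x) \<longlonglongrightarrow> 0"
    by (rule Lim_null_comparison[rotated]) (use est in auto)
  then show ?thesis by (simp add: LIM_zero_iff)
qed

text \<open>
Jensen's inequality: a difference of mollified values is an average of differences of the indicator
at points shifted by at most \<open>\<eta>\<close>. Both end points of each shifted increment stay in \<open>\<Omega>\<close> because
\<open>|h| \<le> \<eta>\<close> and \<open>C\<close> has distance at least \<open>2 \<eta>\<close> from the complement of \<open>\<Omega>\<close>.
\<close>

lemma mollified_difference_le:
  fixes \<Omega> :: "'a::euclidean_space set"
  assumes \<eta>: "\<eta> > 0" and F[measurable]: "F \<in> sets borel" and C[measurable]: "C \<in> sets borel" and \<Omega>[measurable]: "\<Omega> \<in> sets borel"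
    and C\<Omega>: "\<And>x. x \<in> C \<Longrightarrow> cball x (2 * \<eta>) \<subseteq> \<Omega>" and h: "norm h \<le> \<eta>"
  shows "(\<integral>\<^sup>+x\<in>C. ennreal \<bar>mollified \<eta> F (x + h) - mollified \<eta> F x\<bar> \<partial>lborel)
    \<le> (\<integral>\<^sup>+y. jump F h y * indicator \<Omega> y * indicator \<Omega> (y + h) \<partial>lborel)"
proof -
  let ?f = "indicat_real F"
  have f1: "\<bar>?f z\<bar> \<le> 1" for z by (simp add: indicator_def)
  define A where "A = (\<integral>\<^sup>+y. ennreal \<bar>?f y - ?f (y + h)\<bar> * indicator \<Omega> y * indicator \<Omega> (y + h) \<partial>lborel)"
  have pw: "ennreal \<bar>conv ?f (moll \<eta>) (x + h) - conv ?f (moll \<eta>) x\<bar> * indicator C x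
     \<le> (\<integral>\<^sup>+z. ennreal (moll \<eta> z) * (ennreal \<bar>?f (x - z) - ?f (x - z + h)\<bar> * indicator \<Omega> (x - z) * indicator \<Omega> (x - z + h)) \<partial>lborel)" for x
  proof (cases "x \<in> C")
    case True
    have cm: "conv ?f (moll \<eta>) = conv (moll \<eta>) ?f" by (rule conv_commute) measurable
    have im: "integrable lborel (\<lambda>z. moll \<eta> z * ?f (y - z))" for y
    proof (rule Bochner_Integration.integrable_bound[OF integrable_moll[OF \<eta>]])
      show "AE z in lborel. norm (moll \<eta> z * ?f (y - z)) \<le> norm (moll \<eta> z)"
        by (rule AE_I2) (auto simp: indicator_def)
    qed measurable
    have "conv ?f (moll \<eta>) (x + h) - conv ?f (moll \<eta>) x = (\<integral>z. moll \<eta> z * ?f (x + h - z) - moll \<eta> z * ?f (x - z) \<partial>lborel)"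
      unfolding cm unfolding conv_def real_scaleR_def by (rule Bochner_Integration.integral_diff[symmetric, OF im im])
    also have "ennreal \<bar>\<dots>\<bar> \<le> (\<integral>\<^sup>+z. ennreal (norm (moll \<eta> z * ?f (x + h - z) - moll \<eta> z * ?f (x - z))) \<partial>lborel)"
      unfolding real_norm_def[symmetric]
      by (rule integral_norm_bound_ennreal) (intro Bochner_Integration.integrable_diff im)
    also have "\<dots> \<le> (\<integral>\<^sup>+z. ennreal (moll \<eta> z) * (ennreal \<bar>?f (x - z) - ?f (x - z + h)\<bar> * indicator \<Omega> (x - z) * indicator \<Omega> (x - z + h)) \<partial>lborel)"
    proof (rule nn_integral_mono)
      fix z
      show "ennreal (norm (moll \<eta> z * ?f (x + h - z) - moll \<eta> z * ?f (x - z)))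
        \<le> ennreal (moll \<eta> z) * (ennreal \<bar>?f (x - z) - ?f (x - z + h)\<bar> * indicator \<Omega> (x - z) * indicator \<Omega> (x - z + h))"
      proof (cases "norm z \<le> \<eta>")
        case True
        have "x - z \<in> cball x (2 * \<eta>)" using True \<eta> by (simp add: dist_norm)
        moreover have "x - z + h \<in> cball x (2 * \<eta>)"
          using norm_triangle_ineq4[of z h] True h by (simp add: dist_norm algebra_simps)
        ultimately have mem: "x - z \<in> \<Omega>" "x - z + h \<in> \<Omega>" using C\<Omega>[OF \<open>x \<in> C\<close>] by auto
        have "norm (moll \<eta> z * ?f (x + h - z) - moll \<eta> z * ?f (x - z)) = moll \<eta> z * \<bar>?f (x - z) - ?f (x - z + h)\<bar>"
        proof -
          have "x + h - z = x - z + h" by simp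
          then show ?thesis
            using moll_nonneg[OF \<eta>, of z] by (simp only: right_diff_distrib[symmetric] real_norm_def abs_mult abs_minus_commute abs_of_nonneg)
        qed
        then show ?thesis using mem moll_nonneg[OF \<eta>, of z] by (simp add: ennreal_mult)
      next
        case False
        then have "moll \<eta> z = 0" using moll_outside[OF \<eta>, of z] by simp
        then show ?thesis by simp
      qed
    qed
    finally show ?thesis using True by simp
  qed simp
  have "(\<integral>\<^sup>+x\<in>C. ennreal \<bar>conv ?f (moll \<eta>) (x + h) - conv ?f (moll \<eta>) x\<bar> \<partial>lborel)
    \<le> (\<integral>\<^sup>+x. (\<integral>\<^sup>+z. ennreal (moll \<eta> z) * (ennreal \<bar>?f (x - z) - ?f (x - z + h)\<bar> * indicator \<Omega> (x - z) * indicator \<Omega> (x - z + h)) \<partial>lborel) \<partial>lborel)"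
    by (intro nn_integral_mono pw)
  also have "\<dots> = (\<integral>\<^sup>+z. (\<integral>\<^sup>+x. ennreal (moll \<eta> z) * (ennreal \<bar>?f (x - z) - ?f (x - z + h)\<bar> * indicator \<Omega> (x - z) * indicator \<Omega> (x - z + h)) \<partial>lborel) \<partial>lborel)"
    by (rule lborel_pair.Fubini') measurable
  also have "\<dots> = (\<integral>\<^sup>+z. ennreal (moll \<eta> (z::'a)) * A \<partial>lborel)"
  proof (rule nn_integral_cong)
    fix z
    have "(\<integral>\<^sup>+x. ennreal \<bar>?f (- z + x) - ?f (- z + x + h)\<bar> * indicator \<Omega> (- z + x) * indicator \<Omega> (- z + x + h) \<partial>lborel) = A"
      unfolding A_def
      by (rule nn_integral_lborel_shift[of "\<lambda>y. ennreal \<bar>?f y - ?f (y + h)\<bar> * indicator \<Omega> y * indicator \<Omega> (y + h)"]) measurable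
    then show "(\<integral>\<^sup>+x. ennreal (moll \<eta> z) * (ennreal \<bar>?f (x - z) - ?f (x - z + h)\<bar> * indicator \<Omega> (x - z) * indicator \<Omega> (x - z + h)) \<partial>lborel) = ennreal (moll \<eta> z) * A"
      by (subst nn_integral_cmult) (simp_all add: algebra_simps)
  qed
  also have "\<dots> = A" by (simp add: nn_integral_multc nn_integral_moll[OF \<eta>])
  finally show ?thesis by (simp add: A_def)
qed

lemma moll_linearization:
  assumes \<eta>: "\<eta> > 0" and e: "e > 0"
  shows "\<exists>d>0. \<forall>f x (h::'a::euclidean_space). f \<in> borel_measurable borel \<and> (\<forall>z. \<bar>f z\<bar> \<le> 1) \<and> norm h < d \<longrightarrow>
         \<bar>conv f (moll \<eta>) (x + h) - conv f (moll \<eta>) x - conv f (moll_grad \<eta>) x \<bullet> h\<bar> \<le> e * norm h"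
proof -
  have o: "\<And>x::'a. norm x > \<eta> \<Longrightarrow> moll \<eta> x = 0" "\<And>x::'a. norm x > \<eta> \<Longrightarrow> moll_grad \<eta> x = 0"
    using moll_outside[OF \<eta>] moll_grad_outside[OF \<eta>] by auto
  show ?thesis
    by (rule conv_linearization[OF moll_has_derivative o(1) continuous_moll_grad o(2) e]) blast+
qed

text \<open>
For fixed \<open>\<eta>\<close> the difference quotients of the mollified sets converge pointwise to the directional
derivative of the mollification of \<open>E\<close>. Fatou's lemma in \<open>x\<close>, together with the Jensen estimate,
bounds the inner integral for each \<open>h\<close>; Fatou's lemma in \<open>h\<close> then integrates these bounds against
\<open>K\<close>, which may fail to be integrable near \<open>0\<close>.
\<close>

lemma liminf_interaction_ge:
  fixes K :: "real ^ 'n \<Rightarrow> real" and \<Omega> E :: "(real ^ 'n) set"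
  assumes K[measurable]: "K \<in> borel_measurable borel" and K0: "\<And>h. K h \<ge> 0"
    and \<Omega>[measurable]: "\<Omega> \<in> sets borel" and E[measurable]: "E \<in> sets borel"
    and F[measurable]: "\<And>k::nat. F k \<in> sets borel"
    and lim: "\<And>C. compact C \<Longrightarrow> (\<lambda>k. emeasure lborel (sym_diff (F k) E \<inter> C)) \<longlonglongrightarrow> 0"
    and \<epsilon>: "\<And>k. \<epsilon> k > 0" "\<epsilon> \<longlonglongrightarrow> 0"
    and \<eta>: "\<eta> > 0" and C[measurable]: "C \<in> sets borel" and C\<Omega>: "\<And>x. x \<in> C \<Longrightarrow> cball x (2 * \<eta>) \<subseteq> \<Omega>"
  shows "(\<integral>\<^sup>+h. ennreal (K h) * (\<integral>\<^sup>+x\<in>C. ennreal \<bar>mollified_grad \<eta> E x \<bullet> h\<bar> \<partial>lborel) \<partial>lborel)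
    \<le> liminf (\<lambda>k. ennreal (1 / \<epsilon> k) * (\<integral>\<^sup>+h. ennreal (K h) * (\<integral>\<^sup>+y. jump (F k) (\<epsilon> k *\<^sub>R h) y * indicator \<Omega> y * indicator \<Omega> (y + \<epsilon> k *\<^sub>R h) \<partial>lborel) \<partial>lborel))"
proof -
  let ?u = "\<lambda>k. mollified \<eta> (F k)"
  let ?g = "\<lambda>k. mollified_grad \<eta> (F k)"
  let ?gE = "mollified_grad \<eta> E"
  have ib: "\<bar>indicat_real A z\<bar> \<le> 1" for A :: "(real^'n) set" and z by (simp add: indicator_def)
  have um[measurable]: "?u k \<in> borel_measurable borel" for k
    by (rule borel_measurable_continuous_onI[OF continuous_conv_moll[OF \<eta> _ ib]]) (rule borel_measurable_indicator[OF F])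
  have gm[measurable]: "?gE \<in> borel_measurable borel"
    by (rule borel_measurable_continuous_onI[OF continuous_conv_moll_grad[OF \<eta> _ ib]]) (rule borel_measurable_indicator[OF E])
  define A where "A k h = (\<integral>\<^sup>+y. jump (F k) (\<epsilon> k *\<^sub>R h) y * indicator \<Omega> y * indicator \<Omega> (y + \<epsilon> k *\<^sub>R h) \<partial>lborel)" for k h
  have Am[measurable]: "A k \<in> borel_measurable borel" for k unfolding A_def by measurable
  have quot: "(\<lambda>k. (?u k (x + \<epsilon> k *\<^sub>R h) - ?u k x) / \<epsilon> k) \<longlonglongrightarrow> ?gE x \<bullet> h" for x h
  proof -
    have g: "(\<lambda>k. ?g k x) \<longlonglongrightarrow> ?gE x"
      by (rule conv_indicator_tendsto[OF continuous_moll_grad moll_grad_outside[OF \<eta>] F E lim]) auto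
    have "(\<lambda>k. (?u k (x + \<epsilon> k *\<^sub>R h) - ?u k x) / \<epsilon> k - ?g k x \<bullet> h) \<longlonglongrightarrow> 0"
    proof (rule LIMSEQ_I)
      fix r :: real assume "r > 0"
      define e where "e = r / (2 * (norm h + 1))"
      have e: "e > 0" "e * norm h < r"
      proof -
        have "0 < r * norm h + r * 2" using \<open>r > 0\<close> by (intro add_nonneg_pos) auto
        then show "e > 0" "e * norm h < r" using \<open>r > 0\<close> norm_ge_zero[of h] by (auto simp: e_def field_simps add_pos_nonneg)
      qed
      obtain d where d: "d > 0" "\<forall>f x (h::real^'n). f \<in> borel_measurable borel \<and> (\<forall>z. \<bar>f z\<bar> \<le> 1) \<and> norm h < d \<longrightarrow>
         \<bar>conv f (moll \<eta>) (x + h) - conv f (moll \<eta>) x - conv f (moll_grad \<eta>) x \<bullet> h\<bar> \<le> e * norm h"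
        using moll_linearization[OF \<eta> e(1)] by blast
      have "(\<lambda>k. norm (\<epsilon> k *\<^sub>R h)) \<longlonglongrightarrow> norm (0 *\<^sub>R h)" by (intro tendsto_intros \<epsilon>(2))
      then have "eventually (\<lambda>k. norm (\<epsilon> k *\<^sub>R h) < d) sequentially"
        using d(1) by (intro order_tendstoD) auto
      then obtain N where N: "\<And>k. k \<ge> N \<Longrightarrow> norm (\<epsilon> k *\<^sub>R h) < d" by (auto simp: eventually_sequentially)
      show "\<exists>N. \<forall>k\<ge>N. norm ((?u k (x + \<epsilon> k *\<^sub>R h) - ?u k x) / \<epsilon> k - ?g k x \<bullet> h - 0) < r"
      proof (intro exI[of _ N] allI impI)
        fix k assume "k \<ge> N"
        have "\<bar>?u k (x + \<epsilon> k *\<^sub>R h) - ?u k x - ?g k x \<bullet> (\<epsilon> k *\<^sub>R h)\<bar> \<le> e * norm (\<epsilon> k *\<^sub>R h)"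
          by (rule d(2)[rule_format]) (use N[OF \<open>k \<ge> N\<close>] borel_measurable_indicator[OF F] ib in blast)
        moreover have "(?u k (x + \<epsilon> k *\<^sub>R h) - ?u k x) / \<epsilon> k - ?g k x \<bullet> h = (?u k (x + \<epsilon> k *\<^sub>R h) - ?u k x - ?g k x \<bullet> (\<epsilon> k *\<^sub>R h)) / \<epsilon> k"
          using \<epsilon>(1)[of k] by (simp add: field_simps)
        ultimately have "norm ((?u k (x + \<epsilon> k *\<^sub>R h) - ?u k x) / \<epsilon> k - ?g k x \<bullet> h) \<le> e * norm h"
          using \<epsilon>(1)[of k] by (simp add: abs_divide divide_le_eq mult_ac)
        then show "norm ((?u k (x + \<epsilon> k *\<^sub>R h) - ?u k x) / \<epsilon> k - ?g k x \<bullet> h - 0) < r" using e(2) by simp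
      qed
    qed
    from tendsto_add[OF this tendsto_inner[OF g tendsto_const[of h]]] show ?thesis by simp
  qed
  have dir: "(\<integral>\<^sup>+x\<in>C. ennreal \<bar>?gE x \<bullet> h\<bar> \<partial>lborel) \<le> liminf (\<lambda>k. ennreal (1 / \<epsilon> k) * A k h)" for h
  proof -
    have "(\<integral>\<^sup>+x\<in>C. ennreal \<bar>?gE x \<bullet> h\<bar> \<partial>lborel)
      = (\<integral>\<^sup>+x. liminf (\<lambda>k. ennreal (1 / \<epsilon> k) * (ennreal \<bar>?u k (x + \<epsilon> k *\<^sub>R h) - ?u k x\<bar> * indicator C x)) \<partial>lborel)"
    proof (rule nn_integral_cong)
      fix x
      have "(\<lambda>k. ennreal \<bar>(?u k (x + \<epsilon> k *\<^sub>R h) - ?u k x) / \<epsilon> k\<bar>) \<longlonglongrightarrow> ennreal \<bar>?gE x \<bullet> h\<bar>"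
        by (intro tendsto_ennrealI tendsto_rabs quot)
      then have "(\<lambda>k. ennreal \<bar>(?u k (x + \<epsilon> k *\<^sub>R h) - ?u k x) / \<epsilon> k\<bar> * indicator C x) \<longlonglongrightarrow> ennreal \<bar>?gE x \<bullet> h\<bar> * indicator C x"
        by (cases "x \<in> C") simp_all
      moreover have "ennreal \<bar>(?u k (x + \<epsilon> k *\<^sub>R h) - ?u k x) / \<epsilon> k\<bar> * indicator C x
         = ennreal (1 / \<epsilon> k) * (ennreal \<bar>?u k (x + \<epsilon> k *\<^sub>R h) - ?u k x\<bar> * indicator C x)" for k
      proof -
        have "\<bar>(?u k (x + \<epsilon> k *\<^sub>R h) - ?u k x) / \<epsilon> k\<bar> = 1 / \<epsilon> k * \<bar>?u k (x + \<epsilon> k *\<^sub>R h) - ?u k x\<bar>"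
          using \<epsilon>(1)[of k] by (simp add: abs_divide)
        then have "ennreal \<bar>(?u k (x + \<epsilon> k *\<^sub>R h) - ?u k x) / \<epsilon> k\<bar> = ennreal (1 / \<epsilon> k) * ennreal \<bar>?u k (x + \<epsilon> k *\<^sub>R h) - ?u k x\<bar>"
          using \<epsilon>(1)[of k] by (simp only:) (rule ennreal_mult, auto)
        then show ?thesis by (simp only: mult.assoc)
      qed
      ultimately have "(\<lambda>k. ennreal (1 / \<epsilon> k) * (ennreal \<bar>?u k (x + \<epsilon> k *\<^sub>R h) - ?u k x\<bar> * indicator C x)) \<longlonglongrightarrow> ennreal \<bar>?gE x \<bullet> h\<bar> * indicator C x"
        by simp
      then show "ennreal \<bar>?gE x \<bullet> h\<bar> * indicator C x = liminf (\<lambda>k. ennreal (1 / \<epsilon> k) * (ennreal \<bar>?u k (x + \<epsilon> k *\<^sub>R h) - ?u k x\<bar> * indicator C x))"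
        by (intro lim_imp_Liminf[symmetric]) auto
    qed
    also have "\<dots> \<le> liminf (\<lambda>k. \<integral>\<^sup>+x. ennreal (1 / \<epsilon> k) * (ennreal \<bar>?u k (x + \<epsilon> k *\<^sub>R h) - ?u k x\<bar> * indicator C x) \<partial>lborel)"
      by (rule nn_integral_liminf) measurable
    also have "\<dots> \<le> liminf (\<lambda>k. ennreal (1 / \<epsilon> k) * A k h)"
    proof (rule Liminf_mono)
      have "(\<lambda>k. norm (\<epsilon> k *\<^sub>R h)) \<longlonglongrightarrow> norm (0 *\<^sub>R h)" by (intro tendsto_intros \<epsilon>(2))
      then have "eventually (\<lambda>k. norm (\<epsilon> k *\<^sub>R h) < \<eta>) sequentially"
        using \<eta> by (intro order_tendstoD) auto
      then show "eventually (\<lambda>k. (\<integral>\<^sup>+x. ennreal (1 / \<epsilon> k) * (ennreal \<bar>?u k (x + \<epsilon> k *\<^sub>R h) - ?u k x\<bar> * indicator C x) \<partial>lborel) \<le> ennreal (1 / \<epsilon> k) * A k h) sequentially"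
      proof eventually_elim
        case (elim k)
        have "(\<integral>\<^sup>+x. ennreal (1 / \<epsilon> k) * (ennreal \<bar>?u k (x + \<epsilon> k *\<^sub>R h) - ?u k x\<bar> * indicator C x) \<partial>lborel)
          = ennreal (1 / \<epsilon> k) * (\<integral>\<^sup>+x\<in>C. ennreal \<bar>?u k (x + \<epsilon> k *\<^sub>R h) - ?u k x\<bar> \<partial>lborel)"
          by (rule nn_integral_cmult) measurable
        also have "\<dots> \<le> ennreal (1 / \<epsilon> k) * A k h"
          unfolding A_def using elim by (intro mult_left_mono mollified_difference_le[OF \<eta> F C \<Omega> C\<Omega>]) auto
        finally show ?case .
      qed
    qed
    finally show ?thesis .
  qed
  have "(\<integral>\<^sup>+h. ennreal (K h) * (\<integral>\<^sup>+x\<in>C. ennreal \<bar>?gE x \<bullet> h\<bar> \<partial>lborel) \<partial>lborel)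
    \<le> (\<integral>\<^sup>+h. liminf (\<lambda>k. ennreal (1 / \<epsilon> k) * (ennreal (K h) * A k h)) \<partial>lborel)"
  proof (rule nn_integral_mono)
    fix h
    have "ennreal (K h) * (\<integral>\<^sup>+x\<in>C. ennreal \<bar>?gE x \<bullet> h\<bar> \<partial>lborel) \<le> ennreal (K h) * liminf (\<lambda>k. ennreal (1 / \<epsilon> k) * A k h)"
      by (intro mult_left_mono dir) auto
    also have "\<dots> \<le> liminf (\<lambda>k. ennreal (K h) * (ennreal (1 / \<epsilon> k) * A k h))"
      by (rule mult_Liminf_le_ennreal)
    finally show "ennreal (K h) * (\<integral>\<^sup>+x\<in>C. ennreal \<bar>?gE x \<bullet> h\<bar> \<partial>lborel) \<le> liminf (\<lambda>k. ennreal (1 / \<epsilon> k) * (ennreal (K h) * A k h))"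
      by (simp add: mult_ac)
  qed
  also have "\<dots> \<le> liminf (\<lambda>k. \<integral>\<^sup>+h. ennreal (1 / \<epsilon> k) * (ennreal (K h) * A k h) \<partial>lborel)"
    by (rule nn_integral_liminf) measurable
  also have "\<dots> = liminf (\<lambda>k. ennreal (1 / \<epsilon> k) * (\<integral>\<^sup>+h. ennreal (K h) * A k h \<partial>lborel))"
    by (subst nn_integral_cmult) measurable
  finally show ?thesis unfolding A_def .
qed

section \<open>Deformations that push the domain inwards\<close>

lemma moll_pos: "\<eta> > 0 \<Longrightarrow> norm x < \<eta> \<Longrightarrow> moll \<eta> (x::'a::euclidean_space) > 0"
proof -
  assume "\<eta> > 0" "norm x < \<eta>"
  then have "x \<bullet> x < \<eta>\<^sup>2" by (simp add: dot_square_norm power_strict_mono)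
  then show ?thesis using bump_mass_pos[OF \<open>\<eta> > 0\<close>, where 'a='a] by (simp add: moll_def bump_def)
qed

lemma moll_zero: "\<eta> > 0 \<Longrightarrow> norm x \<ge> \<eta> \<Longrightarrow> moll \<eta> (x::'a::euclidean_space) = 0"
proof -
  assume "\<eta> > 0" "norm x \<ge> \<eta>"
  then have "\<eta>\<^sup>2 \<le> x \<bullet> x" by (simp add: dot_square_norm power_mono)
  then show ?thesis by (simp add: moll_def bump_def)
qed

text \<open>
A vertical shift does not change the projection at which \<open>g\<close> is evaluated. On the closure of the
domain the graph inequality holds in its weak form by continuity of \<open>g\<close>, and a strictly positive
shift makes it strict.
\<close>

lemma vertical_shift_into_domain:
  fixes \<Omega> :: "'a::euclidean_space set"
  assumes \<nu>: "norm \<nu> = 1" and g: "continuous_on {z. z \<bullet> \<nu> = 0} g"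
    and graph: "\<Omega> \<inter> ball p r = {x \<in> ball p r. g (x - (x \<bullet> \<nu>) *\<^sub>R \<nu>) < x \<bullet> \<nu>}"
    and y: "y \<in> closure \<Omega>" "y \<in> ball p r" and s: "s > 0" "y + s *\<^sub>R \<nu> \<in> ball p r"
  shows "y + s *\<^sub>R \<nu> \<in> \<Omega>"
proof -
  have \<nu>\<nu>: "\<nu> \<bullet> \<nu> = 1" using \<nu> by (simp add: dot_square_norm)
  define q where "q x = g (x - (x \<bullet> \<nu>) *\<^sub>R \<nu>) - x \<bullet> \<nu>" for x
  have qc: "continuous_on UNIV q"
    unfolding q_def
  proof (intro continuous_on_diff)
    show "continuous_on UNIV (\<lambda>x. g (x - (x \<bullet> \<nu>) *\<^sub>R \<nu>))"
      by (rule continuous_on_compose2[OF g]) (auto intro!: continuous_intros simp: inner_diff_left \<nu>\<nu>)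
  qed (intro continuous_intros)
  have "y \<in> closure (ball p r \<inter> \<Omega>)" using open_Int_closure_subset[of "ball p r" \<Omega>] y by auto
  also have "\<dots> \<subseteq> {x. q x \<le> 0}"
  proof (rule closure_minimal)
    show "ball p r \<inter> \<Omega> \<subseteq> {x. q x \<le> 0}"
    proof
      fix x assume "x \<in> ball p r \<inter> \<Omega>"
      then have "x \<in> {x \<in> ball p r. g (x - (x \<bullet> \<nu>) *\<^sub>R \<nu>) < x \<bullet> \<nu>}" using graph by blast
      then show "x \<in> {x. q x \<le> 0}" by (simp add: q_def)
    qed
    show "closed {x. q x \<le> 0}" by (intro closed_Collect_le qc continuous_on_const)
  qed
  finally have "q y \<le> 0" by simp
  moreover have sh: "y + s *\<^sub>R \<nu> - ((y + s *\<^sub>R \<nu>) \<bullet> \<nu>) *\<^sub>R \<nu> = y - (y \<bullet> \<nu>) *\<^sub>R \<nu>"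
    by (simp add: inner_add_left \<nu>\<nu> algebra_simps)
  ultimately have "g (y + s *\<^sub>R \<nu> - ((y + s *\<^sub>R \<nu>) \<bullet> \<nu>) *\<^sub>R \<nu>) < (y + s *\<^sub>R \<nu>) \<bullet> \<nu>"
    unfolding sh using s(1) by (simp add: q_def inner_add_left \<nu>\<nu>)
  then show ?thesis using s(2) graph by auto
qed

text \<open>
Near \<open>p\<close> the domain lies above a graph over the hyperplane normal to \<open>\<nu> p\<close>; the bump of radius \<open>r p\<close>
localizes the direction \<open>\<nu> p\<close> to that neighbourhood.
\<close>

definition push_field :: "'a set \<Rightarrow> ('a \<Rightarrow> 'a) \<Rightarrow> ('a \<Rightarrow> real) \<Rightarrow> 'a::euclidean_space \<Rightarrow> 'a" where
  "push_field P \<nu> r x = (\<Sum>p\<in>P. moll (r p) (x - p) *\<^sub>R \<nu> p)"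

text \<open>
The transpose of the derivative of \<^const>\<open>push_field\<close> at \<open>x\<close>, applied to \<open>v\<close>
(\<open>push_field_adjoint\<close>). It turns the chain rule for a composition with \<open>id + t X\<close> into a formula for
the gradient.
\<close>

definition push_deriv_adjoint :: "'a set \<Rightarrow> ('a \<Rightarrow> 'a) \<Rightarrow> ('a \<Rightarrow> real) \<Rightarrow> 'a::euclidean_space \<Rightarrow> 'a \<Rightarrow> 'a" where
  "push_deriv_adjoint P \<nu> r x v = (\<Sum>p\<in>P. (\<nu> p \<bullet> v) *\<^sub>R moll_grad (r p) (x - p))"

lemma push_field_has_derivative:
  "(push_field P \<nu> r has_derivative (\<lambda>h. \<Sum>p\<in>P. (moll_grad (r p) (x - p) \<bullet> h) *\<^sub>R \<nu> p)) (at x)"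
proof -
  have 1: "((\<lambda>x. x - p) has_derivative (\<lambda>h. h)) (at x)" for p
    by (auto intro!: derivative_eq_intros)
  have "((\<lambda>x. moll (r p) (x - p) *\<^sub>R \<nu> p) has_derivative (\<lambda>h. (moll_grad (r p) (x - p) \<bullet> h) *\<^sub>R \<nu> p)) (at x)" for p
    by (rule has_derivative_scaleR_left[OF has_derivative_compose[OF 1 moll_has_derivative]])
  then show ?thesis unfolding push_field_def[abs_def] by (intro has_derivative_sum)
qed

lemma push_field_adjoint:
  "v \<bullet> (\<Sum>p\<in>P. (moll_grad (r p) (x - p) \<bullet> h) *\<^sub>R \<nu> p) = push_deriv_adjoint P \<nu> r x v \<bullet> h"
  by (simp add: push_deriv_adjoint_def inner_sum_right inner_sum_left inner_commute mult.commute)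

text \<open>
One constant serves for the partial sums over \<open>Q \<subseteq> P\<close>, for the transpose of the derivative and for the
Lipschitz constant, the last two because an operator and its transpose have the same norm.
\<close>

lemma push_field_bounds:
  fixes P :: "'a::euclidean_space set"
  assumes P: "finite P" and r: "\<And>p. p \<in> P \<Longrightarrow> r p > 0" and \<nu>: "\<And>p. p \<in> P \<Longrightarrow> norm (\<nu> p) = 1"
  obtains M where "M > 0" "\<And>x Q. Q \<subseteq> P \<Longrightarrow> norm (push_field Q \<nu> r x) \<le> M"
    "\<And>x v. norm (push_deriv_adjoint P \<nu> r x v) \<le> M * norm v"
    "\<And>x y. norm (push_field P \<nu> r x - push_field P \<nu> r y) \<le> M * norm (x - y)"
proof -
  have "\<exists>B>0. \<forall>x::'a. norm (moll (r p) x) \<le> B \<and> norm (moll_grad (r p) x) \<le> B" if pP: "p \<in> P" for p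
  proof -
    obtain B1 where B1: "B1 > 0" "\<And>x::'a. norm (moll (r p) x) \<le> B1"
      by (rule bounded_continuous_compact_support[OF continuous_moll, where R = "r p"])
         (erule moll_outside[OF r[OF pP]], rule that)
    obtain B2 where B2: "B2 > 0" "\<And>x::'a. norm (moll_grad (r p) x) \<le> B2"
      by (rule bounded_continuous_compact_support[OF continuous_moll_grad, where R = "r p"])
         (erule moll_grad_outside[OF r[OF pP]], rule that)
    show ?thesis using B1 B2 by (intro exI[of _ "max B1 B2"]) (auto simp: le_max_iff_disj)
  qed
  then obtain B where B: "\<And>p. p \<in> P \<Longrightarrow> B p > 0" "\<And>p x. p \<in> P \<Longrightarrow> norm (moll (r p) (x::'a)) \<le> B p"
     "\<And>p x. p \<in> P \<Longrightarrow> norm (moll_grad (r p) (x::'a)) \<le> B p" by metis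
  define M where "M = (\<Sum>p\<in>P. B p) + 1"
  have MB: "(\<Sum>p\<in>P. B p) \<le> M" by (simp add: M_def)
  have M0: "M > 0" unfolding M_def using sum_nonneg[of P B] B(1) by (auto simp: less_imp_le add_nonneg_pos)
  have b1: "norm (push_field Q \<nu> r x) \<le> M" if "Q \<subseteq> P" for Q x
  proof -
    have "norm (push_field Q \<nu> r x) \<le> (\<Sum>p\<in>Q. norm (moll (r p) (x - p) *\<^sub>R \<nu> p))"
      unfolding push_field_def by (rule norm_sum)
    also have "\<dots> \<le> (\<Sum>p\<in>Q. B p)" using B(2) \<nu> that by (intro sum_mono) (auto simp: subset_iff)
    also have "\<dots> \<le> (\<Sum>p\<in>P. B p)" using that P B(1) by (intro sum_mono2) (auto simp: less_imp_le)
    finally show ?thesis using MB by simp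
  qed
  have b2: "norm (push_deriv_adjoint P \<nu> r x v) \<le> M * norm v" for x v
  proof -
    have "norm (push_deriv_adjoint P \<nu> r x v) \<le> (\<Sum>p\<in>P. norm ((\<nu> p \<bullet> v) *\<^sub>R moll_grad (r p) (x - p)))"
      unfolding push_deriv_adjoint_def by (rule norm_sum)
    also have "\<dots> \<le> (\<Sum>p\<in>P. norm v * B p)"
    proof (rule sum_mono)
      fix p assume "p \<in> P"
      have "\<bar>\<nu> p \<bullet> v\<bar> \<le> norm v" using Cauchy_Schwarz_ineq2[of "\<nu> p" v] \<nu>[OF \<open>p \<in> P\<close>] by simp
      then show "norm ((\<nu> p \<bullet> v) *\<^sub>R moll_grad (r p) (x - p)) \<le> norm v * B p"
        using B(3)[OF \<open>p \<in> P\<close>] by (auto intro!: mult_mono)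
    qed
    also have "\<dots> = (\<Sum>p\<in>P. B p) * norm v" by (simp add: sum_distrib_left mult.commute)
    also have "\<dots> \<le> M * norm v" using MB by (intro mult_right_mono) auto
    finally show ?thesis .
  qed
  have b3: "norm (push_field P \<nu> r x - push_field P \<nu> r y) \<le> M * norm (x - y)" for x y
  proof (rule differentiable_bound[where S = UNIV and f' = "\<lambda>x h. \<Sum>p\<in>P. (moll_grad (r p) (x - p) \<bullet> h) *\<^sub>R \<nu> p"])
    fix z :: 'a
    show "onorm (\<lambda>h. \<Sum>p\<in>P. (moll_grad (r p) (z - p) \<bullet> h) *\<^sub>R \<nu> p) \<le> M"
    proof (rule onorm_le)
      fix h
      let ?D = "\<Sum>p\<in>P. (moll_grad (r p) (z - p) \<bullet> h) *\<^sub>R \<nu> p"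
      have "norm ?D * norm ?D = push_deriv_adjoint P \<nu> r z ?D \<bullet> h"
        unfolding push_field_adjoint[symmetric] by (simp add: dot_square_norm power2_eq_square)
      also have "\<dots> \<le> norm (push_deriv_adjoint P \<nu> r z ?D) * norm h" by (rule norm_cauchy_schwarz)
      also have "\<dots> \<le> (M * norm ?D) * norm h" by (intro mult_right_mono b2) auto
      finally have "norm ?D * norm ?D \<le> (M * norm h) * norm ?D" by (simp add: mult_ac)
      then show "norm ?D \<le> M * norm h"
        using M0 by (cases "norm ?D = 0") (auto simp: mult_le_cancel_right)
    qed
  qed (auto intro: has_derivative_at_withinI push_field_has_derivative)
  show ?thesis by (rule that[OF M0 b1 b2 b3])
qed

text \<open>
Finitely many local graphs cover the boundary. The displacement \<open>t X(x)\<close> is a sum of steps along the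
directions \<open>\<nu> p\<close>, taken one after the other. A step is nonzero only if \<open>x\<close> lies within \<open>r p\<close> of
\<open>p\<close>, and then, for small \<open>t\<close>, all intermediate points lie in the ball of radius \<open>2 * r p\<close> in which
the graph description at \<open>p\<close> is valid. So every nonzero step leads from the closure of the domain into
the domain, and a boundary point makes at least one nonzero step.
\<close>

lemma inward_push_field:
  fixes \<Omega> :: "'a::euclidean_space set"
  assumes \<Omega>: "open \<Omega>" "bounded \<Omega>" "lipschitz_boundary \<Omega>"
  obtains P \<nu> r t0 where "finite P" "\<And>p. p \<in> P \<Longrightarrow> r p > 0" "\<And>p. p \<in> P \<Longrightarrow> norm (\<nu> p) = 1" "t0 > 0"
    "\<And>t x. 0 < t \<Longrightarrow> t < t0 \<Longrightarrow> x \<in> closure \<Omega> \<Longrightarrow> x + t *\<^sub>R push_field P \<nu> r x \<in> \<Omega>"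
proof -
  have "\<forall>p\<in>frontier \<Omega>. \<exists>\<nu> r g. norm \<nu> = 1 \<and> r > 0 \<and> continuous_on {z. z \<bullet> \<nu> = 0} g \<and>
      \<Omega> \<inter> ball p (2 * r) = {x \<in> ball p (2 * r). g (x - (x \<bullet> \<nu>) *\<^sub>R \<nu>) < x \<bullet> \<nu>}"
  proof
    fix p assume "p \<in> frontier \<Omega>"
    from \<Omega>(3)[unfolded lipschitz_boundary_def, rule_format, OF this] obtain \<nu> r L g where *: "norm \<nu> = 1" "r > 0" "L-lipschitz_on {z. z \<bullet> \<nu> = 0} g"
      "\<Omega> \<inter> ball p r = {x \<in> ball p r. g (x - (x \<bullet> \<nu>) *\<^sub>R \<nu>) < x \<bullet> \<nu>}"
      by (elim exE conjE) (rule that)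
    then show "\<exists>\<nu> r g. norm \<nu> = 1 \<and> r > 0 \<and> continuous_on {z. z \<bullet> \<nu> = 0} g \<and>
      \<Omega> \<inter> ball p (2 * r) = {x \<in> ball p (2 * r). g (x - (x \<bullet> \<nu>) *\<^sub>R \<nu>) < x \<bullet> \<nu>}"
      by (intro exI[of _ \<nu>] exI[of _ "r / 2"] exI[of _ g]) (simp add: lipschitz_on_continuous_on)
  qed
  from bchoice[OF this] obtain \<nu> where "\<forall>p\<in>frontier \<Omega>. \<exists>r g. norm (\<nu> p) = 1 \<and> r > 0 \<and> continuous_on {z. z \<bullet> \<nu> p = 0} g \<and>
      \<Omega> \<inter> ball p (2 * r) = {x \<in> ball p (2 * r). g (x - (x \<bullet> \<nu> p) *\<^sub>R \<nu> p) < x \<bullet> \<nu> p}" by blast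
  from bchoice[OF this] obtain r where "\<forall>p\<in>frontier \<Omega>. \<exists>g. norm (\<nu> p) = 1 \<and> r p > 0 \<and> continuous_on {z. z \<bullet> \<nu> p = 0} g \<and>
      \<Omega> \<inter> ball p (2 * r p) = {x \<in> ball p (2 * r p). g (x - (x \<bullet> \<nu> p) *\<^sub>R \<nu> p) < x \<bullet> \<nu> p}" by blast
  from bchoice[OF this] obtain g where loc: "\<And>p. p \<in> frontier \<Omega> \<Longrightarrow> norm (\<nu> p) = 1" "\<And>p. p \<in> frontier \<Omega> \<Longrightarrow> r p > 0"
    "\<And>p. p \<in> frontier \<Omega> \<Longrightarrow> continuous_on {z. z \<bullet> \<nu> p = 0} (g p)"
    "\<And>p. p \<in> frontier \<Omega> \<Longrightarrow> \<Omega> \<inter> ball p (2 * r p) = {x \<in> ball p (2 * r p). g p (x - (x \<bullet> \<nu> p) *\<^sub>R \<nu> p) < x \<bullet> \<nu> p}"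
    by blast
  have co: "compact (frontier \<Omega>)" using \<Omega>(2) by (rule compact_frontier_bounded)
  have sub: "frontier \<Omega> \<subseteq> (\<Union>p\<in>frontier \<Omega>. ball p (r p))"
    using loc(2) by auto
  obtain P where P: "P \<subseteq> frontier \<Omega>" "finite P" "frontier \<Omega> \<subseteq> (\<Union>p\<in>P. ball p (r p))"
    by (rule compactE_image[OF co _ sub]) (simp, rule that)
  have rP: "r p > 0" and \<nu>P: "norm (\<nu> p) = 1" if "p \<in> P" for p using that P(1) loc(1,2) by auto
  obtain M where M: "M > 0" "\<And>x Q. Q \<subseteq> P \<Longrightarrow> norm (push_field Q \<nu> r x) \<le> M"
    by (rule push_field_bounds[OF P(2) rP \<nu>P]) (assumption | rule that)+
  \<comment> \<open>Inserting \<open>1\<close> keeps the minimum defined when the boundary is empty.\<close>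
  define t0 where "t0 = Min (insert 1 (r ` P)) / M"
  have t0: "t0 > 0" using M(1) P(2) rP by (auto simp: t0_def)
  have t0r: "t * M < r p" if "t < t0" "p \<in> P" for t p
  proof -
    have "Min (insert 1 (r ` P)) \<le> r p" using P(2) that(2) by (intro Min_le) auto
    then show ?thesis using that(1) M(1) by (simp add: t0_def less_divide_eq)
  qed
  show ?thesis
  proof (rule that[OF P(2) rP \<nu>P t0])
    fix t x assume t: "0 < t" "t < t0" and x: "x \<in> closure \<Omega>"
    have dist: "norm (t *\<^sub>R push_field Q \<nu> r x) \<le> t * M" if "Q \<subseteq> P" for Q
      using M(2)[OF that, of x] t(1) by simp
    have "x + t *\<^sub>R push_field Q \<nu> r x \<in> closure \<Omega> \<and> (x \<in> \<Omega> \<or> (\<exists>p\<in>Q. norm (x - p) < r p) \<longrightarrow> x + t *\<^sub>R push_field Q \<nu> r x \<in> \<Omega>)"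
      if "finite Q" "Q \<subseteq> P" for Q
      using that
    proof (induction Q rule: finite_induct)
      case empty then show ?case using x by (simp add: push_field_def)
    next
      case (insert p Q)
      let ?y = "x + t *\<^sub>R push_field Q \<nu> r x"
      let ?s = "t * moll (r p) (x - p)"
      have p: "p \<in> P" "p \<in> frontier \<Omega>" using insert.prems P(1) by auto
      have step: "x + t *\<^sub>R push_field (insert p Q) \<nu> r x = ?y + ?s *\<^sub>R \<nu> p"
        using insert.hyps by (simp add: push_field_def algebra_simps)
      have IH: "?y \<in> closure \<Omega>" "x \<in> \<Omega> \<or> (\<exists>p\<in>Q. norm (x - p) < r p) \<longrightarrow> ?y \<in> \<Omega>"
        using insert.IH insert.prems by auto
      show ?case
      proof (cases "norm (x - p) < r p")
        case False
        then have "moll (r p) (x - p) = 0" using moll_zero[OF rP[OF p(1)], of "x - p"] by simp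
        then have "x + t *\<^sub>R push_field (insert p Q) \<nu> r x = ?y" using step by simp
        then show ?thesis using IH False by auto
      next
        case True
        have close: "x + t *\<^sub>R push_field R \<nu> r x \<in> ball p (2 * r p)" if "R \<subseteq> P" for R
        proof -
          have "norm (x + t *\<^sub>R push_field R \<nu> r x - p) \<le> norm (x - p) + norm (t *\<^sub>R push_field R \<nu> r x)"
            using norm_triangle_ineq[of "x - p" "t *\<^sub>R push_field R \<nu> r x"] by (simp add: algebra_simps)
          also have "\<dots> < r p + r p" using True dist[OF that] t0r[OF t(2) p(1)] by linarith
          finally show ?thesis by (simp add: dist_norm norm_minus_commute)
        qed
        have "?y + ?s *\<^sub>R \<nu> p \<in> \<Omega>"
        proof (rule vertical_shift_into_domain[OF loc(1,3,4)[OF p(2)]])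
          show "?y \<in> ball p (2 * r p)" using insert.prems by (intro close) auto
          show "?y + ?s *\<^sub>R \<nu> p \<in> ball p (2 * r p)" using close[OF insert.prems] step by simp
          show "?s > 0" using t(1) moll_pos[OF rP[OF p(1)] True] by simp
        qed (rule IH)
        then show ?thesis unfolding step using closure_subset by blast
      qed
    qed
    from this[OF P(2)] have fin: "x \<in> \<Omega> \<or> (\<exists>p\<in>P. norm (x - p) < r p) \<longrightarrow> x + t *\<^sub>R push_field P \<nu> r x \<in> \<Omega>" by blast
    have "x \<in> \<Omega> \<or> x \<in> frontier \<Omega>" using x \<Omega>(1) by (simp add: frontier_def interior_open)
    then have "x \<in> \<Omega> \<or> (\<exists>p\<in>P. norm (x - p) < r p)"
      using P(3) by (fastforce simp: dist_norm norm_minus_commute)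
    then show "x + t *\<^sub>R push_field P \<nu> r x \<in> \<Omega>" using fin by blast
  qed
qed

text \<open>
The equation \<open>x + t X(x) = y\<close> is a fixed point equation for a contraction. Surjectivity matters: the
volume estimate for preimages is applied to an inverse that is Lipschitz on the whole space.
\<close>

lemma perturbed_identity_inverse:
  fixes X :: "'a::euclidean_space \<Rightarrow> 'a"
  assumes X: "\<And>x y. norm (X x - X y) \<le> M * norm (x - y)" and M: "M > 0" and t: "0 < t" "t * M < 1"
  obtains \<Psi> where "(1 / (1 - t * M))-lipschitz_on UNIV \<Psi>" "\<And>x. \<Psi> (x + t *\<^sub>R X x) = x"
    "\<And>y. \<Psi> y + t *\<^sub>R X (\<Psi> y) = y"
proof -
  let ?\<Phi> = "\<lambda>x. x + t *\<^sub>R X x"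
  have expand: "(1 - t * M) * norm (x - y) \<le> norm (?\<Phi> x - ?\<Phi> y)" for x y
  proof -
    have "norm (x - y) \<le> norm (?\<Phi> x - ?\<Phi> y) + norm (t *\<^sub>R (X x - X y))"
      using norm_triangle_ineq4[of "?\<Phi> x - ?\<Phi> y" "t *\<^sub>R (X x - X y)"] by (simp add: algebra_simps)
    also have "norm (t *\<^sub>R (X x - X y)) \<le> t * (M * norm (x - y))" using X t(1) by simp
    finally show ?thesis by (simp add: algebra_simps)
  qed
  have "\<exists>x. ?\<Phi> x = y" for y
  proof -
    have "\<exists>!x. y - t *\<^sub>R X x = x"
    proof (rule banach_fix_type)
      show "0 \<le> t * M" "t * M < 1" using t M by auto
      show "\<forall>a b. dist (y - t *\<^sub>R X a) (y - t *\<^sub>R X b) \<le> t * M * dist a b"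
      proof (intro allI)
        fix a b
        have "dist (y - t *\<^sub>R X a) (y - t *\<^sub>R X b) = norm (t *\<^sub>R (X b - X a))"
          by (simp add: dist_norm algebra_simps)
        also have "\<dots> \<le> t * (M * norm (b - a))" using X t(1) by simp
        finally show "dist (y - t *\<^sub>R X a) (y - t *\<^sub>R X b) \<le> t * M * dist a b"
          by (simp add: dist_norm norm_minus_commute mult.assoc)
      qed
    qed
    then obtain x where "y - t *\<^sub>R X x = x" by blast
    then have "?\<Phi> x = y" by (metis diff_add_cancel)
    then show ?thesis by blast
  qed
  then obtain \<Psi> where \<Psi>: "\<And>y. ?\<Phi> (\<Psi> y) = y" by metis
  have inv: "\<Psi> (?\<Phi> x) = x" for x
  proof -
    have "(1 - t * M) * norm (\<Psi> (?\<Phi> x) - x) \<le> norm (?\<Phi> (\<Psi> (?\<Phi> x)) - ?\<Phi> x)" by (rule expand)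
    also have "\<dots> = 0" by (simp add: \<Psi>)
    finally show ?thesis using t(2) by (simp add: mult_le_0_iff)
  qed
  have "(1 / (1 - t * M))-lipschitz_on UNIV \<Psi>"
  proof (rule lipschitz_onI)
    fix a b
    have "(1 - t * M) * norm (\<Psi> a - \<Psi> b) \<le> norm (?\<Phi> (\<Psi> a) - ?\<Phi> (\<Psi> b))" by (rule expand)
    then show "dist (\<Psi> a) (\<Psi> b) \<le> 1 / (1 - t * M) * dist a b"
      using t(2) by (simp add: \<Psi> dist_norm field_simps)
  qed (use t(2) in simp)
  then show ?thesis using that inv \<Psi> by blast
qed

section \<open>Short-range energy of a deformed set\<close>

lemma ennreal_tendsto_0I:
  assumes "\<And>e::real. e > 0 \<Longrightarrow> eventually (\<lambda>x. f x \<le> ennreal e) G"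
  shows "(f \<longlongrightarrow> (0::ennreal)) G"
proof (rule order_tendstoI)
  fix a :: ennreal assume "0 < a"
  then obtain y where y: "0 < y" "y < a" using dense by blast
  obtain e where e: "y = ennreal e" "e > 0" using y by (cases y) auto
  show "eventually (\<lambda>x. f x < a) G"
    using assms[OF e(2)] by eventually_elim (use y(2) e(1) in \<open>auto intro: le_less_trans\<close>)
qed simp

text \<open>
Stated for extended values, where the error term cannot be subtracted.
\<close>

lemma le_liminf_of_le_add_null:
  fixes b c :: "nat \<Rightarrow> ennreal"
  assumes le: "\<And>k. D \<le> b k + c k" and c: "c \<longlonglongrightarrow> 0"
  shows "D \<le> liminf b"
  unfolding le_Liminf_iff
proof (intro allI impI)
  fix y assume y: "y < D"
  then have "0 < D - y" by (simp add: diff_gr0_ennreal)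
  with c have "eventually (\<lambda>k. c k < D - y) sequentially" by (rule order_tendstoD)
  then show "eventually (\<lambda>k. y < b k) sequentially"
  proof eventually_elim
    case (elim k)
    show ?case
    proof (rule ccontr)
      assume "\<not> y < b k"
      then have "D \<le> y + c k" using le[of k] by (meson add_right_mono leI order_trans)
      also have "y + c k < y + (D - y)" using elim y
        using less_le_trans[OF y top_greatest] by (subst ennreal_add_left_cancel_less) simp
      also have "\<dots> = D" using y by (intro add_diff_inverse_ennreal) auto
      finally show False by simp
    qed
  qed
qed

lemma compact_collar:
  fixes S :: "'a::euclidean_space set"
  assumes S: "compact S" "S \<subseteq> \<Omega>" and \<Omega>: "open \<Omega>"
  obtains e C where "e > 0" "compact C" "C \<subseteq> \<Omega>" "\<And>x. x \<in> S \<Longrightarrow> cball x e \<subseteq> C"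
proof (cases "S = {}")
  case True then show ?thesis using that[of 1 "{}"] by auto
next
  case False
  obtain e where e: "e > 0" "(\<Union>x\<in>S. cball x e) \<subseteq> \<Omega>"
    using compact_subset_open_imp_cball_epsilon_subset[OF S(1) \<Omega> S(2)] by blast
  let ?C = "{x. infdist x S \<le> e}"
  show ?thesis
  proof (rule that[OF e(1)])
    show "compact ?C" by (rule compact_infdist_le[OF False S(1) e(1)])
    show "?C \<subseteq> \<Omega>"
    proof
      fix x assume "x \<in> ?C"
      obtain y where "y \<in> S" "infdist x S = dist x y"
        using infdist_attains_inf[OF compact_imp_closed[OF S(1)] False] by metis
      then have "y \<in> S" "x \<in> cball y e" using \<open>x \<in> ?C\<close> by (auto simp: dist_commute)
      then show "x \<in> \<Omega>" using e(2) by blast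
    qed
    fix x assume "x \<in> S"
    then show "cball x e \<subseteq> ?C" by (auto simp: dist_commute intro: order_trans[OF infdist_le])
  qed
qed

context
  fixes P :: "(real ^ 'n) set" and \<nu> :: "real ^ 'n \<Rightarrow> real ^ 'n" and r :: "real ^ 'n \<Rightarrow> real"
    and M t :: real and \<Psi> :: "real ^ 'n \<Rightarrow> real ^ 'n"
  assumes M: "M > 0" and t: "0 < t" "t * M < 1"
    and adj: "\<And>x v. norm (push_deriv_adjoint P \<nu> r x v) \<le> M * norm v"
    and lip: "(1 / (1 - t * M))-lipschitz_on UNIV \<Psi>"
    and inv: "\<And>x. \<Psi> (x + t *\<^sub>R push_field P \<nu> r x) = x"
begin

abbreviation (input) \<Phi> where "\<Phi> \<equiv> \<lambda>x. x + t *\<^sub>R push_field P \<nu> r x"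

lemma continuous_deformation: "continuous_on S \<Phi>"
  unfolding push_field_def
  by (intro continuous_intros continuous_on_compose2[OF continuous_moll[of UNIV]]) auto

lemma deformation_measurable[measurable]: "\<Phi> \<in> borel_measurable borel"
  by (rule borel_measurable_continuous_onI[OF continuous_deformation])

text \<open>
The gradient of the mollified indicator of \<open>E\<close> composed with the deformation \<open>id + t X\<close>, by the chain rule.
\<close>

definition deformed_gradient :: "(real ^ 'n) set \<Rightarrow> real \<Rightarrow> real ^ 'n \<Rightarrow> real ^ 'n" where
  "deformed_gradient E \<eta> x = (let v = mollified_grad \<eta> E (\<Phi> x) in v + t *\<^sub>R push_deriv_adjoint P \<nu> r x v)"

lemma deformed_has_derivative:
  assumes \<eta>: "\<eta> > 0" and E: "E \<in> sets borel"
  shows "((\<lambda>x. mollified \<eta> E (\<Phi> x)) has_derivative (\<lambda>h. deformed_gradient E \<eta> x \<bullet> h)) (at x)"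
proof -
  have E1: "\<bar>indicat_real E z\<bar> \<le> 1" for z by (simp add: indicator_def)
  have Em: "indicat_real E \<in> borel_measurable borel" using E by (rule borel_measurable_indicator)
  let ?D = "\<lambda>h. \<Sum>p\<in>P. (moll_grad (r p) (x - p) \<bullet> h) *\<^sub>R \<nu> p"
  have "(\<Phi> has_derivative (\<lambda>h. h + t *\<^sub>R ?D h)) (at x)"
    by (intro has_derivative_add has_derivative_ident has_derivative_scaleR_right push_field_has_derivative)
  from has_derivative_compose[OF this conv_moll_has_derivative[OF \<eta> Em E1]]
  have "((\<lambda>x. mollified \<eta> E (\<Phi> x)) has_derivative
    (\<lambda>h. mollified_grad \<eta> E (\<Phi> x) \<bullet> (h + t *\<^sub>R ?D h))) (at x)" .
  moreover have "mollified_grad \<eta> E (\<Phi> x) \<bullet> (h + t *\<^sub>R ?D h) = deformed_gradient E \<eta> x \<bullet> h" for h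
    by (simp only: deformed_gradient_def Let_def inner_add_right inner_add_left inner_scaleR_right inner_scaleR_left push_field_adjoint)
  ultimately show ?thesis by simp
qed

lemma continuous_deformed_gradient:
  assumes \<eta>: "\<eta> > 0" and E: "E \<in> sets borel"
  shows "continuous_on UNIV (deformed_gradient E \<eta>)"
proof -
  have E1: "\<bar>indicat_real E z\<bar> \<le> 1" for z by (simp add: indicator_def)
  have Em: "indicat_real E \<in> borel_measurable borel" using E by (rule borel_measurable_indicator)
  have v: "continuous_on UNIV (\<lambda>x. mollified_grad \<eta> E (\<Phi> x))"
    by (rule continuous_on_compose2[OF continuous_conv_moll_grad[OF \<eta> Em E1, of UNIV] continuous_deformation]) simp
  show ?thesis
    unfolding deformed_gradient_def Let_def push_deriv_adjoint_def
    by (intro continuous_on_add v continuous_on_scaleR continuous_on_const continuous_on_sum continuous_on_inner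
        continuous_on_compose2[OF continuous_moll_grad[of UNIV]] continuous_on_diff continuous_on_id) auto
qed

lemma norm_deformed_gradient_le:
  "norm (deformed_gradient E \<eta> x) \<le> (1 + t * M) * norm (mollified_grad \<eta> E (\<Phi> x))"
proof -
  let ?v = "mollified_grad \<eta> E (\<Phi> x)"
  have "norm (deformed_gradient E \<eta> x) \<le> norm ?v + norm (t *\<^sub>R push_deriv_adjoint P \<nu> r x ?v)"
    unfolding deformed_gradient_def Let_def by (rule norm_triangle_ineq)
  also have "norm (t *\<^sub>R push_deriv_adjoint P \<nu> r x ?v) \<le> t * (M * norm ?v)" using adj[of x ?v] t(1) by simp
  finally show ?thesis by (simp add: algebra_simps)
qed

text \<open>
The gradient of the composition is at most \<open>1 + t M\<close> times the mollified gradient at the deformed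
point; the change of variables costs the \<open>d\<close>-th power of the Lipschitz constant of the inverse, and the
image of \<open>C0\<close> stays in a compact part of \<open>\<Omega>\<close>, where the perimeter bounds the integral.
\<close>

lemma deformed_gradient_integral_le:
  assumes E[measurable]: "E \<in> sets borel" and C0: "compact C0" "\<Phi> ` C0 \<subseteq> \<Omega>" and \<Omega>: "open \<Omega>"
  obtains \<eta>0 where "\<eta>0 > 0" "\<And>\<eta>. 0 < \<eta> \<Longrightarrow> \<eta> < \<eta>0 \<Longrightarrow>
    (\<integral>\<^sup>+x\<in>C0. ennreal (norm (deformed_gradient E \<eta> x)) \<partial>lborel)
      \<le> ennreal ((1 + t * M) * (1 / (1 - t * M)) ^ CARD('n)) * Per E \<Omega>"
proof -
  have cS: "compact (\<Phi> ` C0)" by (rule compact_continuous_image[OF continuous_deformation C0(1)])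
  obtain e C where e: "e > 0" and C: "compact C" "C \<subseteq> \<Omega>" "\<And>x. x \<in> \<Phi> ` C0 \<Longrightarrow> cball x e \<subseteq> C"
    by (rule compact_collar[OF cS C0(2) \<Omega>]) (rule that)
  show ?thesis
  proof (rule that[OF e])
    fix \<eta> assume \<eta>: "0 < \<eta>" "\<eta> < e"
    have E1: "\<bar>indicat_real E z\<bar> \<le> 1" for z by (simp add: indicator_def)
    have Em: "indicat_real E \<in> borel_measurable borel" by measurable
    let ?v = "mollified_grad \<eta> E"
    have vm[measurable]: "?v \<in> borel_measurable borel"
      by (rule borel_measurable_continuous_onI[OF continuous_conv_moll_grad[OF \<eta>(1) Em E1]])
    have [measurable]: "\<Phi> ` C0 \<in> sets borel" using compact_imp_closed[OF cS] by (rule borel_closed)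
    let ?f = "\<lambda>y. ennreal (norm (?v y)) * indicator (\<Phi> ` C0) y"
    have fm[measurable]: "?f \<in> borel_measurable borel" by measurable
    have c0: "0 \<le> 1 + t * M" using t M by simp
    have "(\<integral>\<^sup>+x\<in>C0. ennreal (norm (deformed_gradient E \<eta> x)) \<partial>lborel) \<le> (\<integral>\<^sup>+x. ennreal (1 + t * M) * ?f (\<Phi> x) \<partial>lborel)"
    proof (rule nn_integral_mono)
      fix x
      show "ennreal (norm (deformed_gradient E \<eta> x)) * indicator C0 x \<le> ennreal (1 + t * M) * ?f (\<Phi> x)"
      proof (cases "x \<in> C0")
        case True
        have "ennreal (norm (deformed_gradient E \<eta> x)) \<le> ennreal ((1 + t * M) * norm (?v (\<Phi> x)))"
          by (rule ennreal_leI[OF norm_deformed_gradient_le])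
        also have "\<dots> = ennreal (1 + t * M) * ennreal (norm (?v (\<Phi> x)))" using c0 by (intro ennreal_mult) auto
        finally show ?thesis using True by simp
      qed simp
    qed
    also have "\<dots> = ennreal (1 + t * M) * (\<integral>\<^sup>+x. ?f (\<Phi> x) \<partial>lborel)"
      by (rule nn_integral_cmult) (use measurable_compose[OF deformation_measurable fm] in simp)
    also have "\<dots> \<le> ennreal (1 + t * M) * (ennreal ((1 / (1 - t * M)) ^ DIM(real^'n)) * (\<integral>\<^sup>+y. ?f y \<partial>lborel))"
      by (intro mult_left_mono nn_integral_lipschitz_substitution[OF lip inv deformation_measurable fm]) auto
    also have "\<dots> \<le> ennreal (1 + t * M) * (ennreal ((1 / (1 - t * M)) ^ DIM(real^'n)) * Per E \<Omega>)"
    proof (intro mult_left_mono gradient_integral_le_Per[OF \<eta>(1) E _ C(1,2)])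
      fix x assume "x \<in> \<Phi> ` C0"
      then have "cball x e \<subseteq> C" by (rule C(3))
      then show "cball x \<eta> \<subseteq> C" using \<eta>(2) by (meson less_imp_le order_trans subset_cball)
    qed auto
    also have "\<dots> = ennreal ((1 + t * M) * (1 / (1 - t * M)) ^ CARD('n)) * Per E \<Omega>"
      using c0 t(2) by (simp add: ennreal_mult mult.assoc)
    finally show "(\<integral>\<^sup>+x\<in>C0. ennreal (norm (deformed_gradient E \<eta> x)) \<partial>lborel)
      \<le> ennreal ((1 + t * M) * (1 / (1 - t * M)) ^ CARD('n)) * Per E \<Omega>" .
  qed
qed

text \<open>
For increments with \<open>\<epsilon> |h| \<le> \<delta>\<close> the segments from \<open>y\<close> to \<open>y + \<epsilon> h\<close> stay in \<open>C0\<close>, so the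
difference integrals of the mollified and deformed functions \<open>w j\<close> are bounded by directional
derivatives. The functions \<open>w j\<close> converge to the indicator of the deformed set in \<open>L\<^sup>1(C0)\<close>, and
Fatou's lemma in \<open>h\<close> transfers the bound to that set.
\<close>

lemma short_range_energy_le:
  fixes K :: "real ^ 'n \<Rightarrow> real"
  assumes K[measurable]: "K \<in> borel_measurable borel" and K0: "\<And>h. K h \<ge> 0" and rad: "\<And>h. K h = k (norm h)"
    and E[measurable]: "E \<in> sets borel" and \<Omega>: "open \<Omega>" and C0: "compact C0" "\<Phi> ` C0 \<subseteq> \<Omega>"
    and \<delta>: "\<And>y. y \<in> \<Omega> \<Longrightarrow> cball y \<delta> \<subseteq> C0" and \<epsilon>: "\<epsilon> > 0"
  shows "(\<integral>\<^sup>+h. ennreal (K h) * indicator {h. \<epsilon> * norm h \<le> \<delta>} h * (\<integral>\<^sup>+y. jump (\<Phi> -` E) (\<epsilon> *\<^sub>R h) y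
        * indicator {y. y \<in> \<Omega> \<or> y + \<epsilon> *\<^sub>R h \<in> \<Omega>} y \<partial>lborel) \<partial>lborel)
    \<le> ennreal \<epsilon> * ((\<integral>\<^sup>+h. ennreal (K h * \<bar>h $ i\<bar>) \<partial>lborel) * (ennreal ((1 + t * M) * (1 / (1 - t * M)) ^ CARD('n)) * Per E \<Omega>))"
proof -
  have E1: "\<bar>indicat_real E z\<bar> \<le> 1" for z by (simp add: indicator_def)
  have Em: "indicat_real E \<in> borel_measurable borel" by measurable
  have C0m[measurable]: "C0 \<in> sets borel" using compact_imp_closed[OF C0(1)] by (rule borel_closed)
  have \<Omega>m[measurable]: "\<Omega> \<in> sets borel" using \<Omega> by (rule borel_open)
  obtain \<eta>0 where \<eta>0: "\<eta>0 > 0" "\<And>\<eta>. 0 < \<eta> \<Longrightarrow> \<eta> < \<eta>0 \<Longrightarrow>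
    (\<integral>\<^sup>+x\<in>C0. ennreal (norm (deformed_gradient E \<eta> x)) \<partial>lborel)
      \<le> ennreal ((1 + t * M) * (1 / (1 - t * M)) ^ CARD('n)) * Per E \<Omega>"
    by (rule deformed_gradient_integral_le[OF E C0 \<Omega>]) (rule that)
  \<comment> \<open>The factor \<open>1/2\<close> keeps every scale, including the first, strictly below \<open>\<eta>0\<close>.\<close>
  define \<eta> where "\<eta> j = \<eta>0 / 2 * inverse (real (Suc j))" for j :: nat
  have \<eta>: "\<eta> j > 0" "\<eta> j < \<eta>0" for j
  proof -
    show "\<eta> j > 0" using \<eta>0(1) by (simp add: \<eta>_def)
    have "\<eta>0 / 2 * inverse (real (Suc j)) \<le> \<eta>0 / 2 * 1"
      using \<eta>0(1) by (intro mult_left_mono) (auto simp: inverse_le_1_iff)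
    then show "\<eta> j < \<eta>0" using \<eta>0(1) unfolding \<eta>_def by linarith
  qed
  have \<eta>lim: "\<eta> \<longlonglongrightarrow> 0"
    unfolding \<eta>_def by (intro tendsto_mult_right_zero LIMSEQ_inverse_real_of_nat)
  define u where "u j = mollified (\<eta> j) E" for j
  define w where "w j x = u j (\<Phi> x)" for j x
  define W where "W j = deformed_gradient E (\<eta> j)" for j
  define f where "f = indicat_real (\<Phi> -` E)"
  have um[measurable]: "u j \<in> borel_measurable borel" for j
    unfolding u_def by (rule borel_measurable_continuous_onI[OF continuous_conv_moll[OF \<eta>(1) Em E1]])
  have wm[measurable]: "w j \<in> borel_measurable borel" for j
    unfolding w_def by (rule measurable_compose[OF deformation_measurable um])
  have Wm[measurable]: "W j \<in> borel_measurable borel" for j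
    unfolding W_def by (rule borel_measurable_continuous_onI[OF continuous_deformed_gradient[OF \<eta>(1) E]])
  have fm[measurable]: "f \<in> borel_measurable borel"
    unfolding f_def using measurable_sets[OF deformation_measurable E] by (intro borel_measurable_indicator) simp
  obtain R where R: "\<Phi> ` C0 \<subseteq> cball 0 R"
    using bounded_subset_ballD[OF compact_imp_bounded[OF compact_continuous_image[OF continuous_deformation C0(1)]], of 0]
      ball_subset_cball by (meson order_trans)
  have Rm[measurable]: "cball (0::real^'n) R \<in> sets borel" by simp
  define L where "L = (1 / (1 - t * M)) ^ DIM(real ^ 'n)"
  define d where "d j = (\<integral>\<^sup>+x\<in>C0. ennreal \<bar>w j x - f x\<bar> \<partial>lborel)" for j
  define m where "m j = (\<integral>\<^sup>+x\<in>cball 0 R. ennreal \<bar>u j x - indicat_real E x\<bar> \<partial>lborel)" for j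
  have m0: "m \<longlonglongrightarrow> 0"
  proof (rule ennreal_tendsto_0I)
    fix e :: real assume "e > 0"
    obtain s where s: "s > 0" "\<And>\<eta>. 0 < \<eta> \<Longrightarrow> \<eta> < s \<Longrightarrow>
       (\<integral>\<^sup>+x\<in>cball 0 R. ennreal \<bar>mollified \<eta> E x - indicat_real E x\<bar> \<partial>lborel) \<le> ennreal e"
      by (rule mollify_L1_conv[OF E \<open>e > 0\<close>]) (rule that)
    have "eventually (\<lambda>j. \<eta> j < s) sequentially" using \<eta>lim s(1) by (rule order_tendstoD)
    then show "eventually (\<lambda>j. m j \<le> ennreal e) sequentially"
      by eventually_elim (use s(2) \<eta>(1) in \<open>simp add: m_def u_def\<close>)
  qed
  have dm: "d j \<le> ennreal L * m j" for j
  proof -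
    let ?g = "\<lambda>y. ennreal \<bar>u j y - indicat_real E y\<bar> * indicator (cball 0 R) y"
    have gm: "?g \<in> borel_measurable borel" by measurable
    have "d j \<le> (\<integral>\<^sup>+x. ?g (\<Phi> x) \<partial>lborel)"
      unfolding d_def
    proof (rule nn_integral_mono)
      fix x
      show "ennreal \<bar>w j x - f x\<bar> * indicator C0 x \<le> ?g (\<Phi> x)"
        using R by (cases "x \<in> C0") (auto simp: w_def f_def indicator_def image_subset_iff)
    qed
    also have "\<dots> \<le> ennreal L * (\<integral>\<^sup>+y. ?g y \<partial>lborel)"
      unfolding L_def by (rule nn_integral_lipschitz_substitution[OF lip inv deformation_measurable gm])
    finally show ?thesis unfolding m_def .
  qed
  have d0: "d \<longlonglongrightarrow> 0"
  proof (rule tendsto_sandwich[of "\<lambda>_. 0" d sequentially "\<lambda>j. ennreal L * m j"])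
    show "(\<lambda>j. ennreal L * m j) \<longlonglongrightarrow> 0" using ennreal_tendsto_cmult[OF _ m0, of "ennreal L"] by simp
  qed (use dm in auto)
  define A where "A h = {y. y \<in> \<Omega> \<or> y + \<epsilon> *\<^sub>R h \<in> \<Omega>}" for h
  have Am[measurable]: "A h \<in> sets borel" for h unfolding A_def by measurable
  define D where "D h = (\<integral>\<^sup>+y. ennreal \<bar>f y - f (y + \<epsilon> *\<^sub>R h)\<bar> * indicator (A h) y \<partial>lborel)" for h
  define B where "B j h = (\<integral>\<^sup>+y\<in>A h. ennreal \<bar>w j (y + \<epsilon> *\<^sub>R h) - w j y\<bar> \<partial>lborel)" for j h
  have Bm[measurable]: "B j \<in> borel_measurable borel" for j unfolding B_def A_def by measurable
  have seg: "y + s *\<^sub>R (\<epsilon> *\<^sub>R h) \<in> C0" if y: "y \<in> A h" and s: "0 \<le> s" "s \<le> 1" and h: "\<epsilon> * norm h \<le> \<delta>" for y s h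
  proof -
    have *: "\<bar>c\<bar> * (\<epsilon> * norm h) \<le> \<delta>" if "\<bar>c\<bar> \<le> 1" for c
    proof -
      have "\<bar>c\<bar> * (\<epsilon> * norm h) \<le> 1 * (\<epsilon> * norm h)" by (rule mult_right_mono[OF that]) (use \<epsilon> in simp)
      then show ?thesis using h by linarith
    qed
    have eq: "y + s *\<^sub>R (\<epsilon> *\<^sub>R h) = (y + \<epsilon> *\<^sub>R h) + (s - 1) *\<^sub>R (\<epsilon> *\<^sub>R h)" by (simp add: algebra_simps)
    have mem: "z + c *\<^sub>R (\<epsilon> *\<^sub>R h) \<in> C0" if "z \<in> \<Omega>" "\<bar>c\<bar> \<le> 1" for z c
      using *[OF that(2)] \<epsilon> by (intro subsetD[OF \<delta>[OF that(1)]]) (simp add: dist_norm abs_mult mult.assoc)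
    from y consider "y \<in> \<Omega>" | "y + \<epsilon> *\<^sub>R h \<in> \<Omega>" by (auto simp: A_def)
    then show ?thesis
    proof cases
      case 1 then show ?thesis by (rule mem) (use s in simp)
    next
      case 2 then show ?thesis unfolding eq by (rule mem) (use s in simp)
    qed
  qed
  have DB: "D h \<le> liminf (\<lambda>j. B j h)" if h: "\<epsilon> * norm h \<le> \<delta>" for h
  proof (rule le_liminf_of_le_add_null)
    show "(\<lambda>j. d j + d j) \<longlonglongrightarrow> 0" using tendsto_add[OF d0 d0] by simp
    fix j
    let ?q = "\<lambda>x. ennreal \<bar>w j x - f x\<bar> * indicator C0 x"
    have qm[measurable]: "?q \<in> borel_measurable borel" by measurable
    have "D h \<le> (\<integral>\<^sup>+y. ennreal \<bar>w j (y + \<epsilon> *\<^sub>R h) - w j y\<bar> * indicator (A h) y + (?q y + ?q (\<epsilon> *\<^sub>R h + y)) \<partial>lborel)"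
      unfolding D_def
    proof (rule nn_integral_mono)
      fix y
      show "ennreal \<bar>f y - f (y + \<epsilon> *\<^sub>R h)\<bar> * indicator (A h) y
        \<le> ennreal \<bar>w j (y + \<epsilon> *\<^sub>R h) - w j y\<bar> * indicator (A h) y + (?q y + ?q (\<epsilon> *\<^sub>R h + y))"
      proof (cases "y \<in> A h")
        case True
        have mem: "y \<in> C0" "\<epsilon> *\<^sub>R h + y \<in> C0" using seg[OF True _ _ h, of 0] seg[OF True _ _ h, of 1] by (auto simp: add.commute)
        have "\<bar>f y - f (y + \<epsilon> *\<^sub>R h)\<bar> \<le> \<bar>w j (y + \<epsilon> *\<^sub>R h) - w j y\<bar> + (\<bar>w j y - f y\<bar> + \<bar>w j (\<epsilon> *\<^sub>R h + y) - f (\<epsilon> *\<^sub>R h + y)\<bar>)"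
          by (simp add: add.commute[of y])
        then have "ennreal \<bar>f y - f (y + \<epsilon> *\<^sub>R h)\<bar> \<le> ennreal (\<bar>w j (y + \<epsilon> *\<^sub>R h) - w j y\<bar> + (\<bar>w j y - f y\<bar> + \<bar>w j (\<epsilon> *\<^sub>R h + y) - f (\<epsilon> *\<^sub>R h + y)\<bar>))"
          by (rule ennreal_leI)
        then show ?thesis using True mem by simp
      qed simp
    qed
    also have "\<dots> = B j h + ((\<integral>\<^sup>+y. ?q y \<partial>lborel) + (\<integral>\<^sup>+y. ?q (\<epsilon> *\<^sub>R h + y) \<partial>lborel))"
    proof -
      have m1: "(\<lambda>y. ennreal \<bar>w j (y + \<epsilon> *\<^sub>R h) - w j y\<bar> * indicator (A h) y) \<in> borel_measurable lborel" by measurable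
      have m2: "?q \<in> borel_measurable lborel" by measurable
      have m3: "(\<lambda>y. ?q (\<epsilon> *\<^sub>R h + y)) \<in> borel_measurable lborel" by measurable
      show ?thesis
        unfolding B_def nn_integral_add[OF m1 borel_measurable_add[OF m2 m3]] nn_integral_add[OF m2 m3] ..
    qed
    also have "(\<integral>\<^sup>+y. ?q (\<epsilon> *\<^sub>R h + y) \<partial>lborel) = (\<integral>\<^sup>+y. ?q y \<partial>lborel)" by (rule nn_integral_lborel_shift[OF qm])
    finally show "D h \<le> B j h + (d j + d j)" unfolding d_def .
  qed
  have BW: "B j h \<le> ennreal \<epsilon> * (\<integral>\<^sup>+x\<in>C0. ennreal \<bar>W j x \<bullet> h\<bar> \<partial>lborel)" if h: "\<epsilon> * norm h \<le> \<delta>" for j h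
  proof -
    have "B j h \<le> (\<integral>\<^sup>+x\<in>C0. ennreal \<bar>W j x \<bullet> (\<epsilon> *\<^sub>R h)\<bar> \<partial>lborel)"
      unfolding B_def w_def u_def W_def
      by (rule difference_le_directional_derivative[OF deformed_has_derivative[OF \<eta>(1) E] continuous_deformed_gradient[OF \<eta>(1) E] Am C0m])
         (rule seg[OF _ _ _ h])
    also have "\<dots> = (\<integral>\<^sup>+x. ennreal \<epsilon> * (ennreal \<bar>W j x \<bullet> h\<bar> * indicator C0 x) \<partial>lborel)"
      using \<epsilon> by (intro nn_integral_cong) (simp add: abs_mult ennreal_mult mult.assoc)
    also have "\<dots> = ennreal \<epsilon> * (\<integral>\<^sup>+x\<in>C0. ennreal \<bar>W j x \<bullet> h\<bar> \<partial>lborel)" by (rule nn_integral_cmult) measurable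
    finally show ?thesis .
  qed
  let ?S = "{h. \<epsilon> * norm h \<le> \<delta>} :: (real^'n) set"
  have Sm[measurable]: "?S \<in> sets borel" by measurable
  have "(\<integral>\<^sup>+h. ennreal (K h) * indicator ?S h * D h \<partial>lborel)
    \<le> (\<integral>\<^sup>+h. liminf (\<lambda>j. ennreal (K h) * indicator ?S h * B j h) \<partial>lborel)"
  proof (rule nn_integral_mono)
    fix h
    have "ennreal (K h) * indicator ?S h * D h \<le> ennreal (K h) * indicator ?S h * liminf (\<lambda>j. B j h)"
      using DB[of h] by (cases "h \<in> ?S") (auto intro: mult_left_mono)
    also have "\<dots> \<le> liminf (\<lambda>j. ennreal (K h) * indicator ?S h * B j h)" by (rule mult_Liminf_le_ennreal)
    finally show "ennreal (K h) * indicator ?S h * D h \<le> liminf (\<lambda>j. ennreal (K h) * indicator ?S h * B j h)" .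
  qed
  also have "\<dots> \<le> liminf (\<lambda>j. \<integral>\<^sup>+h. ennreal (K h) * indicator ?S h * B j h \<partial>lborel)"
    by (rule nn_integral_liminf) measurable
  also have "\<dots> \<le> liminf (\<lambda>j. ennreal \<epsilon> * ((\<integral>\<^sup>+h. ennreal (K h * \<bar>h $ i\<bar>) \<partial>lborel) * (ennreal ((1 + t * M) * (1 / (1 - t * M)) ^ CARD('n)) * Per E \<Omega>)))"
  proof (rule Liminf_mono, rule always_eventually, rule allI)
    fix j
    have "(\<integral>\<^sup>+h. ennreal (K h) * indicator ?S h * B j h \<partial>lborel)
      \<le> (\<integral>\<^sup>+h. ennreal \<epsilon> * (ennreal (K h) * (\<integral>\<^sup>+x\<in>C0. ennreal \<bar>W j x \<bullet> h\<bar> \<partial>lborel)) \<partial>lborel)"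
    proof (rule nn_integral_mono)
      fix h
      show "ennreal (K h) * indicator ?S h * B j h \<le> ennreal \<epsilon> * (ennreal (K h) * (\<integral>\<^sup>+x\<in>C0. ennreal \<bar>W j x \<bullet> h\<bar> \<partial>lborel))"
        using mult_left_mono[OF BW[of h j], of "ennreal (K h)"] by (cases "h \<in> ?S") (auto simp: mult_ac)
    qed
    also have "\<dots> = ennreal \<epsilon> * (\<integral>\<^sup>+h. ennreal (K h) * (\<integral>\<^sup>+x\<in>C0. ennreal \<bar>W j x \<bullet> h\<bar> \<partial>lborel) \<partial>lborel)"
      by (rule nn_integral_cmult) measurable
    also have "\<dots> = ennreal \<epsilon> * ((\<integral>\<^sup>+h. ennreal (K h * \<bar>h $ i\<bar>) \<partial>lborel) * (\<integral>\<^sup>+x\<in>C0. ennreal (norm (W j x)) \<partial>lborel))"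
      by (simp only: nn_integral_kernel_directional[OF K K0 rad Wm C0m, where i = i])
    also have "\<dots> \<le> ennreal \<epsilon> * ((\<integral>\<^sup>+h. ennreal (K h * \<bar>h $ i\<bar>) \<partial>lborel) * (ennreal ((1 + t * M) * (1 / (1 - t * M)) ^ CARD('n)) * Per E \<Omega>))"
      unfolding W_def by (intro mult_left_mono \<eta>0(2) \<eta>) auto
    finally show "(\<integral>\<^sup>+h. ennreal (K h) * indicator ?S h * B j h \<partial>lborel) \<le> \<dots>" .
  qed
  also have "\<dots> = ennreal \<epsilon> * ((\<integral>\<^sup>+h. ennreal (K h * \<bar>h $ i\<bar>) \<partial>lborel) * (ennreal ((1 + t * M) * (1 / (1 - t * M)) ^ CARD('n)) * Per E \<Omega>))"
    by (rule Liminf_const) simp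
  finally show ?thesis unfolding D_def f_def A_def .
qed

end

section \<open>Difference form of the energy, tails, and diagonal selection\<close>

lemma interaction_eq_difference_form:
  fixes K :: "real ^ 'n \<Rightarrow> real"
  assumes K[measurable]: "K \<in> borel_measurable borel" and K0: "\<And>h. K h \<ge> 0" and even: "\<And>h. K (- h) = K h"
    and \<epsilon>: "\<epsilon> > 0" and E[measurable]: "E \<in> sets borel" and A[measurable]: "A \<in> sets borel" and B[measurable]: "B \<in> sets borel"
  shows "(\<integral>\<^sup>+y\<in>A. (\<integral>\<^sup>+x\<in>B. ennreal (scaled_kernel K \<epsilon> (y - x) * \<bar>indicat_real E y - indicat_real E x\<bar>) \<partial>lebesgue) \<partial>lebesgue)
    = (\<integral>\<^sup>+h. ennreal (K h) * (\<integral>\<^sup>+y. jump E (\<epsilon> *\<^sub>R h) y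
        * indicator A y * indicator B (y + \<epsilon> *\<^sub>R h) \<partial>lborel) \<partial>lborel)"
proof -
  define g where "g y x = ennreal \<bar>indicat_real E y - indicat_real E x\<bar> * indicator A y * indicator B x" for y x
  have gm: "case_prod g \<in> borel_measurable (borel \<Otimes>\<^sub>M borel)" unfolding g_def by measurable
  have skm[measurable]: "(\<lambda>x. scaled_kernel K \<epsilon> (y - x)) \<in> borel_measurable borel" for y
    unfolding scaled_kernel_def by measurable
  have sk0: "scaled_kernel K \<epsilon> h \<ge> 0" for h using K0 \<epsilon> by (simp add: scaled_kernel_def)
  have "(\<integral>\<^sup>+y\<in>A. (\<integral>\<^sup>+x\<in>B. ennreal (scaled_kernel K \<epsilon> (y - x) * \<bar>indicat_real E y - indicat_real E x\<bar>) \<partial>lebesgue) \<partial>lebesgue)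
    = (\<integral>\<^sup>+y. (\<integral>\<^sup>+x. ennreal (scaled_kernel K \<epsilon> (y - x)) * g y x \<partial>lborel) \<partial>lborel)"
    unfolding nn_integral_completion
  proof (rule nn_integral_cong)
    fix y
    have "(\<integral>\<^sup>+x\<in>B. ennreal (scaled_kernel K \<epsilon> (y - x) * \<bar>indicat_real E y - indicat_real E x\<bar>) \<partial>lborel) * indicator A y
      = (\<integral>\<^sup>+x. ennreal (scaled_kernel K \<epsilon> (y - x) * \<bar>indicat_real E y - indicat_real E x\<bar>) * indicator B x * indicator A y \<partial>lborel)"
      by (rule nn_integral_multc[symmetric]) measurable
    also have "\<dots> = (\<integral>\<^sup>+x. ennreal (scaled_kernel K \<epsilon> (y - x)) * g y x \<partial>lborel)"
      by (intro nn_integral_cong) (simp add: g_def ennreal_mult sk0 mult_ac)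
    finally show "(\<integral>\<^sup>+x\<in>B. ennreal (scaled_kernel K \<epsilon> (y - x) * \<bar>indicat_real E y - indicat_real E x\<bar>) \<partial>lborel) * indicator A y
      = (\<integral>\<^sup>+x. ennreal (scaled_kernel K \<epsilon> (y - x)) * g y x \<partial>lborel)" .
  qed
  then show ?thesis unfolding interaction_substitution[OF K K0 even \<epsilon> gm] by (simp only: g_def)
qed

text \<open>
Reversing the increment \<open>h\<close> identifies the interaction of \<open>\<Omega>\<close> with its complement and the one of the
complement with \<open>\<Omega>\<close>. Therefore \<open>J\<^sup>1 + 2 J\<^sup>2\<close> collects exactly the pairs of which at least
one point lies in \<open>\<Omega>\<close>.
\<close>

lemma J_eq_difference_form:
  fixes K :: "real ^ 'n \<Rightarrow> real"
  assumes K[measurable]: "K \<in> borel_measurable borel" and K0: "\<And>h. K h \<ge> 0" and even: "\<And>h. K (- h) = K h"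
    and \<epsilon>: "\<epsilon> > 0" and E[measurable]: "E \<in> sets borel" and \<Omega>[measurable]: "\<Omega> \<in> sets borel"
  shows "J K \<epsilon> E \<Omega> = (\<integral>\<^sup>+h. ennreal (K h) * (\<integral>\<^sup>+y. jump E (\<epsilon> *\<^sub>R h) y
        * indicator {y. y \<in> \<Omega> \<or> y + \<epsilon> *\<^sub>R h \<in> \<Omega>} y \<partial>lborel) \<partial>lborel) / 2"
proof -
  define g where "g y x = ennreal \<bar>indicat_real E y - indicat_real E x\<bar>" for y x
  define I where "I A B h = (\<integral>\<^sup>+y. g y (y + \<epsilon> *\<^sub>R h) * indicator A y * indicator B (y + \<epsilon> *\<^sub>R h) \<partial>lborel)" for A B h
  have gm[measurable]: "(\<lambda>p. g (fst p) (snd p)) \<in> borel_measurable (borel \<Otimes>\<^sub>M borel)" unfolding g_def by measurable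
  have g1: "(\<lambda>y. g y (y + z)) \<in> borel_measurable borel" for z unfolding g_def by measurable
  have \<Omega>c[measurable]: "- \<Omega> \<in> sets borel" using \<Omega> by auto
  have Im[measurable]: "I A B \<in> borel_measurable borel" if [measurable]: "A \<in> sets borel" "B \<in> sets borel" for A B
    unfolding I_def g_def by measurable
  have J1: "J1 K \<epsilon> E \<Omega> = (\<integral>\<^sup>+h. ennreal (K h) * I \<Omega> \<Omega> h \<partial>lborel)"
    unfolding J1_def I_def g_def by (rule interaction_eq_difference_form[OF K K0 even \<epsilon> E \<Omega> \<Omega>])
  have J2: "J2 K \<epsilon> E \<Omega> = (\<integral>\<^sup>+h. ennreal (K h) * I \<Omega> (- \<Omega>) h \<partial>lborel)"
    unfolding J2_def I_def g_def by (rule interaction_eq_difference_form[OF K K0 even \<epsilon> E \<Omega> \<Omega>c])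
  have refl: "I \<Omega> (- \<Omega>) (- h) = I (- \<Omega>) \<Omega> h" for h
  proof -
    have "I \<Omega> (- \<Omega>) (- h) = (\<integral>\<^sup>+y. g y (y - \<epsilon> *\<^sub>R h) * indicator \<Omega> y * indicator (- \<Omega>) (y - \<epsilon> *\<^sub>R h) \<partial>lborel)"
      by (simp add: I_def)
    also have "\<dots> = (\<integral>\<^sup>+y. g (\<epsilon> *\<^sub>R h + y) (\<epsilon> *\<^sub>R h + y - \<epsilon> *\<^sub>R h) * indicator \<Omega> (\<epsilon> *\<^sub>R h + y) * indicator (- \<Omega>) (\<epsilon> *\<^sub>R h + y - \<epsilon> *\<^sub>R h) \<partial>lborel)"
      by (rule nn_integral_lborel_shift[symmetric]) (unfold g_def, measurable)
    also have "\<dots> = I (- \<Omega>) \<Omega> h"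
      unfolding I_def by (intro nn_integral_cong) (simp add: g_def add.commute abs_minus_commute mult_ac)
    finally show ?thesis .
  qed
  have J2': "J2 K \<epsilon> E \<Omega> = (\<integral>\<^sup>+h. ennreal (K h) * I (- \<Omega>) \<Omega> h \<partial>lborel)"
  proof -
    have "(\<integral>\<^sup>+h. ennreal (K h) * I \<Omega> (- \<Omega>) h \<partial>lborel) = (\<integral>\<^sup>+h. ennreal (K (0 - h)) * I \<Omega> (- \<Omega>) (0 - h) \<partial>lborel)"
      by (rule nn_integral_lborel_reflect[symmetric]) measurable
    then show ?thesis by (simp add: J2 even refl)
  qed
  have split: "(\<integral>\<^sup>+y. g y (y + \<epsilon> *\<^sub>R h) * indicator {y. y \<in> \<Omega> \<or> y + \<epsilon> *\<^sub>R h \<in> \<Omega>} y \<partial>lborel)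
     = I \<Omega> \<Omega> h + (I \<Omega> (- \<Omega>) h + I (- \<Omega>) \<Omega> h)" for h
  proof -
    note g1[of "\<epsilon> *\<^sub>R h", measurable]
    have "(\<integral>\<^sup>+y. g y (y + \<epsilon> *\<^sub>R h) * indicator {y. y \<in> \<Omega> \<or> y + \<epsilon> *\<^sub>R h \<in> \<Omega>} y \<partial>lborel)
      = (\<integral>\<^sup>+y. g y (y + \<epsilon> *\<^sub>R h) * indicator \<Omega> y * indicator \<Omega> (y + \<epsilon> *\<^sub>R h)
          + (g y (y + \<epsilon> *\<^sub>R h) * indicator \<Omega> y * indicator (- \<Omega>) (y + \<epsilon> *\<^sub>R h)
           + g y (y + \<epsilon> *\<^sub>R h) * indicator (- \<Omega>) y * indicator \<Omega> (y + \<epsilon> *\<^sub>R h)) \<partial>lborel)"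
      by (intro nn_integral_cong) (auto simp: indicator_def)
    also have "\<dots> = I \<Omega> \<Omega> h + (I \<Omega> (- \<Omega>) h + I (- \<Omega>) \<Omega> h)"
      unfolding I_def by (subst nn_integral_add, measurable, subst nn_integral_add, measurable)
    finally show ?thesis .
  qed
  have "(\<integral>\<^sup>+h. ennreal (K h) * (I \<Omega> \<Omega> h + (I \<Omega> (- \<Omega>) h + I (- \<Omega>) \<Omega> h)) \<partial>lborel)
     = J1 K \<epsilon> E \<Omega> + (J2 K \<epsilon> E \<Omega> + J2 K \<epsilon> E \<Omega>)"
  proof -
    have "(\<integral>\<^sup>+h. ennreal (K h) * (I \<Omega> \<Omega> h + (I \<Omega> (- \<Omega>) h + I (- \<Omega>) \<Omega> h)) \<partial>lborel)
      = (\<integral>\<^sup>+h. ennreal (K h) * I \<Omega> \<Omega> h + (ennreal (K h) * I \<Omega> (- \<Omega>) h + ennreal (K h) * I (- \<Omega>) \<Omega> h) \<partial>lborel)"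
      by (simp only: distrib_left)
    also have "\<dots> = (\<integral>\<^sup>+h. ennreal (K h) * I \<Omega> \<Omega> h \<partial>lborel) + ((\<integral>\<^sup>+h. ennreal (K h) * I \<Omega> (- \<Omega>) h \<partial>lborel) + (\<integral>\<^sup>+h. ennreal (K h) * I (- \<Omega>) \<Omega> h \<partial>lborel))"
      by (subst nn_integral_add, measurable, subst nn_integral_add, measurable)
    finally show ?thesis by (simp only: J1 J2[symmetric] J2'[symmetric])
  qed
  then have tot: "(\<integral>\<^sup>+h. ennreal (K h) * (\<integral>\<^sup>+y. g y (y + \<epsilon> *\<^sub>R h) * indicator {y. y \<in> \<Omega> \<or> y + \<epsilon> *\<^sub>R h \<in> \<Omega>} y \<partial>lborel) \<partial>lborel)
    = J1 K \<epsilon> E \<Omega> + (J2 K \<epsilon> E \<Omega> + J2 K \<epsilon> E \<Omega>)" by (simp only: split)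
  have half: "(a + (b + b)) / 2 = a / 2 + b" for a b :: ennreal
    by (simp add: add_divide_distrib_ennreal mult_2[symmetric] ennreal_mult_divide_eq mult.commute[of 2] )
  show ?thesis unfolding J_def half[symmetric] tot[symmetric] g_def ..
qed

lemma kernel_tail_tendsto_0:
  fixes K :: "'a::euclidean_space \<Rightarrow> real"
  assumes K[measurable]: "K \<in> borel_measurable borel" and fin: "(\<integral>\<^sup>+h. ennreal (K h * norm h) \<partial>lborel) < \<infinity>" and \<delta>: "\<delta> > 0"
  shows "((\<lambda>\<epsilon>. \<integral>\<^sup>+h. ennreal (K h * norm h) * indicator {h. \<delta> < \<epsilon> * norm h} h \<partial>lborel) \<longlongrightarrow> 0) (at_right 0)"
proof (rule tendsto_at_right_sequentially[OF zero_less_one])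
  fix S :: "nat \<Rightarrow> real" assume S: "\<And>n. 0 < S n" "S \<longlonglongrightarrow> 0"
  have "(\<lambda>n. \<integral>\<^sup>+h. ennreal (K h * norm h) * indicator {h. \<delta> < S n * norm h} h \<partial>lborel) \<longlonglongrightarrow> (\<integral>\<^sup>+h. 0 \<partial>(lborel::'a measure))"
  proof (rule nn_integral_dominated_convergence[where w = "\<lambda>h. ennreal (K h * norm h)"])
    show "AE h in lborel. (\<lambda>n. ennreal (K h * norm h) * indicator {h. \<delta> < S n * norm h} h) \<longlonglongrightarrow> 0"
    proof (rule AE_I2)
      fix h :: 'a
      have "(\<lambda>n. S n * norm h) \<longlonglongrightarrow> 0" using tendsto_mult_left_zero[OF S(2)] by simp
      then have "eventually (\<lambda>n. S n * norm h < \<delta>) sequentially" using \<delta> by (rule order_tendstoD)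
      then have "eventually (\<lambda>n. ennreal (K h * norm h) * indicator {h. \<delta> < S n * norm h} h = 0) sequentially"
        by eventually_elim (simp add: indicator_def)
      then show "(\<lambda>n. ennreal (K h * norm h) * indicator {h. \<delta> < S n * norm h} h) \<longlonglongrightarrow> 0" by (rule tendsto_eventually)
    qed
  qed (use fin in \<open>auto simp: indicator_def\<close>)
  then show "(\<lambda>n. \<integral>\<^sup>+h. ennreal (K h * norm h) * indicator {h. \<delta> < S n * norm h} h \<partial>lborel) \<longlonglongrightarrow> 0" by simp
qed

text \<open>
The set of admissible \<open>y\<close> has measure at most \<open>2 |\<Omega>|\<close>, and \<open>1 \<le> \<epsilon> |h| / \<delta>\<close> in this range;
the factor \<open>\<epsilon>\<close> compensates the division of the energy by \<open>\<epsilon>\<close>.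
\<close>

lemma long_range_energy_le:
  fixes K :: "real ^ 'n \<Rightarrow> real" and \<Omega> :: "(real ^ 'n) set"
  assumes K[measurable]: "K \<in> borel_measurable borel" and K0: "\<And>h. K h \<ge> 0"
    and E[measurable]: "E \<in> sets borel" and \<Omega>[measurable]: "\<Omega> \<in> sets borel" and bd: "bounded \<Omega>" and \<delta>: "\<delta> > 0" and \<epsilon>: "\<epsilon> > 0"
  shows "(\<integral>\<^sup>+h. ennreal (K h) * indicator {h. \<delta> < \<epsilon> * norm h} h * (\<integral>\<^sup>+y. jump E (\<epsilon> *\<^sub>R h) y
        * indicator {y. y \<in> \<Omega> \<or> y + \<epsilon> *\<^sub>R h \<in> \<Omega>} y \<partial>lborel) \<partial>lborel)
    \<le> ennreal (2 * measure lborel \<Omega> * \<epsilon> / \<delta>) * (\<integral>\<^sup>+h. ennreal (K h * norm h) * indicator {h. \<delta> < \<epsilon> * norm h} h \<partial>lborel)"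
proof -
  let ?V = "measure lborel \<Omega>"
  have V: "emeasure lborel \<Omega> = ennreal ?V"
    using emeasure_bounded_finite[OF bd] by (intro emeasure_eq_ennreal_measure) auto
  have D: "(\<integral>\<^sup>+y. jump E (\<epsilon> *\<^sub>R h) y * indicator {y. y \<in> \<Omega> \<or> y + \<epsilon> *\<^sub>R h \<in> \<Omega>} y \<partial>lborel) \<le> ennreal (2 * ?V)" for h
  proof -
    have "(\<integral>\<^sup>+y. jump E (\<epsilon> *\<^sub>R h) y * indicator {y. y \<in> \<Omega> \<or> y + \<epsilon> *\<^sub>R h \<in> \<Omega>} y \<partial>lborel)
      \<le> (\<integral>\<^sup>+y. indicator \<Omega> y + indicator \<Omega> (\<epsilon> *\<^sub>R h + y) \<partial>lborel)"
      by (intro nn_integral_mono) (auto simp: indicator_def add.commute)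
    also have "\<dots> = (\<integral>\<^sup>+y. indicator \<Omega> y \<partial>lborel) + (\<integral>\<^sup>+y. indicator \<Omega> (\<epsilon> *\<^sub>R h + y) \<partial>lborel)"
      by (rule nn_integral_add) measurable
    also have "(\<integral>\<^sup>+y. indicator \<Omega> (\<epsilon> *\<^sub>R h + y) \<partial>lborel) = (\<integral>\<^sup>+y. indicator \<Omega> y \<partial>lborel)"
      by (rule nn_integral_lborel_shift) measurable
    also have "(\<integral>\<^sup>+y. indicator \<Omega> y \<partial>lborel) + (\<integral>\<^sup>+y. indicator \<Omega> y \<partial>lborel) = ennreal (2 * ?V)"
      by (simp add: V ennreal_plus[symmetric] del: ennreal_plus)
    finally show ?thesis .
  qed
  have "(\<integral>\<^sup>+h. ennreal (K h) * indicator {h. \<delta> < \<epsilon> * norm h} h * (\<integral>\<^sup>+y. jump E (\<epsilon> *\<^sub>R h) y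
        * indicator {y. y \<in> \<Omega> \<or> y + \<epsilon> *\<^sub>R h \<in> \<Omega>} y \<partial>lborel) \<partial>lborel)
    \<le> (\<integral>\<^sup>+h. ennreal (2 * ?V * \<epsilon> / \<delta>) * (ennreal (K h * norm h) * indicator {h. \<delta> < \<epsilon> * norm h} h) \<partial>lborel)"
  proof (rule nn_integral_mono)
    fix h :: "real ^ 'n"
    let ?D = "\<integral>\<^sup>+y. jump E (\<epsilon> *\<^sub>R h) y * indicator {y. y \<in> \<Omega> \<or> y + \<epsilon> *\<^sub>R h \<in> \<Omega>} y \<partial>lborel"
    show "ennreal (K h) * indicator {h. \<delta> < \<epsilon> * norm h} h * ?D \<le> ennreal (2 * ?V * \<epsilon> / \<delta>) * (ennreal (K h * norm h) * indicator {h. \<delta> < \<epsilon> * norm h} h)"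
    proof (cases "\<delta> < \<epsilon> * norm h")
      case True
      have "ennreal (K h) * ?D \<le> ennreal (K h) * ennreal (2 * ?V)" by (intro mult_left_mono D) auto
      also have "\<dots> = ennreal (K h * (2 * ?V))" using K0[of h] by (simp add: ennreal_mult[symmetric])
      also have "\<dots> \<le> ennreal (2 * ?V * \<epsilon> / \<delta> * (K h * norm h))"
      proof (rule ennreal_leI)
        have "1 \<le> \<epsilon> * norm h / \<delta>" using True \<delta> by simp
        then have "K h * (2 * ?V) * 1 \<le> K h * (2 * ?V) * (\<epsilon> * norm h / \<delta>)" using K0[of h] by (intro mult_left_mono) auto
        then show "K h * (2 * ?V) \<le> 2 * ?V * \<epsilon> / \<delta> * (K h * norm h)" by (simp add: mult_ac)
      qed
      also have "\<dots> = ennreal (2 * ?V * \<epsilon> / \<delta>) * ennreal (K h * norm h)"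
        using K0[of h] \<epsilon> \<delta> by (intro ennreal_mult) auto
      finally show ?thesis using True by simp
    qed simp
  qed
  also have "\<dots> = ennreal (2 * ?V * \<epsilon> / \<delta>) * (\<integral>\<^sup>+h. ennreal (K h * norm h) * indicator {h. \<delta> < \<epsilon> * norm h} h \<partial>lborel)"
    by (rule nn_integral_cmult) measurable
  finally show ?thesis .
qed

text \<open>
Take \<open>j \<epsilon>\<close> to be the largest index whose threshold, capped by \<open>1/(m + 1)\<close>, exceeds \<open>\<epsilon>\<close>. The cap
makes the set of such indices finite.
\<close>

lemma diagonal_selection:
  fixes Q :: "real \<Rightarrow> nat \<Rightarrow> bool"
  assumes "\<And>j. eventually (\<lambda>\<epsilon>. Q \<epsilon> j) (at_right 0)"
  obtains j where "filterlim j at_top (at_right (0::real))" "eventually (\<lambda>\<epsilon>. Q \<epsilon> (j \<epsilon>)) (at_right 0)"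
proof -
  have "\<exists>b>0. \<forall>\<epsilon>. 0 < \<epsilon> \<and> \<epsilon> < b \<longrightarrow> Q \<epsilon> j" for j
    using assms[of j] unfolding eventually_at_right_field by auto
  then obtain b where b: "\<And>j. b j > 0" "\<And>j \<epsilon>. 0 < \<epsilon> \<Longrightarrow> \<epsilon> < b j \<Longrightarrow> Q \<epsilon> j" by metis
  define c where "c m = min (b m) (inverse (real (Suc m)))" for m
  have c: "c m > 0" for m using b(1) by (simp add: c_def)
  define J where "J \<epsilon> = {m. \<epsilon> < c m}" for \<epsilon>
  have fin: "finite (J \<epsilon>)" if "\<epsilon> > 0" for \<epsilon>
  proof -
    obtain N where N: "inverse (real (Suc N)) < \<epsilon>" using reals_Archimedean[OF \<open>\<epsilon> > 0\<close>] by blast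
    have "J \<epsilon> \<subseteq> {..N}"
    proof
      fix m assume "m \<in> J \<epsilon>"
      then have "\<epsilon> < inverse (real (Suc m))" by (simp add: J_def c_def del: of_nat_Suc)
      with N have "inverse (real (Suc N)) < inverse (real (Suc m))" by (rule less_trans)
      then show "m \<in> {..N}" by (simp add: inverse_less_iff_less)
    qed
    then show ?thesis by (rule finite_subset) simp
  qed
  define j where "j \<epsilon> = Max (J \<epsilon>)" for \<epsilon>
  have large: "m \<le> j \<epsilon>" if "0 < \<epsilon>" "\<epsilon> < c m" for m \<epsilon>
    unfolding j_def using that by (intro Max_ge fin) (auto simp: J_def)
  have mem: "j \<epsilon> \<in> J \<epsilon>" if "0 < \<epsilon>" "\<epsilon> < c 0" for \<epsilon>
    unfolding j_def using that by (intro Max_in fin) (auto simp: J_def)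
  show ?thesis
  proof (rule that)
    show "filterlim j at_top (at_right 0)"
      unfolding filterlim_at_top eventually_at_right_field using large c by blast
    show "eventually (\<lambda>\<epsilon>. Q \<epsilon> (j \<epsilon>)) (at_right 0)"
      unfolding eventually_at_right_field
    proof (intro exI[of _ "c 0"] conjI c allI impI)
      fix \<epsilon> :: real assume "0 < \<epsilon>" "\<epsilon> < c 0"
      then show "Q \<epsilon> (j \<epsilon>)" using mem[of \<epsilon>] b(2)[of \<epsilon> "j \<epsilon>"] by (simp add: J_def c_def)
    qed
  qed
qed

text \<open>
The indicator of \<open>E\<close> is compared with a continuous function \<open>k\<close>: their distance in \<open>L\<^sup>1\<close> grows under
the deformation at most by the factor \<open>N = 2\<^sup>d\<close>, and \<open>k\<close> changes little under small displacements.
\<close>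

lemma deformed_set_converges:
  fixes X :: "'a::euclidean_space \<Rightarrow> 'a"
  assumes X: "\<And>x y. norm (X x - X y) \<le> M * norm (x - y)" "\<And>x. norm (X x) \<le> M" and M: "M > 0"
    and Xm: "X \<in> borel_measurable borel" and E[measurable]: "E \<in> sets borel" and C: "compact C" and e: "e > 0"
  obtains s where "s > 0" "\<And>t. 0 < t \<Longrightarrow> t < s \<Longrightarrow>
    emeasure lborel (sym_diff ((\<lambda>x. x + t *\<^sub>R X x) -` E) E \<inter> C) \<le> ennreal e"
proof -
  note Xm[measurable]
  have Cm[measurable]: "C \<in> sets borel" using compact_imp_closed[OF C] by (rule borel_closed)
  obtain R where R: "C \<subseteq> cball 0 R"
    using bounded_subset_ballD[OF compact_imp_bounded[OF C], of 0] ball_subset_cball by (meson order_trans)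
  define N where "N = (2::real) ^ DIM('a)"
  have N: "N > 0" by (simp add: N_def)
  define V where "V = measure lborel C"
  have V: "V \<ge> 0" "emeasure lborel C = ennreal V"
    using emeasure_bounded_finite[OF compact_imp_bounded[OF C]] by (auto simp: V_def emeasure_eq_ennreal_measure)
  define B where "B = E \<inter> cball 0 (R + 1)"
  have [measurable]: "cball (0::'a) (R + 1) \<in> sets borel" by simp
  have Bm[measurable]: "B \<in> sets borel" and Bb: "bounded B" by (auto simp: B_def bounded_Int)
  define e1 where "e1 = (e / 2) / (N + 1)"
  define e2 where "e2 = e / (2 * (V + 1))"
  have e1: "e1 > 0" using e N by (simp add: e1_def)
  have e2: "e2 > 0" using e V(1) by (simp add: e2_def)
  obtain k :: "'a \<Rightarrow> real" and R' where k: "continuous_on UNIV k" "\<And>x. 0 \<le> k x \<and> k x \<le> 1" "\<And>x. norm x > R' \<Longrightarrow> k x = 0"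
    "(\<integral>\<^sup>+x. ennreal \<bar>indicat_real B x - k x\<bar> \<partial>lborel) \<le> ennreal e1"
    by (rule approx_indicator_continuous[OF Bm Bb e1]) (rule that)
  have km[measurable]: "k \<in> borel_measurable borel" by (rule borel_measurable_continuous_onI[OF k(1)])
  obtain d where d: "d > 0" "\<And>x y. norm (x - y) < d \<Longrightarrow> norm (k x - k y) < e2"
    by (rule uniform_continuous_compact_support[OF k(1) _ e2, where R = R']) (erule k(3), rule that)
  \<comment> \<open>The first bound makes the inverse deformation \<open>2\<close>-Lipschitz, the second makes displacements shorter than \<open>d\<close>.\<close>
  define s where "s = min (1 / (2 * M)) (d / M)"
  have s: "s > 0" using M d(1) by (simp add: s_def)
  show ?thesis
  proof (rule that[OF s])
    fix t assume t: "0 < t" "t < s"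
    have "t < 1 / (2 * M)" "t < d / M" using t(2) by (auto simp: s_def)
    then have tM: "t * M < 1 / 2" "t * M < d" using M by (auto simp: field_simps)
    let ?\<Phi> = "\<lambda>x. x + t *\<^sub>R X x"
    have \<Phi>m[measurable]: "?\<Phi> \<in> borel_measurable borel" by measurable
    have tX: "norm (t *\<^sub>R X x) \<le> t * M" for x using X(2)[of x] t(1) by simp
    have tM1: "t * M < 1" using tM(1) by simp
    obtain \<Psi> where \<Psi>: "(1 / (1 - t * M))-lipschitz_on UNIV \<Psi>" "\<And>x. \<Psi> (?\<Phi> x) = x"
      by (rule perturbed_identity_inverse[OF X(1) M t(1) tM1]) (assumption | rule that)+
    have LN: "(1 / (1 - t * M)) ^ DIM('a) \<le> N"
      unfolding N_def using tM(1) by (intro power_mono) (auto simp: field_simps)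
    define f where "f x = \<bar>indicat_real B x - k x\<bar>" for x
    have fm[measurable]: "(\<lambda>x. ennreal (f x)) \<in> borel_measurable borel" unfolding f_def by measurable
    have pre[measurable]: "?\<Phi> -` E \<in> sets borel" using measurable_sets[OF \<Phi>m E] by simp
    let ?S = "sym_diff (?\<Phi> -` E) E \<inter> C"
    have "emeasure lborel ?S = (\<integral>\<^sup>+x. indicator ?S x \<partial>lborel)" by (subst nn_integral_indicator) auto
    also have "\<dots> \<le> (\<integral>\<^sup>+x. ennreal (f (?\<Phi> x)) + (ennreal (f x) + ennreal e2 * indicator C x) \<partial>lborel)"
    proof (rule nn_integral_mono)
      fix x
      show "indicator ?S x \<le> ennreal (f (?\<Phi> x)) + (ennreal (f x) + ennreal e2 * indicator C x)"
      proof (cases "x \<in> ?S")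
        case True
        then have xC: "x \<in> C" by simp
        have x: "norm x \<le> R" using xC R by auto
        moreover have "norm (?\<Phi> x) \<le> norm x + t * M" using norm_triangle_ineq[of x "t *\<^sub>R X x"] tX[of x] by linarith
        ultimately have "indicat_real B (?\<Phi> x) = indicat_real E (?\<Phi> x)" "indicat_real B x = indicat_real E x"
          using tM(1) by (auto simp: B_def indicator_def)
        moreover have "\<bar>indicat_real E (?\<Phi> x) - indicat_real E x\<bar> = 1" using True by (auto simp: indicator_def)
        moreover have "\<bar>k (?\<Phi> x) - k x\<bar> < e2" using d(2)[of "?\<Phi> x" x] tX[of x] tM(2) by simp
        ultimately have "1 \<le> f (?\<Phi> x) + (f x + e2)" unfolding f_def by linarith
        then have "ennreal 1 \<le> ennreal (f (?\<Phi> x) + (f x + e2))" by (rule ennreal_leI)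
        also have "\<dots> = ennreal (f (?\<Phi> x)) + (ennreal (f x) + ennreal e2)" using e2 by (simp add: f_def)
        finally show ?thesis using True by simp
      qed simp
    qed
    also have "\<dots> = (\<integral>\<^sup>+x. ennreal (f (?\<Phi> x)) \<partial>lborel) + ((\<integral>\<^sup>+x. ennreal (f x) \<partial>lborel) + (\<integral>\<^sup>+x. ennreal e2 * indicator C x \<partial>lborel))"
    proof -
      have m1: "(\<lambda>x. ennreal (f (?\<Phi> x))) \<in> borel_measurable lborel" using measurable_compose[OF \<Phi>m fm] by simp
      have m2: "(\<lambda>x. ennreal (f x)) \<in> borel_measurable lborel" by measurable
      have m3: "(\<lambda>x. ennreal e2 * indicator C x) \<in> borel_measurable lborel" by measurable
      show ?thesis unfolding nn_integral_add[OF m1 borel_measurable_add[OF m2 m3]] nn_integral_add[OF m2 m3] ..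
    qed
    also have "\<dots> \<le> ennreal (N * e1) + (ennreal e1 + ennreal (e2 * V))"
    proof (intro add_mono)
      have "(\<integral>\<^sup>+x. ennreal (f (?\<Phi> x)) \<partial>lborel) \<le> ennreal ((1 / (1 - t * M)) ^ DIM('a)) * (\<integral>\<^sup>+x. ennreal (f x) \<partial>lborel)"
        by (rule nn_integral_lipschitz_substitution[OF \<Psi> \<Phi>m fm])
      also have "\<dots> \<le> ennreal N * ennreal e1" using k(4) LN by (intro mult_mono ennreal_leI) (auto simp: f_def)
      finally show "(\<integral>\<^sup>+x. ennreal (f (?\<Phi> x)) \<partial>lborel) \<le> ennreal (N * e1)" using N e1 by (simp add: ennreal_mult)
      show "(\<integral>\<^sup>+x. ennreal (f x) \<partial>lborel) \<le> ennreal e1" using k(4) by (simp add: f_def)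
      show "(\<integral>\<^sup>+x. ennreal e2 * indicator C x \<partial>lborel) \<le> ennreal (e2 * V)"
        using e2 V by (simp add: nn_integral_cmult_indicator ennreal_mult)
    qed
    also have "\<dots> = ennreal (N * e1 + (e1 + e2 * V))" using N e1 e2 V by simp
    also have "\<dots> \<le> ennreal e"
    proof (rule ennreal_leI)
      have "(N + 1) * e1 = e / 2" using N by (simp add: e1_def divide_simps)
      then have "N * e1 + e1 = e / 2" by (simp add: algebra_simps)
      moreover have "e2 * V \<le> e / 2" using V(1) e by (simp add: e2_def field_simps)
      ultimately show "N * e1 + (e1 + e2 * V) \<le> e" by linarith
    qed
    finally show "emeasure lborel ?S \<le> ennreal e" .
  qed
qed

section \<open>Both inequalities for Borel data\<close>

lemma ennreal_half: "x / 2 = ennreal (1 / 2) * x"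
proof -
  have "inverse (ennreal 2) = ennreal (inverse 2)" by (rule inverse_ennreal) simp
  then have "inverse (2::ennreal) = ennreal (1 / 2)" by (simp only: ennreal_numeral inverse_eq_divide)
  then show ?thesis by (simp only: divide_ennreal_def mult.commute)
qed

text \<open>
For each \<open>j\<close> the deformed set has limiting energy at most \<open>a j\<close>, where \<open>a j\<close> tends to the constant
times the perimeter as \<open>t j \<rightarrow> 0\<close>; the family lets \<open>j\<close> tend to infinity slowly as \<open>\<epsilon> \<rightarrow> 0\<close>.
\<close>

lemma recovery_family:
  fixes K :: "real ^ 'n \<Rightarrow> real" and \<Omega> E :: "(real ^ 'n) set"
  assumes \<Omega>: "open \<Omega>" "bounded \<Omega>" "lipschitz_boundary \<Omega>"
    and K[measurable]: "K \<in> borel_measurable borel" and K0: "\<And>h. K h \<ge> 0" and rad: "\<And>h. K h = k (norm h)"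
    and fin: "(\<integral>\<^sup>+h. ennreal (K h * norm h) \<partial>lborel) < \<infinity>"
    and E[measurable]: "E \<in> sets borel" and Pfin: "Per E \<Omega> < \<infinity>"
  obtains F where "\<And>\<epsilon>. F \<epsilon> \<in> sets borel"
    "\<And>C. compact C \<Longrightarrow> ((\<lambda>\<epsilon>. emeasure lborel (sym_diff (F \<epsilon>) E \<inter> C)) \<longlongrightarrow> 0) (at_right 0)"
    "Limsup (at_right 0) (\<lambda>\<epsilon>. ennreal (1 / \<epsilon>) * J K \<epsilon> (F \<epsilon>) \<Omega>) \<le> (\<integral>\<^sup>+h. ennreal (K h * \<bar>h $ i\<bar>) \<partial>lborel) / 2 * Per E \<Omega>"
proof -
  have \<Omega>m[measurable]: "\<Omega> \<in> sets borel" using \<Omega>(1) by (rule borel_open)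
  have even: "K (- h) = K h" for h by (simp add: rad)
  obtain P \<nu> r t0 where P: "finite P" "\<And>p. p \<in> P \<Longrightarrow> r p > 0" "\<And>p. p \<in> P \<Longrightarrow> norm (\<nu> p) = 1" and t0: "t0 > 0"
    and inward: "\<And>t x. 0 < t \<Longrightarrow> t < t0 \<Longrightarrow> x \<in> closure \<Omega> \<Longrightarrow> x + t *\<^sub>R push_field P \<nu> r x \<in> \<Omega>"
    by (rule inward_push_field[OF \<Omega>]) (rule that)
  obtain M where M: "M > 0" "\<And>x Q. Q \<subseteq> P \<Longrightarrow> norm (push_field Q \<nu> r x) \<le> M"
    and adj: "\<And>x v. norm (push_deriv_adjoint P \<nu> r x v) \<le> M * norm v"
    and lipX: "\<And>x y. norm (push_field P \<nu> r x - push_field P \<nu> r y) \<le> M * norm (x - y)"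
    by (rule push_field_bounds[OF P]) (assumption, assumption, rule that)
  let ?X = "push_field P \<nu> r"
  have Xm: "?X \<in> borel_measurable borel"
    by (rule borel_measurable_continuous_onI[OF has_derivative_continuous_on[OF has_derivative_at_withinI[OF push_field_has_derivative]]])
  define m where "m = min t0 (1 / (2 * M))"
  have m: "m > 0" "m \<le> t0" "m \<le> 1 / (2 * M)" using t0 M(1) by (auto simp: m_def)
  \<comment> \<open>Below \<open>t0\<close> the deformation pushes inwards; below \<open>1 / (2 * M)\<close> it is invertible.\<close>
  define q where "q = m / 2"
  have qm: "q > 0" "q < m" using m(1) by (auto simp: q_def)
  have q: "q > 0" "q < t0" "q < 1 / (2 * M)"
    using qm less_le_trans[OF qm(2) m(2)] less_le_trans[OF qm(2) m(3)] by auto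
  define t where "t j = q * inverse (real (Suc j))" for j
  have tq: "t j > 0" "t j \<le> q" for j
  proof -
    show "t j > 0" using q(1) by (simp add: t_def)
    have "q * inverse (real (Suc j)) \<le> q * 1" using q(1) by (intro mult_left_mono) (auto simp: inverse_le_1_iff)
    then show "t j \<le> q" by (simp add: t_def)
  qed
  have tt0: "t j < t0" for j using tq(2)[of j] q(2) by simp
  have tM: "t j * M < 1" for j
  proof -
    have "t j < 1 / (2 * M)" using tq(2)[of j] q(3) by simp
    then have "t j * M < 1 / 2" using M(1) by (simp add: field_simps)
    then show ?thesis by simp
  qed
  have tlim: "t \<longlonglongrightarrow> 0" unfolding t_def by (intro tendsto_mult_right_zero LIMSEQ_inverse_real_of_nat)
  let ?\<Phi> = "\<lambda>j x. x + t j *\<^sub>R ?X x"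
  define c2 where "c2 = (\<integral>\<^sup>+h. ennreal (K h * \<bar>h $ i\<bar>) \<partial>lborel)"
  have c2: "c2 < \<infinity>"
  proof -
    have "c2 \<le> (\<integral>\<^sup>+h. ennreal (K h * norm h) \<partial>lborel)"
      unfolding c2_def using K0 by (intro nn_integral_mono ennreal_leI mult_left_mono component_le_norm_cart) auto
    then show ?thesis using fin by (rule le_less_trans)
  qed
  define b where "b j = (1 + t j * M) * (1 / (1 - t j * M)) ^ CARD('n)" for j
  define a where "a j = ennreal (1 / 2) * c2 * Per E \<Omega> * ennreal (b j)" for j
  have contX: "continuous_on UNIV (?\<Phi> j)" for j
    by (intro continuous_intros has_derivative_continuous_on[OF has_derivative_at_withinI[OF push_field_has_derivative]])
  have \<Phi>m: "?\<Phi> j \<in> borel_measurable borel" for j by (rule borel_measurable_continuous_onI[OF contX])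
  have Fm[measurable]: "?\<Phi> j -` E \<in> sets borel" for j using measurable_sets[OF \<Phi>m E, of j] by simp
  let ?G = "\<lambda>\<epsilon> j. ennreal (1 / \<epsilon>) * J K \<epsilon> (?\<Phi> j -` E) \<Omega>"
  have bound: "eventually (\<lambda>\<epsilon>. ?G \<epsilon> j \<le> a j + ennreal (inverse (real (Suc j)))) (at_right 0)" for j
  proof -
    obtain \<Psi> where \<Psi>: "(1 / (1 - t j * M))-lipschitz_on UNIV \<Psi>" "\<And>x. \<Psi> (?\<Phi> j x) = x"
      by (rule perturbed_identity_inverse[OF lipX M(1) tq(1) tM]) (assumption | rule that)+
    have cc: "compact (closure \<Omega>)" using \<Omega>(2) by simp
    have sub: "closure \<Omega> \<subseteq> ?\<Phi> j -` \<Omega>" using inward[OF tq(1) tt0] by auto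
    have op: "open (?\<Phi> j -` \<Omega>)" by (rule open_vimage[OF \<Omega>(1) contX])
    \<comment> \<open>The deformation maps the closure of the domain into the domain, hence also a compact neighbourhood \<open>C0\<close>.\<close>
    obtain \<delta> C0 where \<delta>: "\<delta> > 0" and C0: "compact C0" "C0 \<subseteq> ?\<Phi> j -` \<Omega>" "\<And>x. x \<in> closure \<Omega> \<Longrightarrow> cball x \<delta> \<subseteq> C0"
      by (rule compact_collar[OF cc sub op]) (rule that)
    have im: "?\<Phi> j ` C0 \<subseteq> \<Omega>" using C0(2) by auto
    have \<delta>C: "cball y \<delta> \<subseteq> C0" if "y \<in> \<Omega>" for y using C0(3)[of y] that closure_subset[of \<Omega>] by blast
    define T where "T \<epsilon> = (\<integral>\<^sup>+h. ennreal (K h * norm h) * indicator {h. \<delta> < \<epsilon> * norm h} h \<partial>lborel)" for \<epsilon>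
    define V where "V = measure lborel \<Omega>"
    have V: "V \<ge> 0" by (simp add: V_def)
    have G: "?G \<epsilon> j \<le> a j + ennreal (V / \<delta>) * T \<epsilon>" if \<epsilon>: "\<epsilon> > 0" for \<epsilon>
    proof -
      define D where "D h = (\<integral>\<^sup>+y. jump (?\<Phi> j -` E) (\<epsilon> *\<^sub>R h) y
        * indicator {y. y \<in> \<Omega> \<or> y + \<epsilon> *\<^sub>R h \<in> \<Omega>} y \<partial>lborel)" for h
      have Dm[measurable]: "D \<in> borel_measurable borel" unfolding D_def by measurable
      have short: "(\<integral>\<^sup>+h. ennreal (K h) * indicator {h. \<epsilon> * norm h \<le> \<delta>} h * D h \<partial>lborel) \<le> ennreal \<epsilon> * (c2 * (ennreal (b j) * Per E \<Omega>))"
        unfolding D_def c2_def b_def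
        by (rule short_range_energy_le[OF M(1) tq(1) tM adj \<Psi> K K0 rad E \<Omega>(1) C0(1) im \<delta>C \<epsilon>])
      have long: "(\<integral>\<^sup>+h. ennreal (K h) * indicator {h. \<delta> < \<epsilon> * norm h} h * D h \<partial>lborel) \<le> ennreal (2 * V * \<epsilon> / \<delta>) * T \<epsilon>"
        unfolding D_def T_def V_def by (rule long_range_energy_le[OF K K0 Fm \<Omega>m \<Omega>(2) \<delta> \<epsilon>])
      have "(\<integral>\<^sup>+h. ennreal (K h) * D h \<partial>lborel)
        = (\<integral>\<^sup>+h. ennreal (K h) * indicator {h. \<epsilon> * norm h \<le> \<delta>} h * D h + ennreal (K h) * indicator {h. \<delta> < \<epsilon> * norm h} h * D h \<partial>lborel)"
        by (intro nn_integral_cong) (auto simp: indicator_def)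
      also have "\<dots> = (\<integral>\<^sup>+h. ennreal (K h) * indicator {h. \<epsilon> * norm h \<le> \<delta>} h * D h \<partial>lborel) + (\<integral>\<^sup>+h. ennreal (K h) * indicator {h. \<delta> < \<epsilon> * norm h} h * D h \<partial>lborel)"
        by (rule nn_integral_add) measurable
      also have "\<dots> \<le> ennreal \<epsilon> * (c2 * (ennreal (b j) * Per E \<Omega>)) + ennreal (2 * V * \<epsilon> / \<delta>) * T \<epsilon>"
        by (intro add_mono short long)
      finally have I: "(\<integral>\<^sup>+h. ennreal (K h) * D h \<partial>lborel) \<le> \<dots>" .
      have "?G \<epsilon> j = ennreal (1 / \<epsilon>) * (ennreal (1 / 2) * (\<integral>\<^sup>+h. ennreal (K h) * D h \<partial>lborel))"
        unfolding J_eq_difference_form[OF K K0 even \<epsilon> Fm \<Omega>m] ennreal_half D_def ..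
      also have "\<dots> \<le> ennreal (1 / \<epsilon>) * (ennreal (1 / 2) * (ennreal \<epsilon> * (c2 * (ennreal (b j) * Per E \<Omega>)) + ennreal (2 * V * \<epsilon> / \<delta>) * T \<epsilon>))"
        by (intro mult_left_mono I) auto
      also have "\<dots> = (ennreal (1 / \<epsilon>) * ennreal \<epsilon>) * (ennreal (1 / 2) * c2 * Per E \<Omega> * ennreal (b j))
          + (ennreal (1 / \<epsilon>) * ennreal (1 / 2) * ennreal (2 * V * \<epsilon> / \<delta>)) * T \<epsilon>"
        by (simp only: distrib_left mult_ac)
      also have "ennreal (1 / \<epsilon>) * ennreal \<epsilon> = 1" using \<epsilon> by (simp add: ennreal_mult[symmetric])
      also have "ennreal (1 / \<epsilon>) * ennreal (1 / 2) * ennreal (2 * V * \<epsilon> / \<delta>) = ennreal (V / \<delta>)"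
      proof -
        have "ennreal (1 / \<epsilon>) * ennreal (1 / 2) = ennreal (1 / \<epsilon> * (1 / 2))"
          using \<epsilon> by (intro ennreal_mult[symmetric]) auto
        moreover have "ennreal (1 / \<epsilon> * (1 / 2)) * ennreal (2 * V * \<epsilon> / \<delta>) = ennreal (1 / \<epsilon> * (1 / 2) * (2 * V * \<epsilon> / \<delta>))"
          using \<epsilon> \<delta> V by (intro ennreal_mult[symmetric]) auto
        moreover have "1 / \<epsilon> * (1 / 2) * (2 * V * \<epsilon> / \<delta>) = V / \<delta>" using \<epsilon> by simp
        ultimately show ?thesis by (simp only:)
      qed
      finally show ?thesis by (simp add: a_def)
    qed
    have "((\<lambda>\<epsilon>. ennreal (V / \<delta>) * T \<epsilon>) \<longlongrightarrow> ennreal (V / \<delta>) * 0) (at_right 0)"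
      unfolding T_def by (intro ennreal_tendsto_cmult kernel_tail_tendsto_0[OF K fin \<delta>]) simp
    then have "eventually (\<lambda>\<epsilon>. ennreal (V / \<delta>) * T \<epsilon> < ennreal (inverse (real (Suc j)))) (at_right 0)"
      by (intro order_tendstoD) auto
    then show ?thesis
      using eventually_at_right_less[of "0::real"]
    proof eventually_elim
      case (elim \<epsilon>)
      show ?case using G[OF elim(2)] elim(1) by (meson add_left_mono less_imp_le order_trans)
    qed
  qed
  obtain jj where jj: "filterlim jj at_top (at_right (0::real))"
    "eventually (\<lambda>\<epsilon>. ?G \<epsilon> (jj \<epsilon>) \<le> a (jj \<epsilon>) + ennreal (inverse (real (Suc (jj \<epsilon>))))) (at_right 0)"
    by (rule diagonal_selection[OF bound]) (rule that)
  show ?thesis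
  proof (rule that[of "\<lambda>\<epsilon>. ?\<Phi> (jj \<epsilon>) -` E"])
    show "?\<Phi> (jj \<epsilon>) -` E \<in> sets borel" for \<epsilon> by (rule Fm)
  next
    fix C :: "(real ^ 'n) set" assume C: "compact C"
    have "(\<lambda>j. emeasure lborel (sym_diff (?\<Phi> j -` E) E \<inter> C)) \<longlonglongrightarrow> 0"
    proof (rule ennreal_tendsto_0I)
      fix e :: real assume e: "e > 0"
      obtain s where s: "s > 0" "\<And>t. 0 < t \<Longrightarrow> t < s \<Longrightarrow> emeasure lborel (sym_diff ((\<lambda>x. x + t *\<^sub>R ?X x) -` E) E \<inter> C) \<le> ennreal e"
        by (rule deformed_set_converges[OF lipX M(2)[OF order_refl] M(1) Xm E C e]) (rule that)
      have "eventually (\<lambda>j. t j < s) sequentially" using tlim s(1) by (rule order_tendstoD)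
      then show "eventually (\<lambda>j. emeasure lborel (sym_diff (?\<Phi> j -` E) E \<inter> C) \<le> ennreal e) sequentially"
        by eventually_elim (rule s(2)[OF tq(1)])
    qed
    from filterlim_compose[OF this jj(1)]
    show "((\<lambda>\<epsilon>. emeasure lborel (sym_diff (?\<Phi> (jj \<epsilon>) -` E) E \<inter> C)) \<longlongrightarrow> 0) (at_right 0)" .
  next
    have blim: "b \<longlonglongrightarrow> (1 + 0 * M) * (1 / (1 - 0 * M)) ^ CARD('n)"
      unfolding b_def by (intro tendsto_intros tlim) simp
    have fin2: "ennreal (1 / 2) * c2 * Per E \<Omega> < top"
      using c2 Pfin by (simp only: ennreal_mult_less_top ennreal_less_top infinity_ennreal_def simp_thms)
    have "a \<longlonglongrightarrow> ennreal (1 / 2) * c2 * Per E \<Omega> * ennreal 1"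
      unfolding a_def using blim by (intro ennreal_tendsto_cmult fin2 tendsto_ennrealI) simp
    moreover have "(\<lambda>j. ennreal (inverse (real (Suc j)))) \<longlonglongrightarrow> ennreal 0"
      by (intro tendsto_ennrealI LIMSEQ_inverse_real_of_nat)
    ultimately have "(\<lambda>j. a j + ennreal (inverse (real (Suc j)))) \<longlonglongrightarrow> ennreal (1 / 2) * c2 * Per E \<Omega> * ennreal 1 + ennreal 0"
      by (rule tendsto_add)
    then have "(\<lambda>j. a j + ennreal (inverse (real (Suc j)))) \<longlonglongrightarrow> c2 / 2 * Per E \<Omega>"
      by (simp only: ennreal_half ennreal_1 ennreal_0 mult_1_right add_0_right)
    from filterlim_compose[OF this jj(1)]
    have lim: "((\<lambda>\<epsilon>. a (jj \<epsilon>) + ennreal (inverse (real (Suc (jj \<epsilon>))))) \<longlongrightarrow> c2 / 2 * Per E \<Omega>) (at_right 0)" .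
    have "Limsup (at_right 0) (\<lambda>\<epsilon>. ?G \<epsilon> (jj \<epsilon>)) \<le> Limsup (at_right 0) (\<lambda>\<epsilon>. a (jj \<epsilon>) + ennreal (inverse (real (Suc (jj \<epsilon>)))))"
      by (rule Limsup_mono[OF jj(2)])
    also have "\<dots> = c2 / 2 * Per E \<Omega>"
      by (rule lim_imp_Limsup[OF _ lim]) (simp add: trivial_limit_at_right_real)
    finally show "Limsup (at_right 0) (\<lambda>\<epsilon>. ?G \<epsilon> (jj \<epsilon>)) \<le> (\<integral>\<^sup>+h. ennreal (K h * \<bar>h $ i\<bar>) \<partial>lborel) / 2 * Per E \<Omega>"
      unfolding c2_def .
  qed
qed

text \<open>
For each test field, a mollification scale is chosen that is adapted to the support of the field and to the
accuracy \<open>e'\<close>; the fixed-scale lower bound then controls its pairing with the gradient of \<open>E\<close>. The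
accuracy can be sent to \<open>0\<close> because the constant is finite.
\<close>

lemma sequential_lower_bound:
  fixes K :: "real ^ 'n \<Rightarrow> real" and \<Omega> E :: "(real ^ 'n) set"
  assumes \<Omega>: "open \<Omega>"
    and K[measurable]: "K \<in> borel_measurable borel" and K0: "\<And>h. K h \<ge> 0" and rad: "\<And>h. K h = k (norm h)"
    and fin: "(\<integral>\<^sup>+h. ennreal (K h * \<bar>h $ i\<bar>) \<partial>lborel) < \<infinity>"
    and E[measurable]: "E \<in> sets borel"
    and F[measurable]: "\<And>k::nat. F k \<in> sets borel"
    and lim: "\<And>C. compact C \<Longrightarrow> (\<lambda>k. emeasure lborel (sym_diff (F k) E \<inter> C)) \<longlonglongrightarrow> 0"
    and \<epsilon>: "\<And>k. \<epsilon> k > 0" "\<epsilon> \<longlonglongrightarrow> 0"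
  shows "(\<integral>\<^sup>+h. ennreal (K h * \<bar>h $ i\<bar>) \<partial>lborel) / 2 * Per E \<Omega> \<le> liminf (\<lambda>k. ennreal (1 / (2 * \<epsilon> k)) * J1 K (\<epsilon> k) (F k) \<Omega>)"
    (is "?c2 / 2 * _ \<le> ?L")
proof -
  have \<Omega>m[measurable]: "\<Omega> \<in> sets borel" using \<Omega> by (rule borel_open)
  have even: "K (- h) = K h" for h by (simp add: rad)
  have c: "?c2 / 2 < top" using fin by (simp only: ennreal_half ennreal_mult_less_top ennreal_less_top infinity_ennreal_def simp_thms)
  then obtain c where c: "?c2 / 2 = ennreal c" "c \<ge> 0" by (cases "?c2 / 2") auto
  have main: "ennreal c * ennreal (distr_grad E \<phi>) \<le> ?L" if \<phi>: "\<phi> \<in> test_fields \<Omega>" "\<forall>x. norm (\<phi> x) \<le> 1" for \<phi>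
  proof (rule ennreal_le_epsilon)
    fix e :: real assume e: "e > 0"
    define e' where "e' = e / (c + 1)"
    have e': "e' > 0" "c * e' \<le> e" using e c(2) by (auto simp: e'_def field_simps)
    obtain C \<eta>0 where C: "compact C" "C \<subseteq> \<Omega>" and \<eta>0: "\<eta>0 > 0"
      "\<And>\<eta>. 0 < \<eta> \<Longrightarrow> \<eta> < \<eta>0 \<Longrightarrow> ennreal (distr_grad E \<phi>)
        \<le> (\<integral>\<^sup>+x\<in>C. ennreal (norm (mollified_grad \<eta> E x)) \<partial>lborel) + ennreal e'"
      by (rule test_field_le_gradient_integral[OF \<phi>(1) \<phi>(2)[rule_format] E e'(1)]) (rule that)
    have Cm[measurable]: "C \<in> sets borel" using compact_imp_closed[OF C(1)] by (rule borel_closed)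
    obtain s C' where s: "s > 0" "compact C'" "C' \<subseteq> \<Omega>" "\<And>x. x \<in> C \<Longrightarrow> cball x s \<subseteq> C'"
      by (rule compact_collar[OF C \<Omega>]) (rule that)
    define \<eta> where "\<eta> = min (\<eta>0 / 2) (s / 2)"
    have \<eta>: "\<eta> > 0" "\<eta> < \<eta>0" "2 * \<eta> \<le> s" using \<eta>0(1) s(1) by (auto simp: \<eta>_def)
    have C\<Omega>: "cball x (2 * \<eta>) \<subseteq> \<Omega>" if "x \<in> C" for x
      using s(3) s(4)[OF that] subset_cball[OF \<eta>(3), of x] by blast
    let ?v = "mollified_grad \<eta> E"
    have E1: "\<bar>indicat_real E z\<bar> \<le> 1" for z by (simp add: indicator_def)
    have Em: "indicat_real E \<in> borel_measurable borel" by measurable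
    have vm[measurable]: "?v \<in> borel_measurable borel"
      by (rule borel_measurable_continuous_onI[OF continuous_conv_moll_grad[OF \<eta>(1) Em E1]])
    have "ennreal c * (\<integral>\<^sup>+x\<in>C. ennreal (norm (?v x)) \<partial>lborel)
      = ennreal (1 / 2) * (\<integral>\<^sup>+h. ennreal (K h) * (\<integral>\<^sup>+x\<in>C. ennreal \<bar>?v x \<bullet> h\<bar> \<partial>lborel) \<partial>lborel)"
      unfolding c(1)[symmetric] ennreal_half nn_integral_kernel_directional[OF K K0 rad vm Cm, where i = i]
      by (simp only: mult.assoc)
    also have "\<dots> \<le> ennreal (1 / 2) * liminf (\<lambda>k. ennreal (1 / \<epsilon> k) * J1 K (\<epsilon> k) (F k) \<Omega>)"
    proof (rule mult_left_mono)
      have J1: "J1 K (\<epsilon> k) (F k) \<Omega> = (\<integral>\<^sup>+h. ennreal (K h) * (\<integral>\<^sup>+y. jump (F k) (\<epsilon> k *\<^sub>R h) y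
         * indicator \<Omega> y * indicator \<Omega> (y + \<epsilon> k *\<^sub>R h) \<partial>lborel) \<partial>lborel)" for k
        unfolding J1_def by (rule interaction_eq_difference_form[OF K K0 even \<epsilon>(1) F \<Omega>m \<Omega>m])
      show "(\<integral>\<^sup>+h. ennreal (K h) * (\<integral>\<^sup>+x\<in>C. ennreal \<bar>?v x \<bullet> h\<bar> \<partial>lborel) \<partial>lborel) \<le> liminf (\<lambda>k. ennreal (1 / \<epsilon> k) * J1 K (\<epsilon> k) (F k) \<Omega>)"
        unfolding J1 by (rule liminf_interaction_ge[OF K K0 \<Omega>m E F lim \<epsilon> \<eta>(1) Cm C\<Omega>])
    qed simp
    also have "\<dots> \<le> liminf (\<lambda>k. ennreal (1 / 2) * (ennreal (1 / \<epsilon> k) * J1 K (\<epsilon> k) (F k) \<Omega>))"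
      by (rule mult_Liminf_le_ennreal)
    also have "\<dots> = ?L"
    proof -
      have "ennreal (1 / 2) * ennreal (1 / \<epsilon> k) = ennreal (1 / (2 * \<epsilon> k))" for k
        using \<epsilon>(1)[of k] by (subst ennreal_mult[symmetric]) auto
      then show ?thesis by (simp only: mult.assoc[symmetric])
    qed
    finally have 1: "ennreal c * (\<integral>\<^sup>+x\<in>C. ennreal (norm (?v x)) \<partial>lborel) \<le> ?L" .
    have "ennreal c * ennreal (distr_grad E \<phi>) \<le> ennreal c * ((\<integral>\<^sup>+x\<in>C. ennreal (norm (?v x)) \<partial>lborel) + ennreal e')"
      by (intro mult_left_mono \<eta>0(2) \<eta>) auto
    also have "\<dots> = ennreal c * (\<integral>\<^sup>+x\<in>C. ennreal (norm (?v x)) \<partial>lborel) + ennreal (c * e')"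
      using c(2) e'(1) by (simp only: distrib_left ennreal_mult less_imp_le)
    also have "\<dots> \<le> ?L + ennreal e" by (intro add_mono 1 ennreal_leI e'(2))
    finally show "ennreal c * ennreal (distr_grad E \<phi>) \<le> ?L + ennreal e" .
  qed
  show ?thesis
    unfolding c(1) Per_def SUP_mult_left_ennreal using main by (intro SUP_least) auto
qed

section \<open>Reduction from Lebesgue to Borel data, and the theorem\<close>

lemma AE_not_in_reflected_scaled:
  fixes y :: "'a::euclidean_space"
  assumes N: "N \<in> null_sets lborel" and \<epsilon>: "\<epsilon> > 0"
  shows "AE x in lborel. (y - x) /\<^sub>R \<epsilon> \<notin> N"
proof -
  have Nm[measurable]: "N \<in> sets borel" and N0: "emeasure lborel N = 0" using N by (auto simp: null_sets_def)
  define f where "f x = (indicator N (x /\<^sub>R \<epsilon>) :: ennreal)" for x :: 'a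
  have fm[measurable]: "f \<in> borel_measurable borel" unfolding f_def by measurable
  have "(\<integral>\<^sup>+x. f x \<partial>lborel) = ennreal (\<epsilon> ^ DIM('a)) * (\<integral>\<^sup>+x. f (\<epsilon> *\<^sub>R x) \<partial>lborel)"
    by (rule nn_integral_lborel_scale[OF fm \<epsilon>])
  also have "(\<integral>\<^sup>+x. f (\<epsilon> *\<^sub>R x) \<partial>lborel) = 0" using \<epsilon> N0 by (simp add: f_def)
  finally have "(\<integral>\<^sup>+x. f (y - x) \<partial>lborel) = 0" using nn_integral_lborel_reflect[OF fm, of y] by simp
  then have "AE x in lborel. f (y - x) = 0" by (subst (asm) nn_integral_0_iff_AE) auto
  then show ?thesis by eventually_elim (auto simp: f_def indicator_def split: if_splits)
qed

text \<open>
For each \<open>y\<close> the exceptional points \<open>x\<close> are a reflected, translated and rescaled copy of a null set.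
\<close>

lemma interaction_cong_AE:
  fixes K K' :: "real ^ 'n \<Rightarrow> real"
  assumes K: "AE h in lborel. K h = K' h" and E: "AE x in lborel. x \<in> E \<longleftrightarrow> x \<in> E'" and \<epsilon>: "\<epsilon> > 0"
  shows "(\<integral>\<^sup>+y\<in>A. (\<integral>\<^sup>+x\<in>B. ennreal (scaled_kernel K \<epsilon> (y - x) * \<bar>indicat_real E y - indicat_real E x\<bar>) \<partial>lebesgue) \<partial>lebesgue)
    = (\<integral>\<^sup>+y\<in>A. (\<integral>\<^sup>+x\<in>B. ennreal (scaled_kernel K' \<epsilon> (y - x) * \<bar>indicat_real E' y - indicat_real E' x\<bar>) \<partial>lebesgue) \<partial>lebesgue)"
  unfolding nn_integral_completion
proof (rule nn_integral_cong_AE)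
  obtain N where N': "\<And>h. h \<in> space lborel - N \<Longrightarrow> K h = K' h" and N1: "N \<in> null_sets lborel"
    by (rule AE_E3[OF K]) (rule that)
  have N2: "K h = K' h" if "h \<notin> N" for h by (rule N') (use that in simp)
  show "AE y in lborel. (\<integral>\<^sup>+x\<in>B. ennreal (scaled_kernel K \<epsilon> (y - x) * \<bar>indicat_real E y - indicat_real E x\<bar>) \<partial>lborel) * indicator A y
     = (\<integral>\<^sup>+x\<in>B. ennreal (scaled_kernel K' \<epsilon> (y - x) * \<bar>indicat_real E' y - indicat_real E' x\<bar>) \<partial>lborel) * indicator A y"
    using E
  proof eventually_elim
    case (elim y)
    have "AE x in lborel. ennreal (scaled_kernel K \<epsilon> (y - x) * \<bar>indicat_real E y - indicat_real E x\<bar>) * indicator B x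
      = ennreal (scaled_kernel K' \<epsilon> (y - x) * \<bar>indicat_real E' y - indicat_real E' x\<bar>) * indicator B x"
      using E AE_not_in_reflected_scaled[OF N1 \<epsilon>, of y]
    proof eventually_elim
      case (elim x)
      then have "K ((y - x) /\<^sub>R \<epsilon>) = K' ((y - x) /\<^sub>R \<epsilon>)" by (intro N2)
      then show ?case using elim \<open>y \<in> E \<longleftrightarrow> y \<in> E'\<close> by (simp add: scaled_kernel_def indicator_def)
    qed
    then show ?case by (simp only: nn_integral_cong_AE)
  qed
qed

lemma J1_cong_AE:
  fixes K K' :: "real ^ 'n \<Rightarrow> real"
  assumes "AE h in lborel. K h = K' h" "AE x in lborel. x \<in> E \<longleftrightarrow> x \<in> E'" "\<epsilon> > 0"
  shows "J1 K \<epsilon> E \<Omega> = J1 K' \<epsilon> E' \<Omega>"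
  unfolding J1_def by (rule interaction_cong_AE[OF assms])

lemma J_cong_AE:
  fixes K K' :: "real ^ 'n \<Rightarrow> real"
  assumes "AE h in lborel. K h = K' h" "AE x in lborel. x \<in> E \<longleftrightarrow> x \<in> E'" "\<epsilon> > 0"
  shows "J K \<epsilon> E \<Omega> = J K' \<epsilon> E' \<Omega>"
  unfolding J_def J2_def J1_cong_AE[OF assms] interaction_cong_AE[OF assms] ..

lemma continuous_divergence_test_field:
  assumes "\<phi> \<in> test_fields \<Omega>"
  shows "continuous_on UNIV (divergence \<phi>)"
proof -
  obtain C R G where "compact C" "C \<subseteq> \<Omega>" "\<And>x. x \<notin> C \<Longrightarrow> \<phi> x = 0" "C \<subseteq> cball 0 R"
    "\<And>i x. ((\<lambda>x. \<phi> x $ i) has_derivative (\<lambda>h. G i x \<bullet> h)) (at x)"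
    and G: "\<And>i. continuous_on UNIV (G i)" and "\<And>i x. norm x > R \<Longrightarrow> G i x = 0"
    and div: "\<And>x. divergence \<phi> x = (\<Sum>i\<in>UNIV. G i x $ i)" and "continuous_on UNIV \<phi>"
    by (rule test_field_gradients[OF assms]) (rule that)
  show ?thesis unfolding div[abs_def] by (intro continuous_on_sum continuous_on_component G)
qed

text \<open>
The divergence of a test field is continuous, so that both pairings are integrals of functions which
are measurable and agree almost everywhere.
\<close>

lemma Per_cong_AE:
  fixes E E' :: "(real ^ 'n) set"
  assumes EE: "AE x in lborel. x \<in> E \<longleftrightarrow> x \<in> E'" and E: "E \<in> sets lebesgue" "E' \<in> sets lebesgue"
  shows "Per E \<Omega> = Per E' \<Omega>"
proof -
  have "distr_grad E \<phi> = distr_grad E' \<phi>" if \<phi>: "\<phi> \<in> test_fields \<Omega>" for \<phi>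
  proof -
    have m: "divergence \<phi> \<in> borel_measurable lebesgue"
      using continuous_divergence_test_field[OF \<phi>]
      by (intro measurable_completion) (simp add: borel_measurable_continuous_onI)
    have "(\<integral>x. indicator E x *\<^sub>R divergence \<phi> x \<partial>lebesgue) = (\<integral>x. indicator E' x *\<^sub>R divergence \<phi> x \<partial>lebesgue)"
    proof (rule integral_cong_AE)
      show "AE x in lebesgue. indicator E x *\<^sub>R divergence \<phi> x = indicator E' x *\<^sub>R divergence \<phi> x"
        using AE_completion[OF EE] by eventually_elim (simp add: indicator_def)
    qed (use E m in \<open>auto intro!: borel_measurable_scaleR borel_measurable_indicator\<close>)
    then show ?thesis by (simp add: distr_grad_def set_lebesgue_integral_def)
  qed
  then show ?thesis unfolding Per_def by (intro SUP_cong) auto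
qed

lemma borel_version:
  fixes E :: "'a::euclidean_space set"
  assumes "E \<in> sets lebesgue"
  obtains E' where "E' \<in> sets borel" "AE x in lborel. x \<in> E \<longleftrightarrow> x \<in> E'"
proof -
  obtain S N N' where *: "E = S \<union> N" "N \<subseteq> N'" "N' \<in> null_sets lborel" "S \<in> sets lborel"
    using assms by (rule sets_completionE)
  show ?thesis
  proof (rule that)
    show "S \<in> sets borel" using *(4) by simp
    show "AE x in lborel. x \<in> E \<longleftrightarrow> x \<in> S"
      using AE_not_in[OF *(3)] by eventually_elim (use *(1,2) in auto)
  qed
qed

lemma emeasure_sym_diff_cong_AE:
  fixes A A' B B' C :: "'a::euclidean_space set"
  assumes AE: "AE x in lborel. x \<in> A \<longleftrightarrow> x \<in> A'" "AE x in lborel. x \<in> B \<longleftrightarrow> x \<in> B'"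
    and m: "A \<in> sets lebesgue" "B \<in> sets lebesgue" "A' \<in> sets borel" "B' \<in> sets borel" and C: "compact C"
  shows "emeasure lebesgue (sym_diff A B \<inter> C) = emeasure lborel (sym_diff A' B' \<inter> C)"
proof -
  have C: "C \<in> sets borel" using compact_imp_closed[OF C] by (rule borel_closed)
  have m': "A' \<in> sets lebesgue" "B' \<in> sets lebesgue" "C \<in> sets lebesgue" using m(3,4) C by auto
  have "emeasure lebesgue (sym_diff A B \<inter> C) = emeasure lebesgue (sym_diff A' B' \<inter> C)"
  proof (rule emeasure_eq_AE)
    show "AE x in lebesgue. (x \<in> sym_diff A B \<inter> C) = (x \<in> sym_diff A' B' \<inter> C)"
      using AE_completion[OF AE(1)] AE_completion[OF AE(2)] by eventually_elim auto
  qed (use m(1,2) m' in auto)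
  also have "\<dots> = emeasure lborel (sym_diff A' B' \<inter> C)"
  proof -
    have "sym_diff A' B' \<inter> C \<in> sets borel" using m(3,4) C by auto
    then show ?thesis by simp
  qed
  finally show ?thesis .
qed

text \<open>
By isotropy \<open>K h * h $ l\<close> vanishes almost everywhere for every coordinate \<open>l\<close>, and the
coordinates vanish together only at the origin.
\<close>

lemma kernel_zero_of_directional_zero:
  fixes K :: "real ^ 'n \<Rightarrow> real"
  assumes K[measurable]: "K \<in> borel_measurable borel" and K0: "\<And>h. K h \<ge> 0" and rad: "\<And>h. K h = k (norm h)"
    and z: "(\<integral>\<^sup>+h. ennreal (K h * \<bar>h $ i\<bar>) \<partial>lborel) = 0"
  shows "AE h in lborel. K h = 0"
proof -
  have "AE h in lborel. K h * \<bar>axis l 1 \<bullet> h\<bar> = 0" for l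
  proof -
    have "(\<integral>\<^sup>+h. ennreal (K h * \<bar>axis l 1 \<bullet> h\<bar>) \<partial>lborel) = 0"
      using nn_integral_radial_directional[OF K K0 rad, of "axis l 1" i] z by simp
    then have "AE h in lborel. ennreal (K h * \<bar>axis l 1 \<bullet> h\<bar>) = 0" by (subst (asm) nn_integral_0_iff_AE) auto
    then show ?thesis
    proof eventually_elim
      case (elim h)
      have "0 \<le> K h * \<bar>axis l 1 \<bullet> h\<bar>" using K0[of h] by simp
      moreover have "K h * \<bar>axis l 1 \<bullet> h\<bar> \<le> 0" using elim by (simp only: ennreal_eq_0_iff)
      ultimately show ?case by (rule antisym[rotated])
    qed
  qed
  then have "AE h in lborel. \<forall>l\<in>UNIV. K h * \<bar>axis l 1 \<bullet> h\<bar> = 0" by (intro AE_finite_allI) auto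
  moreover have "AE h in lborel. h \<noteq> (0::real^'n)" by (rule AE_lborel_singleton)
  ultimately show ?thesis
  proof eventually_elim
    case (elim h)
    then obtain l where "h $ l \<noteq> 0" by (auto simp: vec_eq_iff)
    then show ?case using elim(1) by (auto simp: inner_axis')
  qed
qed

theorem theorem3p1:
  fixes \<Omega> E :: "(real ^ 'n::{finite,linorder}) set"
    and K :: "real ^ 'n::{finite,linorder} \<Rightarrow> real"
    and Kbar :: "real \<Rightarrow> real"
  assumes "open \<Omega>" and "connected \<Omega>" and "bounded \<Omega>" and "lipschitz_boundary \<Omega>"
    and "\<And>h. K h = Kbar (norm h)"
    and "\<And>r. r \<ge> 0 \<Longrightarrow> Kbar r \<ge> 0"
    and "set_borel_measurable lebesgue {0..} Kbar"
    and "(\<integral>\<^sup>+r\<in>{0..}. ennreal (Kbar r * r ^ CARD('n)) \<partial>lebesgue) < \<infinity>"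
    and "E \<in> sets lebesgue"
  shows "(\<exists>F. (\<forall>\<epsilon>>0. F \<epsilon> \<in> sets lebesgue) \<and> conv_L1_loc F E \<and>
            Limsup (at_right 0) (\<lambda>\<epsilon>. ennreal (1 / \<epsilon>) * J K \<epsilon> (F \<epsilon>) \<Omega>) \<le> c_K K * Per E \<Omega>)
       \<and> (strict_antimono_on {0..} Kbar \<longrightarrow>
           (\<forall>F. (\<forall>\<epsilon>>0. F \<epsilon> \<in> sets lebesgue) \<and> conv_L1_loc F E \<longrightarrow>
             c_K K * Per E \<Omega> \<le> Liminf (at_right 0) (\<lambda>\<epsilon>. ennreal (1 / (2 * \<epsilon>)) * J1 K \<epsilon> (F \<epsilon>) \<Omega>)))"
proof -
  let ?f0 = "\<lambda>r. indicat_real {0..} r *\<^sub>R Kbar r"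
  have "?f0 \<in> borel_measurable lebesgue" using assms(7) by (simp add: set_borel_measurable_def)
  from completion_ex_borel_measurable_real[OF this]
  obtain g where g: "g \<in> borel_measurable lborel" "AE r in lborel. ?f0 r = g r" by blast
  \<comment> \<open>Truncation at \<open>0\<close> makes the Borel representative nonnegative everywhere, not just almost everywhere.\<close>
  define kb where "kb r = max 0 (g r)" for r
  define K' where "K' h = kb (norm h)" for h :: "real ^ 'n::{finite,linorder}"
  have gm[measurable]: "g \<in> borel_measurable borel" using g(1) by simp
  have kbm[measurable]: "kb \<in> borel_measurable borel" unfolding kb_def by measurable
  have K'm[measurable]: "K' \<in> borel_measurable borel" unfolding K'_def by measurable
  have K'0: "K' h \<ge> 0" for h by (simp add: K'_def kb_def)
  obtain N where N': "\<And>r. r \<in> space lborel - N \<Longrightarrow> ?f0 r = g r" and N: "N \<in> null_sets lborel"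
    by (rule AE_E3[OF g(2)]) (rule that)
  have kb_eq: "Kbar r = kb r" if "r \<ge> 0" "r \<notin> N" for r
  proof -
    have "?f0 r = g r" by (rule N') (use that(2) in simp)
    then show ?thesis using that(1) assms(6)[OF that(1)] by (simp add: kb_def)
  qed
  have KK': "AE h in lborel. K h = K' h"
    using AE_not_in[OF null_set_norm_preimage[OF N]]
    by eventually_elim (simp add: assms(5) K'_def kb_eq)
  have fin: "(\<integral>\<^sup>+h. ennreal (K' h * norm h) \<partial>lborel) < \<infinity>"
  proof -
    have polar: "(\<integral>\<^sup>+h. ennreal (K' h * norm h) \<partial>lborel)
      = ennreal (real DIM(real ^ 'n::{finite,linorder}) * unit_ball_vol DIM(real ^ 'n::{finite,linorder})) * (\<integral>\<^sup>+r\<in>{0..}. ennreal (kb r * r) * ennreal (r ^ (DIM(real ^ 'n::{finite,linorder}) - 1)) \<partial>lborel)"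
      unfolding K'_def by (rule nn_integral_radial) measurable
    have Kb: "(\<integral>\<^sup>+r\<in>{0..}. ennreal (kb r * r) * ennreal (r ^ (DIM(real ^ 'n::{finite,linorder}) - 1)) \<partial>lborel) = (\<integral>\<^sup>+r\<in>{0..}. ennreal (Kbar r * r ^ CARD('n)) \<partial>lborel)"
    proof (rule nn_integral_cong_AE)
      show "AE r in lborel. ennreal (kb r * r) * ennreal (r ^ (DIM(real ^ 'n::{finite,linorder}) - 1)) * indicator {0..} r = ennreal (Kbar r * r ^ CARD('n)) * indicator {0..} r"
        using AE_not_in[OF N]
      proof eventually_elim
        case (elim r)
        show ?case
        proof (cases "r \<ge> 0")
          case True
          have "r * r ^ (CARD('n) - 1) = r ^ CARD('n)" by (simp add: power_eq_if)
          then have "ennreal (kb r * r) * ennreal (r ^ (CARD('n) - 1)) = ennreal (kb r * r ^ CARD('n))"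
            using True by (subst ennreal_mult[symmetric]) (auto simp: kb_def mult.assoc)
          then show ?thesis using True kb_eq[OF True elim] by simp
        qed simp
      qed
    qed
    have "(\<integral>\<^sup>+r\<in>{0..}. ennreal (Kbar r * r ^ CARD('n)) \<partial>lborel) < \<infinity>" using assms(8) by (simp add: nn_integral_completion)
    then show ?thesis unfolding polar Kb by (simp add: ennreal_mult_less_top)
  qed
  let ?i = "Max UNIV :: 'n"
  let ?c2 = "\<integral>\<^sup>+h. ennreal (K' h * \<bar>h $ ?i\<bar>) \<partial>lborel"
  have cK: "c_K K = ?c2 / 2"
  proof -
    have "(\<integral>\<^sup>+h. ennreal (K h * \<bar>h $ ?i\<bar>) \<partial>lborel) = ?c2"
      using KK' by (intro nn_integral_cong_AE) (auto elim!: eventually_mono)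
    then show ?thesis by (simp add: c_K_def nn_integral_completion)
  qed
  have c2fin: "?c2 < \<infinity>"
  proof -
    have "?c2 \<le> (\<integral>\<^sup>+h. ennreal (K' h * norm h) \<partial>lborel)"
      using K'0 by (intro nn_integral_mono ennreal_leI mult_left_mono component_le_norm_cart) auto
    then show ?thesis using fin by (rule le_less_trans)
  qed
  obtain E' where E': "E' \<in> sets borel" and EE': "AE x in lborel. x \<in> E \<longleftrightarrow> x \<in> E'"
    by (rule borel_version[OF assms(9)]) (rule that)
  have Per: "Per E \<Omega> = Per E' \<Omega>" by (rule Per_cong_AE[OF EE' assms(9)]) (use E' in simp)
  have upper: "\<exists>F. (\<forall>\<epsilon>>0. F \<epsilon> \<in> sets lebesgue) \<and> conv_L1_loc F E \<and>
            Limsup (at_right 0) (\<lambda>\<epsilon>. ennreal (1 / \<epsilon>) * J K \<epsilon> (F \<epsilon>) \<Omega>) \<le> c_K K * Per E \<Omega>"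
  proof (cases "Per E \<Omega> < \<infinity>")
    case True
    then have "Per E' \<Omega> < \<infinity>" by (simp add: Per)
    then obtain F where F: "\<And>\<epsilon>. F \<epsilon> \<in> sets borel"
      "\<And>C. compact C \<Longrightarrow> ((\<lambda>\<epsilon>. emeasure lborel (sym_diff (F \<epsilon>) E' \<inter> C)) \<longlongrightarrow> 0) (at_right 0)"
      "Limsup (at_right 0) (\<lambda>\<epsilon>. ennreal (1 / \<epsilon>) * J K' \<epsilon> (F \<epsilon>) \<Omega>) \<le> ?c2 / 2 * Per E' \<Omega>"
      by (rule recovery_family[OF assms(1,3,4) K'm K'0 K'_def fin E']) (rule that)
    show ?thesis
    proof (intro exI[of _ F] conjI allI impI)
      show "F \<epsilon> \<in> sets lebesgue" for \<epsilon> using F(1)[of \<epsilon>] by simp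
      show "conv_L1_loc F E"
        unfolding conv_L1_loc_def
      proof (intro allI impI)
        fix C :: "(real ^ 'n::{finite,linorder}) set" assume C: "compact C"
        have "emeasure lebesgue (sym_diff (F \<epsilon>) E \<inter> C) = emeasure lborel (sym_diff (F \<epsilon>) E' \<inter> C)" for \<epsilon>
          by (rule emeasure_sym_diff_cong_AE[OF _ EE' _ assms(9) F(1) E' C]) (use F(1)[of \<epsilon>] in auto)
        then show "((\<lambda>\<epsilon>. emeasure lebesgue (sym_diff (F \<epsilon>) E \<inter> C)) \<longlongrightarrow> 0) (at_right 0)"
          using F(2)[OF C] by simp
      qed
      have "Limsup (at_right 0) (\<lambda>\<epsilon>. ennreal (1 / \<epsilon>) * J K \<epsilon> (F \<epsilon>) \<Omega>) = Limsup (at_right 0) (\<lambda>\<epsilon>. ennreal (1 / \<epsilon>) * J K' \<epsilon> (F \<epsilon>) \<Omega>)"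
      proof (rule Limsup_eq)
        have J: "J K \<epsilon> (F \<epsilon>) \<Omega> = J K' \<epsilon> (F \<epsilon>) \<Omega>" if "\<epsilon> > 0" for \<epsilon>
          by (rule J_cong_AE[OF KK' _ that]) simp
        show "eventually (\<lambda>\<epsilon>. ennreal (1 / \<epsilon>) * J K \<epsilon> (F \<epsilon>) \<Omega> = ennreal (1 / \<epsilon>) * J K' \<epsilon> (F \<epsilon>) \<Omega>) (at_right 0)"
          using eventually_at_right_less[of "0::real"] by eventually_elim (simp add: J)
      qed
      then show "Limsup (at_right 0) (\<lambda>\<epsilon>. ennreal (1 / \<epsilon>) * J K \<epsilon> (F \<epsilon>) \<Omega>) \<le> c_K K * Per E \<Omega>"
        using F(3) by (simp add: cK Per)
    qed
  next
    case False
    \<comment> \<open>If the constant is positive the right-hand side is infinite. If it is \<open>0\<close>, the product is \<open>0\<close> by the convention for extended reals, but then \<open>K\<close> vanishes almost everywhere and so does the energy.\<close>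
    then have P: "Per E \<Omega> = top" by (simp add: less_top[symmetric])
    have conv: "conv_L1_loc (\<lambda>_. E) E" by (simp add: conv_L1_loc_def)
    show ?thesis
    proof (intro exI[of _ "\<lambda>_. E"] conjI allI impI conv assms(9))
      show "Limsup (at_right 0) (\<lambda>\<epsilon>. ennreal (1 / \<epsilon>) * J K \<epsilon> E \<Omega>) \<le> c_K K * Per E \<Omega>"
      proof (cases "?c2 = 0")
        case True
        have "AE h in lborel. K' h = 0" by (rule kernel_zero_of_directional_zero[OF K'm K'0 K'_def True])
        with KK' have K0: "AE h in lborel. K h = 0" by eventually_elim simp
        have "J K \<epsilon> E \<Omega> = 0" if "\<epsilon> > 0" for \<epsilon>
          using J_cong_AE[of K "\<lambda>_. 0" E E \<epsilon> \<Omega>] K0 that by (simp add: J_def J1_def J2_def scaled_kernel_def)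
        then have "Limsup (at_right 0) (\<lambda>\<epsilon>. ennreal (1 / \<epsilon>) * J K \<epsilon> E \<Omega>) = Limsup (at_right 0) (\<lambda>\<epsilon>::real. 0::ennreal)"
          by (intro Limsup_eq) (use eventually_at_right_less[of "0::real"] in \<open>auto elim!: eventually_mono\<close>)
        then show ?thesis by (simp add: Limsup_const trivial_limit_at_right_real)
      next
        case False
        then have "c_K K \<noteq> 0" by (simp add: cK ennreal_divide_eq_0_iff)
        then show ?thesis by (simp add: P ennreal_mult_top)
      qed
    qed
  qed
  have lower: "c_K K * Per E \<Omega> \<le> Liminf (at_right 0) (\<lambda>\<epsilon>. ennreal (1 / (2 * \<epsilon>)) * J1 K \<epsilon> (F \<epsilon>) \<Omega>)"
    if F: "\<forall>\<epsilon>>0. F \<epsilon> \<in> sets lebesgue" "conv_L1_loc F E" for F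
    unfolding le_Liminf_iff
  proof (intro allI impI)
    fix y assume y: "y < c_K K * Per E \<Omega>"
    show "eventually (\<lambda>\<epsilon>. y < ennreal (1 / (2 * \<epsilon>)) * J1 K \<epsilon> (F \<epsilon>) \<Omega>) (at_right 0)"
    proof (rule sequentially_imp_eventually_at_right[OF zero_less_one])
      fix S :: "nat \<Rightarrow> real" assume S: "\<And>n. 0 < S n" "S \<longlonglongrightarrow> 0"
      have "\<exists>A. A \<in> sets borel \<and> (AE x in lborel. x \<in> F (S n) \<longleftrightarrow> x \<in> A)" for n
      proof -
        have "F (S n) \<in> sets lebesgue" using F(1) S(1) by blast
        then show ?thesis by (rule borel_version) blast
      qed
      then have "\<forall>n. \<exists>A. A \<in> sets borel \<and> (AE x in lborel. x \<in> F (S n) \<longleftrightarrow> x \<in> A)" by blast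
      from choice[OF this] obtain F' where F': "\<And>n. F' n \<in> sets borel" "\<And>n. AE x in lborel. x \<in> F (S n) \<longleftrightarrow> x \<in> F' n" by blast
      have SR: "filterlim S (at_right 0) sequentially"
        using S(2) by (simp add: filterlim_at S(1) less_imp_neq[OF S(1), symmetric])
      have lim: "(\<lambda>n. emeasure lborel (sym_diff (F' n) E' \<inter> C)) \<longlonglongrightarrow> 0" if C: "compact C" for C
      proof -
        have "(\<lambda>n. emeasure lebesgue (sym_diff (F (S n)) E \<inter> C)) \<longlonglongrightarrow> 0"
          using F(2) C by (intro filterlim_compose[OF _ SR]) (auto simp: conv_L1_loc_def)
        moreover have "emeasure lebesgue (sym_diff (F (S n)) E \<inter> C) = emeasure lborel (sym_diff (F' n) E' \<inter> C)" for n
          by (rule emeasure_sym_diff_cong_AE[OF F'(2) EE' _ assms(9) F'(1) E' C]) (use F(1) S(1) in simp)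
        ultimately show ?thesis by simp
      qed
      have "c_K K * Per E \<Omega> \<le> liminf (\<lambda>n. ennreal (1 / (2 * S n)) * J1 K' (S n) (F' n) \<Omega>)"
        unfolding cK Per by (rule sequential_lower_bound[OF assms(1) K'm K'0 K'_def c2fin E' F'(1) lim S])
      also have "\<dots> = liminf (\<lambda>n. ennreal (1 / (2 * S n)) * J1 K (S n) (F (S n)) \<Omega>)"
        by (simp add: J1_cong_AE[OF KK' F'(2) S(1)])
      finally show "eventually (\<lambda>n. y < ennreal (1 / (2 * S n)) * J1 K (S n) (F (S n)) \<Omega>) sequentially"
        using y unfolding le_Liminf_iff by blast
    qed
  qed
  show ?thesis using upper lower by blast
qed

end
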